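(* Let $\sigma$ be a triangulation of a polygon $P$ with $n\ge3$ vertices, $\Gamma_\sigma$ its frozen Jacobian algebra, regarded as an $R$-algebra via $x\mapsto C$ (see context), and $e_F=\sum_{i\in F}e_i$. Then the $R$-order $e_F\Gamma_\sigma e_F$ is isomorphic, as an $R$-order, to the tiled $R$-order $\Lambda\subset M_n(K(x))$ whose $(i,j)$ entry ranges over $x^{c_{ij}}R$, where $c_{ij}=0$ if $i\le j$ and $(i,j)\ne(1,n)$, $c_{1n}=-1$, $c_{ij}=1$ if $i=j+1$, and $c_{ij}=2$ if $i\ge j+2$; i.e. $$\Lambda=\begin{bmatrix} R&R&\cdots&R&(x^{-1})\\ (x)&R&\cdots&R&R\\ (x^2)&(x)&\cdots&R&R\\ \vdots&&\ddots&&\vdots\\ (x^2)&(x^2)&\cdots&(x)&R\end{bmatrix}.$$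
   Context: Let $K$ be a field and $R=K[x]$. Let $P$ be a regular polygon with $n\ge3$ vertices $P_1,\dots,P_n$ labelled counterclockwise; a triangulation $\sigma$ is a decomposition of $P$ into triangles by a maximal set of pairwise non-crossing diagonals (diagonals are segments between vertices lying in the interior of $P$; crossing means sharing an interior point). The quiver $Q_\sigma$ has as vertices the edges of $\sigma$ (sides of $P$ and diagonals of $\sigma$); for two edges $a,b$ which are sides of a common triangle of $\sigma$ there is an internal arrow $a\to b$ if $a$ precedes $b$ anticlockwise around their common vertex; for each vertex of $P$ incident to at least one diagonal there is an external arrow $a\to b$ between the two sides of $P$ at that vertex, $a$ preceding $b$ anticlockwise around it. Minimal cycles are the cycles without repeated arrows enclosing a region with connected interior containing no arrow: cyclic triangles (three internal arrows in a triangle of $\sigma$) and big cycles (internal arrows plus one external arrow around a vertex of $P$). $W_\sigma=\sum\text{cyclic triangles}-\sum\text{big cycles}$; $F$ = set of vertices corresponding to sides of $P$; $\Gamma_\sigma=KQ_\sigma/J$ where $J$ is generated by the cyclic derivatives $\partial_aW_\sigma$ ($\partial_a(a_1\cdots a_d)=\sum_{a_i=a}a_{i+1}\cdots a_da_1\cdots a_{i-1}$) for arrows $a$ with source or target outside $F$. $e_i$ is the trivial path at vertex $i$. All minimal cycles through a vertex $i$ (as cycles at $i$) coincide in $\Gamma_\sigma$; call their common class $C_i$ and set $C=\sum_iC_i$. The $R$-algebra structure on $\Gamma_\sigma$ is given by $x^k\mapsto C^k$. An $R$-order is an $R$-algebra finitely generated and free as an $R$-module. *)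

theory Defs
  imports "HOL-Algebra.QuotRing"
          "HOL-Computational_Algebra.Polynomial"
          "HOL-Computational_Algebra.Fraction_Field"
          "Jordan_Normal_Form.Matrix"
          "HOL-Library.Function_Algebras"
begin

text \<open>The polygon P has vertices 0,...,n-1 (P_(i+1) corresponds to i), labelled
  counterclockwise.  An edge is a two-element set of polygon vertices.\<close>

definition side :: "nat \<Rightarrow> nat \<Rightarrow> nat set" where
  "side n i = {i, (i + 1) mod n}"

definition is_side :: "nat \<Rightarrow> nat set \<Rightarrow> bool" where
  "is_side n e \<longleftrightarrow> (\<exists>i<n. e = side n i)"

definition is_diag :: "nat \<Rightarrow> nat set \<Rightarrow> bool" where
  "is_diag n e \<longleftrightarrow> (\<exists>a b. a < n \<and> b < n \<and> a \<noteq> b \<and> e = {a, b}) \<and> \<not> is_side n e"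

definition ccw_off :: "nat \<Rightarrow> nat \<Rightarrow> nat \<Rightarrow> nat" where
  "ccw_off n a c = (c + n - a) mod n"

definition strictly_between :: "nat \<Rightarrow> nat \<Rightarrow> nat \<Rightarrow> nat \<Rightarrow> bool" where
  "strictly_between n a b c \<longleftrightarrow> 0 < ccw_off n a c \<and> ccw_off n a c < ccw_off n a b"

text \<open>Two diagonals of a convex (regular) polygon cross, i.e. share an interior point,
  iff their four endpoints are distinct and interleave cyclically.\<close>
definition crosses :: "nat \<Rightarrow> nat set \<Rightarrow> nat set \<Rightarrow> bool" where
  "crosses n e f \<longleftrightarrow> (\<exists>a b c d. e = {a, b} \<and> f = {c, d} \<and> card {a, b, c, d} = 4 \<and>
      (strictly_between n a b c \<noteq> strictly_between n a b d))"

definition triangulation :: "nat \<Rightarrow> nat set set \<Rightarrow> bool" where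
  "triangulation n \<sigma> \<longleftrightarrow>
     (\<forall>e\<in>\<sigma>. is_diag n e) \<and>
     (\<forall>e\<in>\<sigma>. \<forall>f\<in>\<sigma>. \<not> crosses n e f) \<and>
     (\<forall>d. is_diag n d \<and> d \<notin> \<sigma> \<longrightarrow> (\<exists>e\<in>\<sigma>. crosses n d e))"

definition edges :: "nat \<Rightarrow> nat set set \<Rightarrow> nat set set" where
  "edges n \<sigma> = \<sigma> \<union> {e. is_side n e}"

text \<open>Triangles of sigma (three polygon vertices pairwise joined by edges of sigma;
  for a triangulation of a convex polygon these are exactly the triangles of the
  decomposition).\<close>
definition triangles :: "nat \<Rightarrow> nat set set \<Rightarrow> nat set set" where
  "triangles n \<sigma> = {{a, b, c} | a b c. a < b \<and> b < c \<and> c < n \<and>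
      {a, b} \<in> edges n \<sigma> \<and> {b, c} \<in> edges n \<sigma> \<and> {a, c} \<in> edges n \<sigma>}"

text \<open>Vertices of Q_sigma are edges of sigma; arrows are pairs (source, target)
  (Q_sigma has at most one arrow between two vertices).  Around a polygon vertex v
  the edges {v,a} are ordered anticlockwise by the counterclockwise offset of a from v.\<close>

definition internal_arrow :: "nat \<Rightarrow> nat set set \<Rightarrow> nat set \<Rightarrow> nat set \<Rightarrow> bool" where
  "internal_arrow n \<sigma> x y \<longleftrightarrow>
     (\<exists>T\<in>triangles n \<sigma>. \<exists>v a b. v \<in> T \<and> a \<in> T \<and> b \<in> T \<and> x = {v, a} \<and> y = {v, b} \<and>
        v \<noteq> a \<and> v \<noteq> b \<and> a \<noteq> b \<and> ccw_off n v a < ccw_off n v b)"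

text \<open>External arrow at a polygon vertex v incident to a diagonal: it goes from the
  side {v-1,v} to the side {v,v+1}, i.e. anticlockwise around v through the exterior
  of P (so that it closes the big cycle around v).\<close>
definition external_arrow :: "nat \<Rightarrow> nat set set \<Rightarrow> nat set \<Rightarrow> nat set \<Rightarrow> bool" where
  "external_arrow n \<sigma> x y \<longleftrightarrow>
     (\<exists>v<n. (\<exists>d\<in>\<sigma>. v \<in> d) \<and> x = {v, (v + n - 1) mod n} \<and> y = {v, (v + 1) mod n})"

definition arrows :: "nat \<Rightarrow> nat set set \<Rightarrow> (nat set \<times> nat set) set" where
  "arrows n \<sigma> = {(x, y). internal_arrow n \<sigma> x y \<or> external_arrow n \<sigma> x y}"

text \<open>Paths are nonempty lists of vertices of Q_sigma, consecutive ones joined by an arrow;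
  [i] is the trivial path e_i.\<close>
definition is_path :: "nat \<Rightarrow> nat set set \<Rightarrow> nat set list \<Rightarrow> bool" where
  "is_path n \<sigma> p \<longleftrightarrow> p \<noteq> [] \<and> set p \<subseteq> edges n \<sigma> \<and>
     (\<forall>i. Suc i < length p \<longrightarrow> (p ! i, p ! Suc i) \<in> arrows n \<sigma>)"

text \<open>Cyclic triangle of the triangle T = {p,q,r}, p<q<r (counterclockwise order),
  as a closed path starting and ending at {p,q}.\<close>
definition tri_cycle :: "nat set \<Rightarrow> nat set list" where
  "tri_cycle T = (let p = Min T; r = Max T; q = (THE q. q \<in> T \<and> q \<noteq> p \<and> q \<noteq> r)
                  in [{p, q}, {p, r}, {q, r}, {p, q}])"

text \<open>Big cycle around the polygon vertex v: the edges at v in anticlockwise order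
  {v,v+1}, ..., {v,v-1}, joined by internal arrows, closed by the external arrow.\<close>
definition big_cycle :: "nat \<Rightarrow> nat set set \<Rightarrow> nat \<Rightarrow> nat set list" where
  "big_cycle n \<sigma> v =
     map (\<lambda>k. {v, (v + k) mod n}) (filter (\<lambda>k. {v, (v + k) mod n} \<in> edges n \<sigma>) [1..<n])
     @ [{v, (v + 1) mod n}]"

definition big_vertices :: "nat \<Rightarrow> nat set set \<Rightarrow> nat set" where
  "big_vertices n \<sigma> = {v. v < n \<and> (\<exists>d\<in>\<sigma>. v \<in> d)}"

text \<open>rotation of a closed path c = [v0,...,vd] (v0 = vd) to start at position j\<close>
definition rotate_cycle :: "nat \<Rightarrow> 'a list \<Rightarrow> 'a list" where
  "rotate_cycle j c = drop j c @ tl (take (Suc j) c)"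

definition min_cycles_at :: "nat \<Rightarrow> nat set set \<Rightarrow> nat set \<Rightarrow> nat set list set" where
  "min_cycles_at n \<sigma> i =
     {rotate_cycle j c | c j. (c \<in> tri_cycle ` triangles n \<sigma> \<or> c \<in> big_cycle n \<sigma> ` big_vertices n \<sigma>)
        \<and> j < length c - 1 \<and> c ! j = i}"

type_synonym 'k pathalg = "nat set list \<Rightarrow> 'k"

definition path_elem :: "nat set list \<Rightarrow> 'k::field pathalg" where
  "path_elem p = (\<lambda>r. if r = p then 1 else 0)"

definition pmult :: "'k::field pathalg \<Rightarrow> 'k pathalg \<Rightarrow> 'k pathalg" where
  "pmult f g = (\<lambda>r. \<Sum>p\<in>{p. f p \<noteq> 0}. \<Sum>q\<in>{q. g q \<noteq> 0}.
                    if last p = hd q \<and> p @ tl q = r then f p * g q else 0)"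

definition path_algebra :: "nat \<Rightarrow> nat set set \<Rightarrow> 'k::field pathalg ring" where
  "path_algebra n \<sigma> = \<lparr>
     carrier = {f. finite {p. f p \<noteq> 0} \<and> (\<forall>p. f p \<noteq> 0 \<longrightarrow> is_path n \<sigma> p)},
     Group.monoid.mult = pmult,
     one = (\<Sum>i\<in>edges n \<sigma>. path_elem [i]),
     zero = (\<lambda>_. 0),
     add = (\<lambda>f g r. f r + g r)\<rparr>"

definition scal :: "'k::field \<Rightarrow> 'k pathalg \<Rightarrow> 'k pathalg" where
  "scal c f = (\<lambda>r. c * f r)"

text \<open>Cyclic derivative of a closed path c = [v0,...,vd] with arrows a_i = (v_(i-1), v_i):
  the sum over i with a_i = a of a_(i+1)...a_d a_1...a_(i-1).\<close>
definition cyc_deriv :: "nat set \<times> nat set \<Rightarrow> nat set list \<Rightarrow> 'k::field pathalg" where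
  "cyc_deriv a c = (\<lambda>r. of_nat (card {i. 1 \<le> i \<and> i < length c \<and> (c ! (i - 1), c ! i) = a \<and>
                                        drop i c @ tl (take i c) = r}))"

definition potential :: "nat \<Rightarrow> nat set set \<Rightarrow> 'k::field pathalg" where
  "potential n \<sigma> = (\<Sum>T\<in>triangles n \<sigma>. path_elem (tri_cycle T))
                   - (\<Sum>v\<in>big_vertices n \<sigma>. path_elem (big_cycle n \<sigma> v))"

definition dW :: "nat \<Rightarrow> nat set set \<Rightarrow> nat set \<times> nat set \<Rightarrow> 'k::field pathalg" where
  "dW n \<sigma> a = (\<Sum>T\<in>triangles n \<sigma>. cyc_deriv a (tri_cycle T))
               - (\<Sum>v\<in>big_vertices n \<sigma>. cyc_deriv a (big_cycle n \<sigma> v))"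

definition frozen :: "nat \<Rightarrow> nat set set" where
  "frozen n = {e. is_side n e}"

definition jac_ideal :: "nat \<Rightarrow> nat set set \<Rightarrow> 'k::field pathalg set" where
  "jac_ideal n \<sigma> = genideal (path_algebra n \<sigma>)
      {dW n \<sigma> a | a. a \<in> arrows n \<sigma> \<and> (fst a \<notin> frozen n \<or> snd a \<notin> frozen n)}"

definition frozen_jacobian :: "nat \<Rightarrow> nat set set \<Rightarrow> 'k::field pathalg set ring" where
  "frozen_jacobian n \<sigma> = path_algebra n \<sigma> Quot jac_ideal n \<sigma>"

definition cls :: "nat \<Rightarrow> nat set set \<Rightarrow> 'k::field pathalg \<Rightarrow> 'k pathalg set" where
  "cls n \<sigma> f = jac_ideal n \<sigma> +>\<^bsub>path_algebra n \<sigma>\<^esub> f"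

text \<open>C = sum over vertices i of (a representative of) the minimal cycle class C_i.\<close>
definition C_elem :: "nat \<Rightarrow> nat set set \<Rightarrow> 'k::field pathalg" where
  "C_elem n \<sigma> = (\<Sum>i\<in>edges n \<sigma>. path_elem (SOME c. c \<in> min_cycles_at n \<sigma> i))"

definition rho_Gamma :: "nat \<Rightarrow> nat set set \<Rightarrow> 'k::field poly \<Rightarrow> 'k pathalg set" where
  "rho_Gamma n \<sigma> p = cls n \<sigma>
     (finsum (path_algebra n \<sigma>)
        (\<lambda>k. scal (coeff p k) (C_elem n \<sigma> [^]\<^bsub>path_algebra n \<sigma>\<^esub> k)) {..degree p})"

definition eF :: "nat \<Rightarrow> nat set set \<Rightarrow> 'k::field pathalg set" where
  "eF n \<sigma> = cls n \<sigma> (\<Sum>i\<in>frozen n. path_elem [i])"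

definition corner :: "('a, 'b) ring_scheme \<Rightarrow> 'a \<Rightarrow> 'a ring" where
  "corner A e = \<lparr>carrier = {e \<otimes>\<^bsub>A\<^esub> a \<otimes>\<^bsub>A\<^esub> e | a. a \<in> carrier A},
                  Group.monoid.mult = Group.monoid.mult A, one = e, zero = zero A, add = add A\<rparr>"

text \<open>Exponents c_ij, with 0-based indices i,j < n (i.e. c_(i+1)(j+1) of the paper).\<close>
definition tile_exp :: "nat \<Rightarrow> nat \<Rightarrow> nat \<Rightarrow> int" where
  "tile_exp n i j =
     (if i \<le> j then (if i = 0 \<and> j = n - 1 then -1 else 0)
      else if i = j + 1 then 1 else 2)"

definition xpowR :: "int \<Rightarrow> 'k::field poly fract set" where
  "xpowR c = {Fract p 1 * power_int (Fract [:0, 1:] 1) c | p. True}"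

definition tiled_order :: "nat \<Rightarrow> 'k::field poly fract mat ring" where
  "tiled_order n = \<lparr>
     carrier = {A \<in> carrier_mat n n. \<forall>i<n. \<forall>j<n. A $$ (i, j) \<in> xpowR (tile_exp n i j)},
     Group.monoid.mult = (*), one = 1\<^sub>m n, zero = 0\<^sub>m n n, add = (+)\<rparr>"

definition rho_Lambda :: "nat \<Rightarrow> 'k::field poly \<Rightarrow> 'k poly fract mat" where
  "rho_Lambda n p = Fract p 1 \<cdot>\<^sub>m 1\<^sub>m n"

end

theory Submission
  imports Defs
begin

text \<open>
  Lift an edge of \<open>\<sigma>\<close> to the integer pairs \<open>(a, b)\<close> with \<open>a < b < a + n\<close> that reduce to it
  modulo \<open>n\<close>; the lifts of one edge form a single orbit of the twist \<open>(a, b) \<mapsto> (b, a + n)\<close>.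
  An internal arrow raises one coordinate of a lift, an external arrow raises both by one, and a
  minimal cycle performs one twist.  If two different arrows leave a lift and both of their targets
  lie below a lift \<open>Y\<close>, then the non-crossing property makes one side of a Jacobian relation end below
  \<open>Y\<close>, and every lift below \<open>Y\<close> is joined to \<open>Y\<close> by a path.  Hence paths of the lifted quiver with the
  same ends agree in \<open>\<Gamma>\<^sub>\<sigma>\<close>, so the Jacobian ideal consists of the combinations of paths whose
  coefficients sum to zero over the paths with given source, target and degree.  A path from side
  \<open>i\<close> to side \<open>j\<close> is thus known by the number \<open>l\<close> of twists at its end; it is sent to \<open>x\<^sup>l\<close>, and the
  coordinatewise order shows that \<open>l\<close> takes exactly the values \<open>l \<ge> c\<^sub>i\<^sub>j\<close>.
\<close>

section \<open>The path algebra\<close>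

text \<open>The obstacle is to show that the Jacobian relations identify enough paths: they are
  imposed only at arrows with an end that is not a side, and no cancellation law or dimension count
  is at hand. A confluence argument graded by \<open>level\<close>, the sum of the two coordinates
  of a lift, takes the place of cancellation. Two diverging steps are completed to a diamond, and
  the diamond must stay below the common end \<open>Y\<close> of the paths being compared; this is
  why \<open>progress\<close> and \<open>joinable\<close> are stated relative to \<open>Y\<close>. A
  lift and its twist carry the same local picture, so the geometry is worked out only for lifts
  \<open>(v, b)\<close> with \<open>v + 2 \<le> b\<close>. Distinct lifts of one edge differ in
  level, so source, target and degree fix the end of a lifted path. The exponent -1 has its origin
  in the side \<open>{n-1, 0}\<close>: its lift \<open>(0, n - 1)\<close> comes one twist before
  \<open>(n - 1, n)\<close> and already lies above \<open>(0, 1)\<close>.\<close>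

definition weighted_sum :: "('p \<Rightarrow> 'k::zero \<Rightarrow> 'b::comm_monoid_add) \<Rightarrow> ('p \<Rightarrow> 'k) \<Rightarrow> 'b" where
  "weighted_sum h f = (\<Sum>p | f p \<noteq> 0. h p (f p))"

text \<open>Only additivity in the coefficient is asked, with an arbitrary target, so that one
  treatment of products covers coefficients of \<open>pmult\<close>, sums over classes of paths, and
  entries in the fraction field.\<close>

definition additive_weight :: "('p \<Rightarrow> 'k::monoid_add \<Rightarrow> 'b::comm_monoid_add) \<Rightarrow> bool" where
  "additive_weight h \<longleftrightarrow> (\<forall>p. h p 0 = 0 \<and> (\<forall>x y. h p (x + y) = h p x + h p y))"

lemma weighted_sum_superset:
  assumes "finite S" "{p. f p \<noteq> 0} \<subseteq> S" "\<And>p. h p 0 = 0"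
  shows "weighted_sum h f = (\<Sum>p\<in>S. h p (f p))"
  unfolding weighted_sum_def by (rule sum.mono_neutral_left) (use assms in auto)

lemma weighted_sum_add:
  fixes f g :: "'p \<Rightarrow> 'k::monoid_add"
  assumes "finite {p. f p \<noteq> 0}" "finite {p. g p \<noteq> 0}" "additive_weight h"
  shows "weighted_sum h (\<lambda>p. f p + g p) = weighted_sum h f + weighted_sum h g"
proof -
  let ?S = "{p. f p \<noteq> 0} \<union> {p. g p \<noteq> 0}"
  have h: "\<And>p. h p 0 = 0" "\<And>p x y. h p (x + y) = h p x + h p y"
    using assms(3) by (auto simp: additive_weight_def)
  have "weighted_sum h (\<lambda>p. f p + g p) = (\<Sum>p\<in>?S. h p (f p + g p))"
    by (rule weighted_sum_superset) (use assms h in auto)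
  also have "\<dots> = (\<Sum>p\<in>?S. h p (f p)) + (\<Sum>p\<in>?S. h p (g p))"
    by (simp add: h sum.distrib)
  also have "(\<Sum>p\<in>?S. h p (f p)) = weighted_sum h f"
    by (rule weighted_sum_superset[symmetric]) (use assms h in auto)
  also have "(\<Sum>p\<in>?S. h p (g p)) = weighted_sum h g"
    by (rule weighted_sum_superset[symmetric]) (use assms h in auto)
  finally show ?thesis .
qed

lemma weighted_sum_zero [simp]: "weighted_sum h (\<lambda>_. 0) = 0"
  by (simp add: weighted_sum_def)

lemma weighted_sum_path_elem:
  assumes "additive_weight h"
  shows "weighted_sum h (path_elem p :: 'k::field pathalg) = h p 1"
proof -
  have "{q. (path_elem p :: 'k pathalg) q \<noteq> 0} = {p}" by (auto simp: path_elem_def)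
  then show ?thesis by (simp add: weighted_sum_def path_elem_def)
qed

lemma supp_pmult:
  "{r. pmult f g r \<noteq> 0} \<subseteq> (\<lambda>(p, q). p @ tl q) ` {(p, q). f p \<noteq> 0 \<and> g q \<noteq> 0 \<and> last p = hd q}"
proof
  fix r assume "r \<in> {r. pmult f g r \<noteq> 0}"
  then have "(\<Sum>p\<in>{p. f p \<noteq> 0}. \<Sum>q\<in>{q. g q \<noteq> 0}. if last p = hd q \<and> p @ tl q = r then f p * g q else 0) \<noteq> 0"
    by (simp add: pmult_def)
  then obtain p where p: "p \<in> {p. f p \<noteq> 0}"
      "(\<Sum>q\<in>{q. g q \<noteq> 0}. if last p = hd q \<and> p @ tl q = r then f p * g q else 0) \<noteq> 0"
    by (rule sum.not_neutral_contains_not_neutral)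
  from p(2) obtain q where q: "q \<in> {q. g q \<noteq> 0}"
      "(if last p = hd q \<and> p @ tl q = r then f p * g q else 0) \<noteq> 0"
    by (rule sum.not_neutral_contains_not_neutral)
  then have "last p = hd q" "p @ tl q = r" by (meson)+
  then show "r \<in> (\<lambda>(p, q). p @ tl q) ` {(p, q). f p \<noteq> 0 \<and> g q \<noteq> 0 \<and> last p = hd q}"
    using p q by auto
qed

lemma finite_supp_pmult:
  assumes "finite {p. f p \<noteq> 0}" "finite {p. g p \<noteq> 0}"
  shows "finite {r. pmult f g r \<noteq> 0}"
proof (rule finite_subset[OF supp_pmult], rule finite_imageI, rule finite_subset)
  show "{(p, q). f p \<noteq> 0 \<and> g q \<noteq> 0 \<and> last p = hd q} \<subseteq> {p. f p \<noteq> 0} \<times> {p. g p \<noteq> 0}" by auto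
qed (use assms in auto)

text \<open>Grouping the pairs of factors by their concatenation is undone by the outer sum, so a
  sum over the paths of a product becomes a double sum over composable pairs. Associativity, class
  sums and matrix entries of products all rest on this exchange.\<close>

lemma weighted_sum_pmult:
  assumes fin: "finite {p. f p \<noteq> 0}" "finite {p. g p \<noteq> 0}" and h: "additive_weight h"
  shows "weighted_sum h (pmult f g) =
    (\<Sum>p | f p \<noteq> 0. \<Sum>q | g q \<noteq> 0. if last p = hd q then h (p @ tl q) (f p * g q) else 0)"
proof -
  let ?F = "{p. f p \<noteq> 0}" and ?G = "{p. g p \<noteq> 0}"
  let ?R = "(\<lambda>(p, q). p @ tl q) ` (?F \<times> ?G)"
  have h0: "h p 0 = 0" for p using h by (simp add: additive_weight_def)
  have hs: "h p (sum a S) = (\<Sum>s\<in>S. h p (a s))" for p S and a :: "nat set list \<Rightarrow> _"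
    by (induction S rule: infinite_finite_induct) (use h in \<open>auto simp: additive_weight_def\<close>)
  have "weighted_sum h (pmult f g) = (\<Sum>r\<in>?R. h r (pmult f g r))"
  proof (rule weighted_sum_superset)
    show "{r. pmult f g r \<noteq> 0} \<subseteq> ?R" using supp_pmult[of f g] by (auto simp: image_iff)
  qed (use fin h0 in auto)
  also have "\<dots> = (\<Sum>r\<in>?R. \<Sum>p\<in>?F. \<Sum>q\<in>?G. if last p = hd q \<and> p @ tl q = r then h r (f p * g q) else 0)"
    unfolding pmult_def hs by (intro sum.cong refl) (auto simp: h0)
  also have "\<dots> = (\<Sum>p\<in>?F. \<Sum>q\<in>?G. \<Sum>r\<in>?R. if last p = hd q \<and> p @ tl q = r then h r (f p * g q) else 0)"
    by (subst sum.swap, rule sum.cong[OF refl], rule sum.swap)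
  also have "\<dots> = (\<Sum>p\<in>?F. \<Sum>q\<in>?G. if last p = hd q then h (p @ tl q) (f p * g q) else 0)"
  proof (intro sum.cong refl)
    fix p q assume pq: "p \<in> ?F" "q \<in> ?G"
    have "(\<Sum>r\<in>?R. if last p = hd q \<and> p @ tl q = r then h r (f p * g q) else 0)
       = (\<Sum>r\<in>?R. if r = p @ tl q then (if last p = hd q then h r (f p * g q) else 0) else 0)"
      by (intro sum.cong refl) auto
    also have "\<dots> = (if last p = hd q then h (p @ tl q) (f p * g q) else 0)"
      using pq fin by (subst sum.delta) auto
    finally show "(\<Sum>r\<in>?R. if last p = hd q \<and> p @ tl q = r then h r (f p * g q) else 0)
       = (if last p = hd q then h (p @ tl q) (f p * g q) else 0)" .
  qed
  finally show ?thesis .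
qed

lemma additive_weight_sum_left:
  "additive_weight (\<lambda>p (c :: 'k::semiring_0). \<Sum>q\<in>S. if P p q then c * g q else 0)"
proof -
  have "(\<Sum>q\<in>S. if P p q then (x + y) * g q else 0)
      = (\<Sum>q\<in>S. (if P p q then x * g q else 0) + (if P p q then y * g q else 0))" for p x y
    by (rule sum.cong) (auto simp: distrib_right)
  then show ?thesis by (auto simp: additive_weight_def sum.distrib intro!: sum.neutral)
qed

lemma additive_weight_sum_right:
  "additive_weight (\<lambda>p (c :: 'k::semiring_0). \<Sum>q\<in>S. if P p q then g q * c else 0)"
proof -
  have "(\<Sum>q\<in>S. if P p q then g q * (x + y) else 0)
      = (\<Sum>q\<in>S. (if P p q then g q * x else 0) + (if P p q then g q * y else 0))" for p x y
    by (rule sum.cong) (auto simp: distrib_left)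
  then show ?thesis by (auto simp: additive_weight_def sum.distrib intro!: sum.neutral)
qed

lemma pmult_eq_weighted_sum_left:
  "pmult f g r = weighted_sum (\<lambda>p c. \<Sum>q | g q \<noteq> 0. if last p = hd q \<and> p @ tl q = r then c * g q else 0) f"
  by (simp add: pmult_def weighted_sum_def)

lemma pmult_eq_weighted_sum_right:
  assumes "finite {p. f p \<noteq> 0}" "finite {p. g p \<noteq> 0}"
  shows "pmult f g r = weighted_sum (\<lambda>q c. \<Sum>p | f p \<noteq> 0. if last p = hd q \<and> p @ tl q = r then f p * c else 0) g"
  unfolding pmult_def weighted_sum_def by (rule sum.swap)

text \<open>Each side is a \<open>weighted_sum\<close> over a product, with the outer factor
  absorbed into the weight. The middle factor must vanish at the empty list because appending
  \<open>tl []\<close> would leave the end of the path at \<open>last p\<close> instead of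
  \<open>last q\<close>.\<close>

lemma pmult_assoc:
  assumes fin: "finite {p. f p \<noteq> 0}" "finite {p. g p \<noteq> 0}" "finite {p. h p \<noteq> 0}"
    and ne: "g [] = 0"
  shows "pmult (pmult f g) h = pmult f (pmult g h)"
proof
  fix r
  let ?F = "{p. f p \<noteq> 0}" and ?G = "{p. g p \<noteq> 0}" and ?H = "{p. h p \<noteq> 0}"
  have "pmult (pmult f g) h r =
     (\<Sum>p\<in>?F. \<Sum>q\<in>?G. if last p = hd q then
        (\<Sum>s\<in>?H. if last (p @ tl q) = hd s \<and> (p @ tl q) @ tl s = r then f p * g q * h s else 0) else 0)"
    unfolding pmult_eq_weighted_sum_left[of "pmult f g"]
    by (rule weighted_sum_pmult)
       (use fin in \<open>auto intro: additive_weight_sum_left\<close>)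
  also have "\<dots> = (\<Sum>p\<in>?F. \<Sum>q\<in>?G. \<Sum>s\<in>?H. if last q = hd s then
      (if last p = hd (q @ tl s) \<and> p @ tl (q @ tl s) = r then f p * (g q * h s) else 0) else 0)"
  proof (intro sum.cong refl)
    fix p q assume "q \<in> ?G"
    then have "q \<noteq> []" using ne by auto
    then have "last p = hd q \<Longrightarrow> last (p @ tl q) = last q" for p :: "nat set list"
      by (cases q) auto
    moreover have "hd (q @ tl s) = hd q" "tl (q @ tl s) = tl q @ tl s" for s :: "nat set list"
      using \<open>q \<noteq> []\<close> by auto
    ultimately show "(if last p = hd q then
        (\<Sum>s\<in>?H. if last (p @ tl q) = hd s \<and> (p @ tl q) @ tl s = r then f p * g q * h s else 0) else 0)
      = (\<Sum>s\<in>?H. if last q = hd s then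
      (if last p = hd (q @ tl s) \<and> p @ tl (q @ tl s) = r then f p * (g q * h s) else 0) else 0)"
      by (cases "last p = hd q") (simp_all add: mult.assoc cong: if_cong, intro sum.cong refl, simp)
  qed
  also have "\<dots> = (\<Sum>q\<in>?G. \<Sum>s\<in>?H. \<Sum>p\<in>?F. if last q = hd s then
      (if last p = hd (q @ tl s) \<and> p @ tl (q @ tl s) = r then f p * (g q * h s) else 0) else 0)"
    by (subst sum.swap, rule sum.cong[OF refl], rule sum.swap)
  also have "\<dots> = (\<Sum>q\<in>?G. \<Sum>s\<in>?H. if last q = hd s then
      (\<Sum>p\<in>?F. if last p = hd (q @ tl s) \<and> p @ tl (q @ tl s) = r then f p * (g q * h s) else 0) else 0)"
    by (intro sum.cong refl) auto
  also have "\<dots> = pmult f (pmult g h) r"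
    unfolding pmult_eq_weighted_sum_right[OF fin(1) finite_supp_pmult[OF fin(2,3)]]
    by (rule weighted_sum_pmult[symmetric])
       (use fin in \<open>auto intro: additive_weight_sum_right\<close>)
  finally show "pmult (pmult f g) h r = pmult f (pmult g h) r" .
qed

lemma pmult_add_left:
  assumes "finite {p. f p \<noteq> 0}" "finite {p. g p \<noteq> 0}" "finite {p. h p \<noteq> 0}"
  shows "pmult (\<lambda>r. f r + g r) h = (\<lambda>r. pmult f h r + pmult g h r)"
  unfolding pmult_eq_weighted_sum_left
  by (rule ext, rule weighted_sum_add)
     (use assms in \<open>auto intro: additive_weight_sum_left\<close>)

lemma pmult_add_right:
  assumes "finite {p. f p \<noteq> 0}" "finite {p. g p \<noteq> 0}" "finite {p. h p \<noteq> 0}"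
  shows "pmult h (\<lambda>r. f r + g r) = (\<lambda>r. pmult h f r + pmult h g r)"
proof
  fix r
  have fin: "finite {r. f r + g r \<noteq> 0}"
    by (rule finite_subset[of _ "{p. f p \<noteq> 0} \<union> {p. g p \<noteq> 0}"]) (use assms in auto)
  show "pmult h (\<lambda>r. f r + g r) r = pmult h f r + pmult h g r"
    unfolding pmult_eq_weighted_sum_right[OF assms(3) fin]
      pmult_eq_weighted_sum_right[OF assms(3,1)] pmult_eq_weighted_sum_right[OF assms(3,2)]
    by (rule weighted_sum_add)
       (use assms in \<open>auto intro: additive_weight_sum_right\<close>)
qed

lemma pmult_path_elem:
  "pmult (path_elem p) (path_elem q) = (if last p = hd q then path_elem (p @ tl q) else (\<lambda>_. 0))"
proof
  fix r
  have s: "{q'. (path_elem q :: 'a pathalg) q' \<noteq> 0} = {q}" for q by (auto simp: path_elem_def)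
  show "pmult (path_elem p) (path_elem q) r = (if last p = hd q then path_elem (p @ tl q) else (\<lambda>_. 0)) r"
    unfolding pmult_def s by (auto simp: path_elem_def)
qed

lemma sum_fun_apply: "(\<Sum>i\<in>S. f i) x = (\<Sum>i\<in>S. f i x)"
  by (induction S rule: infinite_finite_induct) auto

lemma sum_trivial_paths_apply:
  assumes "finite S"
  shows "(\<Sum>i\<in>S. path_elem [i]) r = (if length r = 1 \<and> hd r \<in> S then 1 else (0 :: 'k::field))"
proof -
  have "(\<Sum>i\<in>S. path_elem [i] r) = (\<Sum>i\<in>S. if i = hd r then (if length r = 1 then 1 else (0 :: 'k)) else 0)"
    by (rule sum.cong[OF refl]) (auto simp: path_elem_def length_Suc_conv)
  also have "\<dots> = (if length r = 1 \<and> hd r \<in> S then 1 else 0)"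
    using assms by (simp add: sum.delta)
  finally show ?thesis by (simp add: sum_fun_apply)
qed

lemma supp_trivial_paths:
  assumes "finite S"
  shows "{r. (\<Sum>i\<in>S. path_elem [i] :: 'k::field pathalg) r \<noteq> 0} = (\<lambda>i. [i]) ` S"
proof -
  have "length r = 1 \<and> hd r \<in> S \<longleftrightarrow> r \<in> (\<lambda>i. [i]) ` S" for r
    by (cases r) auto
  then show ?thesis by (auto simp: sum_trivial_paths_apply[OF assms] split: if_splits)
qed

lemma pmult_trivial_paths_left:
  fixes f :: "'k::field pathalg"
  assumes "finite S" "finite {p. f p \<noteq> 0}" "f [] = 0"
  shows "pmult (\<Sum>i\<in>S. path_elem [i]) f = (\<lambda>r. if hd r \<in> S then f r else 0)"
proof
  fix r
  let ?e = "(\<Sum>i\<in>S. path_elem [i] :: 'k pathalg)"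
  have e1: "?e [i] = 1" if "i \<in> S" for i
    using that by (simp add: sum_trivial_paths_apply[OF assms(1)])
  have "pmult ?e f r = (\<Sum>i\<in>S. \<Sum>q | f q \<noteq> 0. if i = hd q \<and> i # tl q = r then f q else 0)"
    unfolding pmult_def supp_trivial_paths[OF assms(1)]
    by (subst sum.reindex, simp add: inj_on_def, intro sum.cong refl)
       (auto simp: e1 intro!: sum.cong)
  also have "\<dots> = (\<Sum>i\<in>S. \<Sum>q | f q \<noteq> 0. if q = r then (if i = hd r then f r else 0) else 0)"
  proof (intro sum.cong refl)
    fix i q assume "q \<in> {q. f q \<noteq> 0}"
    then have "q \<noteq> []" using assms(3) by auto
    then have "i = hd q \<and> i # tl q = r \<longleftrightarrow> q = r \<and> i = hd r" by (cases q) auto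
    then show "(if i = hd q \<and> i # tl q = r then f q else 0)
      = (if q = r then (if i = hd r then f r else 0) else 0)" by simp
  qed
  also have "\<dots> = (\<Sum>i\<in>S. if i = hd r then f r else 0)"
    using assms by (intro sum.cong refl) (subst sum.delta, auto)
  also have "\<dots> = (if hd r \<in> S then f r else 0)" using assms by simp
  finally show "pmult ?e f r = (if hd r \<in> S then f r else 0)" .
qed

lemma pmult_trivial_paths_right:
  fixes f :: "'k::field pathalg"
  assumes "finite S" "finite {p. f p \<noteq> 0}" "f [] = 0"
  shows "pmult f (\<Sum>i\<in>S. path_elem [i]) = (\<lambda>r. if last r \<in> S then f r else 0)"
proof
  fix r
  let ?e = "(\<Sum>i\<in>S. path_elem [i] :: 'k pathalg)"
  have "pmult f ?e r = (\<Sum>q | f q \<noteq> 0. \<Sum>i\<in>S. if last q = i \<and> q = r then f q else 0)"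
    unfolding pmult_def supp_trivial_paths[OF assms(1)]
    by (subst sum.reindex) (simp_all add: inj_on_def sum_trivial_paths_apply assms cong: if_cong)
  also have "\<dots> = (\<Sum>q | f q \<noteq> 0. if q = r then (\<Sum>i\<in>S. if last r = i then f r else 0) else 0)"
    by (intro sum.cong refl) auto
  also have "\<dots> = (if last r \<in> S then f r else 0)"
    using assms by (subst sum.delta) auto
  finally show "pmult f ?e r = (if last r \<in> S then f r else 0)" .
qed

lemma is_path_iff_successively:
  "is_path n \<sigma> p \<longleftrightarrow>
     p \<noteq> [] \<and> set p \<subseteq> edges n \<sigma> \<and> successively (\<lambda>x y. (x, y) \<in> arrows n \<sigma>) p"
  unfolding is_path_def successively_conv_nth ..

lemma is_path_append_tl:
  assumes "is_path n \<sigma> p" "is_path n \<sigma> q" "last p = hd q"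
  shows "is_path n \<sigma> (p @ tl q)"
  using assms by (cases q) (auto simp: is_path_iff_successively successively_append_iff successively_Cons)

section \<open>The path algebra of a fixed triangulation as a ring\<close>

locale triangulated_polygon =
  fixes n :: nat and \<sigma> :: "nat set set"
  assumes n_ge_3: "n \<ge> 3" and triangulation: "triangulation n \<sigma>"
begin

abbreviation PA :: "'k::field pathalg ring" where "PA \<equiv> path_algebra n \<sigma>"

lemma edge_cases: "e \<in> edges n \<sigma> \<Longrightarrow> is_diag n e \<or> is_side n e"
  using triangulation by (auto simp: edges_def triangulation_def)

lemma edge_subset: "e \<in> edges n \<sigma> \<Longrightarrow> e \<subseteq> {..<n}"
proof -
  assume "e \<in> edges n \<sigma>"
  then consider "is_diag n e" | "is_side n e" using edge_cases by blast
  then show ?thesis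
  proof cases
    case 1 then show ?thesis by (auto simp: is_diag_def)
  next
    case 2 then show ?thesis using n_ge_3 by (auto simp: is_side_def side_def)
  qed
qed

lemma finite_edges: "finite (edges n \<sigma>)"
  by (rule finite_subset[of _ "Pow {..<n}"]) (use edge_subset in auto)

lemma PA_sel [simp]:
  "Group.monoid.mult PA = pmult" "zero PA = (\<lambda>_. 0)" "add PA = (\<lambda>f g r. f r + g r)"
  "one PA = (\<Sum>i\<in>edges n \<sigma>. path_elem [i])"
  by (simp_all add: path_algebra_def)

lemma PA_carrier: "f \<in> carrier PA \<longleftrightarrow> finite {p. f p \<noteq> 0} \<and> (\<forall>p. f p \<noteq> 0 \<longrightarrow> is_path n \<sigma> p)"
  by (simp add: path_algebra_def)

lemma PA_finite: "f \<in> carrier PA \<Longrightarrow> finite {p. f p \<noteq> 0}"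
  by (simp add: PA_carrier)

lemma PA_Nil: "f \<in> carrier PA \<Longrightarrow> f [] = 0"
  by (auto simp: PA_carrier is_path_def)

lemma path_elem_in_PA: "is_path n \<sigma> p \<Longrightarrow> path_elem p \<in> carrier PA"
  by (simp add: PA_carrier path_elem_def)

lemma is_path_singleton: "is_path n \<sigma> [i] \<longleftrightarrow> i \<in> edges n \<sigma>"
  by (simp add: is_path_def)

lemma trivial_paths_in_PA:
  assumes "S \<subseteq> edges n \<sigma>" shows "(\<Sum>i\<in>S. path_elem [i]) \<in> carrier PA"
proof -
  have "finite S" using assms finite_edges finite_subset by blast
  then have "finite {r. (\<Sum>i\<in>S. path_elem [i] :: 'a pathalg) r \<noteq> 0}"
    unfolding supp_trivial_paths[OF \<open>finite S\<close>] by simp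
  moreover have "is_path n \<sigma> r" if "(\<Sum>i\<in>S. path_elem [i] :: 'a pathalg) r \<noteq> 0" for r
  proof -
    have "r \<in> (\<lambda>i. [i]) ` S"
      using that supp_trivial_paths[OF \<open>finite S\<close>, where 'k = 'a] by blast
    then show ?thesis using assms by (auto simp: is_path_singleton)
  qed
  ultimately show ?thesis unfolding PA_carrier by blast
qed

lemma pmult_in_PA:
  assumes "f \<in> carrier PA" "g \<in> carrier PA" shows "pmult f g \<in> carrier PA"
proof -
  have "is_path n \<sigma> r" if r: "pmult f g r \<noteq> 0" for r
  proof -
    have "r \<in> (\<lambda>(p, q). p @ tl q) ` {(p, q). f p \<noteq> 0 \<and> g q \<noteq> 0 \<and> last p = hd q}"
      using r supp_pmult[of f g] by blast
    then obtain p q where "f p \<noteq> 0" "g q \<noteq> 0" "last p = hd q" "r = p @ tl q" by auto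
    then show ?thesis using assms by (auto simp: PA_carrier intro!: is_path_append_tl)
  qed
  then show ?thesis using assms finite_supp_pmult[of f g] by (simp add: PA_carrier)
qed

lemma add_in_PA:
  assumes "f \<in> carrier PA" "g \<in> carrier PA" shows "(\<lambda>r. f r + g r) \<in> carrier PA"
proof -
  have "finite {r. f r + g r \<noteq> 0}"
    by (rule finite_subset[of _ "{p. f p \<noteq> 0} \<union> {p. g p \<noteq> 0}"]) (use assms in \<open>auto simp: PA_carrier\<close>)
  moreover have "is_path n \<sigma> r" if "f r + g r \<noteq> 0" for r
    using that assms by (cases "f r = 0") (auto simp: PA_carrier)
  ultimately show ?thesis by (simp add: PA_carrier)
qed

lemma zero_in_PA: "(\<lambda>_. 0) \<in> carrier PA"
  by (simp add: PA_carrier)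

lemma ring_PA: "ring (PA :: 'k::field pathalg ring)"
proof (rule ringI)
  show "abelian_group (PA :: 'k pathalg ring)"
  proof (rule abelian_groupI)
    fix f :: "'k pathalg" assume f: "f \<in> carrier PA"
    then have "(\<lambda>r. - f r) \<in> carrier PA" by (simp add: PA_carrier)
    then show "\<exists>g\<in>carrier PA. g \<oplus>\<^bsub>PA\<^esub> f = \<zero>\<^bsub>PA\<^esub>" by (rule rev_bexI) simp
  qed (auto simp: add_in_PA zero_in_PA add.assoc add.commute)
next
  show "Group.monoid (PA :: 'k pathalg ring)"
  proof (rule monoidI)
    fix f g h :: "'k pathalg" assume fgh: "f \<in> carrier PA" "g \<in> carrier PA" "h \<in> carrier PA"
    then show "f \<otimes>\<^bsub>PA\<^esub> g \<otimes>\<^bsub>PA\<^esub> h = f \<otimes>\<^bsub>PA\<^esub> (g \<otimes>\<^bsub>PA\<^esub> h)"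
      by (simp add: pmult_assoc PA_finite PA_Nil)
    have e: "hd r \<in> edges n \<sigma>" "last r \<in> edges n \<sigma>" if "f r \<noteq> 0" for r
      using that fgh(1) by (auto simp: PA_carrier is_path_def subset_iff)
    show "\<one>\<^bsub>PA\<^esub> \<otimes>\<^bsub>PA\<^esub> f = f"
      using e(1) fgh(1) pmult_trivial_paths_left[OF finite_edges PA_finite PA_Nil, OF fgh(1) fgh(1)]
      by (auto simp: fun_eq_iff)
    show "f \<otimes>\<^bsub>PA\<^esub> \<one>\<^bsub>PA\<^esub> = f"
      using e(2) fgh(1) pmult_trivial_paths_right[OF finite_edges PA_finite PA_Nil, OF fgh(1) fgh(1)]
      by (auto simp: fun_eq_iff)
  qed (auto simp: pmult_in_PA trivial_paths_in_PA)
qed (auto simp: pmult_add_left pmult_add_right PA_finite)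

section \<open>Lifting the edges of a triangulation\<close>

definition pr :: "int \<times> int \<Rightarrow> nat set" where
  "pr X = {nat (fst X mod int n), nat (snd X mod int n)}"

text \<open>Integers replace residues so that cyclic position becomes inequality:
  \<open>v < a < b < v + n\<close> says that the three vertices follow each other counterclockwise,
  without a case distinction where the labels wrap around. Periodicity in each argument separately
  lets either end be moved into a chosen window.\<close>

definition E :: "int \<Rightarrow> int \<Rightarrow> bool" where
  "E a b \<longleftrightarrow> pr (a, b) \<in> edges n \<sigma>"

lemma nat_mod_eq_iff: "nat (a mod int n) = nat (b mod int n) \<longleftrightarrow> a mod int n = b mod int n"
  using n_ge_3 by (subst eq_nat_nat_iff) simp_all

lemma mod_inj_window:
  assumes "a mod int n = b mod int n" "\<bar>a - b\<bar> < int n" shows "a = b"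
proof -
  have "int n dvd a - b" using assms(1) by (simp add: mod_eq_dvd_iff)
  then have "int n dvd \<bar>a - b\<bar>" by simp
  then have "\<bar>a - b\<bar> = 0" using zdvd_imp_le[of "int n" "\<bar>a - b\<bar>"] assms(2) by linarith
  then show ?thesis by simp
qed

lemma E_commute: "E a b \<longleftrightarrow> E b a"
  by (simp add: E_def pr_def insert_commute)

lemma E_add_n [simp]: "E (a + int n) b \<longleftrightarrow> E a b" "E a (b + int n) \<longleftrightarrow> E a b"
  by (simp_all add: E_def pr_def)

lemma E_diff_n [simp]: "E (a - int n) b \<longleftrightarrow> E a b" "E a (b - int n) \<longleftrightarrow> E a b"
  using E_add_n(1)[of "a - int n" b] E_add_n(2)[of a "b - int n"] by simp_all

text \<open>Up to translation by n a side has two lifts, one for each order of its ends; hence the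
  two possible gaps.\<close>

lemma is_side_pr:
  assumes "a < b" "b < a + int n"
  shows "is_side n (pr (a, b)) \<longleftrightarrow> b = a + 1 \<or> b = a + int n - 1"
proof
  have side: "side n (nat (c mod int n)) = pr (c, c + 1)" for c
  proof -
    have "(nat (c mod int n) + 1) mod n = nat ((c + 1) mod int n)"
      using n_ge_3 by (intro int_int_eq[THEN iffD1]) (simp add: zmod_int mod_simps add.commute)
    then show ?thesis by (simp add: side_def pr_def)
  qed
  show "is_side n (pr (a, b))" if "b = a + 1 \<or> b = a + int n - 1"
  proof -
    have "pr (a, a + int n - 1) = pr (a - 1, a)"
      by (auto simp: pr_def insert_commute) (metis add.commute add_diff_eq mod_add_self2)+
    then have "pr (a, b) = pr (a, a + 1) \<or> pr (a, b) = pr (a - 1, a - 1 + 1)" using that by auto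
    then obtain c where "pr (a, b) = side n (nat (c mod int n))" using side by metis
    moreover have "nat (c mod int n) < n" using n_ge_3 by (simp add: nat_less_iff)
    ultimately show ?thesis unfolding is_side_def by blast
  qed
  assume "is_side n (pr (a, b))"
  then obtain i where "i < n" "pr (a, b) = side n i" by (auto simp: is_side_def)
  then have "pr (a, b) = pr (int i, int i + 1)" using side[of "int i"] by simp
  then consider "a mod int n = int i mod int n" "b mod int n = (int i + 1) mod int n"
    | "b mod int n = int i mod int n" "a mod int n = (int i + 1) mod int n"
    unfolding pr_def by (auto simp: doubleton_eq_iff nat_mod_eq_iff)
  then show "b = a + 1 \<or> b = a + int n - 1"
  proof cases
    case 1
    then have "b mod int n = (a + 1) mod int n" by (metis mod_add_left_eq)
    then have "b = a + 1" by (rule mod_inj_window) (use assms n_ge_3 in auto)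
    then show ?thesis ..
  next
    case 2
    then have "(a + int n) mod int n = (b + 1) mod int n" by (metis mod_add_left_eq mod_add_self2)
    then have "a + int n = b + 1" by (rule mod_inj_window) (use assms n_ge_3 in auto)
    then show ?thesis by simp
  qed
qed

lemma E_side: "E a (a + 1)"
  using is_side_pr[of a "a + 1"] n_ge_3 by (auto simp: E_def edges_def)

lemma is_diag_pr:
  assumes "a < b" "b < a + int n"
  shows "is_diag n (pr (a, b)) \<longleftrightarrow> a + 2 \<le> b \<and> b \<le> a + int n - 2"
proof -
  have "nat (a mod int n) \<noteq> nat (b mod int n)"
    using mod_inj_window[of a b] assms by (auto simp: nat_mod_eq_iff)
  moreover have "nat (c mod int n) < n" for c using n_ge_3 by (simp add: nat_less_iff)
  ultimately have "is_diag n (pr (a, b)) \<longleftrightarrow> \<not> is_side n (pr (a, b))"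
    unfolding is_diag_def pr_def by (auto simp del: nat_less_iff)
  then show ?thesis using is_side_pr[OF assms] assms by auto
qed

text \<open>The bridge from the offsets in the definitions of arrows and crossings to inequalities
  in the window starting at \<open>v\<close>.\<close>

lemma ccw_off_lift:
  assumes "0 \<le> k" "k < int n"
  shows "ccw_off n (nat (v mod int n)) (nat ((v + k) mod int n)) = nat k"
proof (rule int_int_eq[THEN iffD1])
  have "nat (v mod int n) < n" using n_ge_3 by (simp add: nat_less_iff)
  then have "int (ccw_off n (nat (v mod int n)) (nat ((v + k) mod int n)))
    = ((v + k) mod int n + int n - v mod int n) mod int n"
    using n_ge_3 by (simp add: ccw_off_def zmod_int of_nat_diff)
  also have "\<dots> = (v + k + int n - v) mod int n"
    using mod_add_left_eq[of "v + k" "int n" "int n - v mod int n"]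
      mod_diff_right_eq[of "v + k + int n" v "int n"] by (simp add: algebra_simps)
  also have "\<dots> = int (nat k)" using assms by simp
  finally show "int (ccw_off n (nat (v mod int n)) (nat ((v + k) mod int n))) = int (nat k)" .
qed

lemma vertex_lift:
  assumes "x < n" obtains k where "0 \<le> k" "k < int n" "x = nat ((v + k) mod int n)"
proof
  let ?k = "(int x - v) mod int n"
  show "0 \<le> ?k" "?k < int n" using n_ge_3 by simp_all
  have "(v + ?k) mod int n = int x" using assms by (simp add: mod_add_right_eq)
  then show "x = nat ((v + ?k) mod int n)" by simp
qed

text \<open>The interleaving leaves a vertex strictly on each side of both chords, so neither is a
  side; both then belong to \<sigma> and cross. Later contradictions are obtained by exhibiting four
  such integers.\<close>

lemma non_crossing:
  assumes "v < c" "c < b" "b < d" "d < v + int n" "E v b" "E c d"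
  shows False
proof -
  let ?v = "nat (v mod int n)" and ?b = "nat (b mod int n)"
    and ?c = "nat (c mod int n)" and ?d = "nat (d mod int n)"
  have "is_diag n (pr (v, b))" "is_diag n (pr (c, d))"
    using assms by (auto simp: is_diag_pr)
  then have e: "pr (v, b) \<in> \<sigma>" "pr (c, d) \<in> \<sigma>"
    using assms(5,6) by (auto simp: E_def edges_def is_diag_def)
  have "?v \<noteq> ?c" "?v \<noteq> ?b" "?v \<noteq> ?d" "?c \<noteq> ?b" "?c \<noteq> ?d" "?b \<noteq> ?d"
    using mod_inj_window[of v c] mod_inj_window[of v b] mod_inj_window[of v d]
      mod_inj_window[of c b] mod_inj_window[of c d] mod_inj_window[of b d] assms
    by (auto simp: nat_mod_eq_iff)
  then have "card {?v, ?b, ?c, ?d} = 4" by auto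
  moreover have "strictly_between n ?v ?b ?c" "\<not> strictly_between n ?v ?b ?d"
    using assms ccw_off_lift[of "b - v" v] ccw_off_lift[of "c - v" v] ccw_off_lift[of "d - v" v]
    by (auto simp: strictly_between_def)
  ultimately have "crosses n (pr (v, b)) (pr (c, d))"
    unfolding crosses_def pr_def fst_conv snd_conv by blast
  then show False using e triangulation by (auto simp: triangulation_def)
qed

text \<open>Maximality of \<sigma>: a chord that is not an edge is a diagonal outside \<sigma> and
  hence is crossed. The work lies in recovering ordered integers, since the definition of crossing
  fixes the order of the ends of neither chord.\<close>

lemma crossing_exists:
  assumes ab: "a < b" "b < a + int n" and "\<not> E a b"
  obtains c d where "a < c" "c < b" "b < d" "d < a + int n" "E c d"
proof -
  have nE: "pr (a, b) \<notin> \<sigma>" "\<not> is_side n (pr (a, b))" using assms(3) by (auto simp: E_def edges_def)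
  then have "is_diag n (pr (a, b))" using is_side_pr[OF ab] is_diag_pr[OF ab] ab by auto
  with nE obtain e where e: "e \<in> \<sigma>" "crosses n (pr (a, b)) e"
    using triangulation by (auto simp: triangulation_def)
  then obtain a' b' c0 d0 where *: "pr (a, b) = {a', b'}" "e = {c0, d0}" "card {a', b', c0, d0} = 4"
    "strictly_between n a' b' c0 \<noteq> strictly_between n a' b' d0"
    unfolding crosses_def by blast
  obtain c' d' where **: "e = {c', d'}" "card {a', b', c', d'} = 4"
    "strictly_between n a' b' c'" "\<not> strictly_between n a' b' d'"
  proof (cases "strictly_between n a' b' c0")
    case True then show ?thesis using * that by blast
  next
    case False
    then show ?thesis using * that[of d0 c0] by (simp add: insert_commute)
  qed
  have E': "e \<in> edges n \<sigma>" using e by (simp add: edges_def)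
  then have lt: "c' < n" "d' < n" using edge_subset[OF E'] **(1) by auto
  have dist: "a' \<noteq> b'" "a' \<noteq> c'" "a' \<noteq> d'" "b' \<noteq> c'" "b' \<noteq> d'" "c' \<noteq> d'"
    using **(2) card_distinct[of "[a', b', c', d']"] by simp_all
  have key: "\<exists>c d. u < c \<and> c < w \<and> w < d \<and> d < u + int n \<and> E c d"
    if uw: "u < w" "w < u + int n" "a' = nat (u mod int n)" "b' = nat (w mod int n)" for u w
  proof -
    obtain k where k: "0 \<le> k" "k < int n" "c' = nat ((u + k) mod int n)" using vertex_lift lt(1) by blast
    obtain l where l: "0 \<le> l" "l < int n" "d' = nat ((u + l) mod int n)" using vertex_lift lt(2) by blast
    have o: "ccw_off n a' b' = nat (w - u)" "ccw_off n a' c' = nat k" "ccw_off n a' d' = nat l"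
      using ccw_off_lift[of "w - u" u] uw(1,2) ccw_off_lift[OF k(1,2), of u] ccw_off_lift[OF l(1,2), of u]
      unfolding uw(3,4) k(3) l(3) by simp_all
    have "0 < k" "k < w - u" using **(3) o by (auto simp: strictly_between_def)
    moreover have "l \<noteq> 0" using dist(3) l(3) uw(3) by auto
    moreover have "l \<noteq> w - u" using dist(5) l(3) uw(4) by auto
    moreover have "\<not> (0 < l \<and> l < w - u)" using **(4) o by (auto simp: strictly_between_def)
    ultimately have "u < u + k" "u + k < w" "w < u + l" "u + l < u + int n" using l by auto
    moreover have "E (u + k) (u + l)" using E' **(1) k(3) l(3) by (simp add: E_def pr_def)
    ultimately show ?thesis by blast
  qed
  from *(1) have "(a' = nat (a mod int n) \<and> b' = nat (b mod int n)) \<or>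
      (a' = nat (b mod int n) \<and> b' = nat (a mod int n))"
    by (auto simp: pr_def doubleton_eq_iff)
  then show thesis
  proof
    assume "a' = nat (a mod int n) \<and> b' = nat (b mod int n)"
    then show thesis using key[OF ab] that by blast
  next
    assume "a' = nat (b mod int n) \<and> b' = nat (a mod int n)"
    \<comment> \<open>With the ends interchanged the window starts at \<open>b\<close>; subtracting
      one period from the far end of the crossing edge returns it to the original window.\<close>
    then obtain c d where "b < c" "c < a + int n" "a + int n < d" "d < b + int n" "E c d"
      using key[of b "a + int n"] ab by auto
    then show thesis using that[of "d - int n" c] by (auto simp: E_commute)
  qed
qed

text \<open>An edge crossing \<open>{a, b}\<close> has one end between \<open>a\<close> and
  \<open>b\<close>. If its other end is \<open>v\<close>, the gap is violated; anywhere else it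
  crosses \<open>{v, a}\<close> or \<open>{v, b}\<close>.\<close>

lemma E_consecutive:
  assumes "v < a" "a < b" "b < v + int n" "E v a" "E v b"
    and gap: "\<And>c. a < c \<Longrightarrow> c < b \<Longrightarrow> \<not> E v c"
  shows "E a b"
proof (rule ccontr)
  assume "\<not> E a b"
  then obtain c d where cd: "a < c" "c < b" "b < d" "d < a + int n" "E c d"
    using crossing_exists[of a b] assms by auto
  consider "d < v + int n" | "d = v + int n" | "v + int n < d" by linarith
  then show False
  proof cases
    case 1 then show False using non_crossing[of v c b d] cd assms by auto
  next
    case 2 then show False using gap[of c] cd by (auto simp: E_commute)
  next
    case 3
    have "E (d - int n) c" using cd by (simp add: E_commute)
    then show False using non_crossing[of v "d - int n" a c] cd assms 3 by auto
  qed
qed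

text \<open>The apex is the last neighbour of \<open>v\<close> before \<open>b\<close>; the side to
  \<open>v + 1\<close> guarantees one, and consecutive neighbours close up to a triangle.\<close>

lemma triangle_below:
  assumes "v + 2 \<le> b" "b < v + int n" "E v b"
  obtains a where "v < a" "a < b" "E v a" "E a b"
proof -
  let ?S = "{a. v < a \<and> a < b \<and> E v a}"
  have fin: "finite ?S" by (rule finite_subset[of _ "{v<..<b}"]) auto
  have ne: "v + 1 \<in> ?S" using assms E_side by auto
  define a where "a = Max ?S"
  have a: "a \<in> ?S" unfolding a_def by (rule Max_in) (use fin ne in auto)
  have "\<not> E v c" if "a < c" "c < b" for c
  proof
    assume "E v c"
    then have "c \<in> ?S" using that a by auto
    then show False using Max_ge[OF fin, of c] that by (simp add: a_def)
  qed
  then have "E a b" using E_consecutive[of v a b] a assms by auto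
  then show thesis using a that by auto
qed

text \<open>The triangle on the other side of the same edge is the one below its twist
  \<open>(b, v + n)\<close>.\<close>

lemma triangle_above:
  assumes "v < b" "b \<le> v + int n - 2" "E v b"
  obtains c where "b < c" "c < v + int n" "E v c" "E b c"
proof -
  obtain c where "b < c" "c < v + int n" "E b c" "E c (v + int n)"
    using triangle_below[of b "v + int n"] assms by (auto simp: E_commute)
  then show thesis using that by (auto simp: E_commute)
qed

section \<open>Lifts of edges: steps, twist, order and grading\<close>

definition valid :: "int \<times> int \<Rightarrow> bool" where
  "valid X \<longleftrightarrow> fst X < snd X \<and> snd X < fst X + int n \<and> E (fst X) (snd X)"

definition has_diag :: "int \<Rightarrow> bool" where
  "has_diag v \<longleftrightarrow> (\<exists>w. v + 2 \<le> w \<and> w \<le> v + int n - 2 \<and> E v w)"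

text \<open>The first two alternatives are internal arrows, the last is an external one. The
  external arrow at \<open>v\<close> has the lifts \<open>(v - 1, v)\<close> to
  \<open>(v, v + 1)\<close> and \<open>(v, v + n - 1)\<close> to \<open>(v + 1, v + n)\<close>, so
  \<open>has_diag\<close> is asked of a different coordinate in each disjunct.\<close>

definition step :: "int \<times> int \<Rightarrow> int \<times> int \<Rightarrow> bool" where
  "step X Y \<longleftrightarrow> valid X \<and> valid Y \<and>
     (fst Y = fst X \<and> snd X < snd Y \<and> E (snd X) (snd Y)
    \<or> snd Y = snd X \<and> fst X < fst Y \<and> E (fst X) (fst Y)
    \<or> fst Y = fst X + 1 \<and> snd Y = snd X + 1 \<and>
      (snd X = fst X + 1 \<and> has_diag (snd X) \<or> snd X = fst X + int n - 1 \<and> has_diag (fst X)))"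

definition twist :: "int \<times> int \<Rightarrow> int \<times> int" where
  "twist X = (snd X, fst X + int n)"

definition shift :: "int \<Rightarrow> int \<times> int \<Rightarrow> int \<times> int" where
  "shift k X = (fst X + k * int n, snd X + k * int n)"

text \<open>The grading behind the inductions: steps raise it, a twist adds n, and its increment
  along a lifted path becomes the degree of the path.\<close>

definition level :: "int \<times> int \<Rightarrow> int" where
  "level X = fst X + snd X"

definition le :: "int \<times> int \<Rightarrow> int \<times> int \<Rightarrow> bool" where
  "le X Y \<longleftrightarrow> fst X \<le> fst Y \<and> snd X \<le> snd Y"

lemma has_diag_add_n [simp]: "has_diag (v + int n) \<longleftrightarrow> has_diag v"
proof
  assume "has_diag (v + int n)"
  then obtain w where "v + int n + 2 \<le> w" "w \<le> v + int n + int n - 2" "E v w"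
    by (auto simp: has_diag_def)
  then show "has_diag v" unfolding has_diag_def by (intro exI[of _ "w - int n"]) auto
next
  assume "has_diag v"
  then obtain w where "v + 2 \<le> w" "w \<le> v + int n - 2" "E v w" by (auto simp: has_diag_def)
  then show "has_diag (v + int n)" unfolding has_diag_def by (intro exI[of _ "w + int n"]) auto
qed

lemma valid_twist [simp]: "valid (twist X) \<longleftrightarrow> valid X"
  by (auto simp: valid_def twist_def E_commute)

lemma step_twist [simp]: "step (twist X) (twist Y) \<longleftrightarrow> step X Y"
proof -
  have h: "has_diag (a + int n) = has_diag a" for a by simp
  have "b = a + int n - 1 \<and> P \<longleftrightarrow> a + int n = b + 1 \<and> P" for a b :: int and P by auto
  then show ?thesis
    unfolding step_def valid_twist
    by (auto simp: twist_def)
qed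

lemma pr_twist [simp]: "pr (twist X) = pr X"
  by (simp add: pr_def twist_def insert_commute)

lemma le_twist [simp]: "le (twist X) (twist Y) \<longleftrightarrow> le X Y"
  by (auto simp: le_def twist_def)

lemma level_twist: "level (twist X) = level X + int n"
  by (simp add: level_def twist_def)

lemma twist_inj [simp]: "twist X = twist Y \<longleftrightarrow> X = Y"
  by (auto simp: twist_def prod_eq_iff)

lemma twist_surj: obtains Y where "X = twist Y"
  using that[of "(snd X - int n, fst X)"] by (simp add: twist_def)

lemma step_le: "step X Y \<Longrightarrow> le X Y" and step_level: "step X Y \<Longrightarrow> level X < level Y"
  by (auto simp: step_def le_def level_def)

lemma step_valid: "step X Y \<Longrightarrow> valid X" "step X Y \<Longrightarrow> valid Y"
  by (auto simp: step_def)

lemma has_diagI: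
  assumes "v < c" "c < w" "w < v + int n" "E v c" "E c w" "E v w" "\<not> (c = v + 1 \<and> w = v + int n - 1)"
  shows "has_diag v"
proof (cases "c = v + 1")
  case True
  then show ?thesis using assms unfolding has_diag_def by (intro exI[of _ w]) auto
next
  case False
  then show ?thesis using assms unfolding has_diag_def by (intro exI[of _ c]) auto
qed

text \<open>The candidates are \<open>(a, b)\<close> from the triangle below, \<open>(v, e)\<close>
  from the triangle above, and the external step when \<open>{v, b}\<close> is the side before
  \<open>v\<close>. If none of them stays below \<open>(c, d)\<close>, then \<open>(c, d)\<close>
  equals \<open>(v, b)\<close> or its edge crosses an edge of one of the two triangles.\<close>

lemma progress_long:
  assumes Z: "valid (v, b)" "v + 2 \<le> b" and Y: "valid (c, d)" "v \<le> c" "b \<le> d" "(v, b) \<noteq> (c, d)"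
  obtains Z' where "step (v, b) Z'" "le Z' (c, d)"
proof -
  have Eb: "E v b" "b < v + int n" and cd: "c < d" "d < c + int n" "E c d"
    using Z Y by (auto simp: valid_def)
  obtain a where a: "v < a" "a < b" "E v a" "E a b" using triangle_below[of v b] Z Eb by auto
  show thesis
  proof (cases "a \<le> c")
    case True
    have "step (v, b) (a, b)" using a Z Eb by (auto simp: step_def valid_def)
    then show thesis using that[of "(a, b)"] True Y by (auto simp: le_def)
  next
    case ca: False
    show thesis
    proof (cases "b = v + int n - 1")
      case True
      show thesis
      proof (cases "c = v")
        case True
        then have "d = b" using \<open>b = v + int n - 1\<close> cd Y by auto
        then show thesis using True Y by auto
      next
        case c: False
        \<comment> \<open>Otherwise \<open>{c, d}\<close> would cross \<open>{v, a}\<close>. The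
          bound makes room for the external step, which raises both coordinates.\<close>
        have "v + int n \<le> d"
        proof (rule ccontr)
          assume "\<not> v + int n \<le> d"
          then show False using non_crossing[of v c a d] ca c Y a cd by auto
        qed
        moreover have "has_diag v" using ca c Y a True unfolding has_diag_def by (intro exI[of _ a]) auto
        moreover have "valid (v + 1, v + int n)" using n_ge_3 E_side[of v] by (auto simp: valid_def E_commute)
        ultimately show thesis using that[of "(v + 1, v + int n)"] True Z c Y
          by (auto simp: step_def le_def)
      qed
    next
      case False
      then obtain e where e: "b < e" "e < v + int n" "E v e" "E b e"
        using triangle_above[of v b] Eb Z by auto
      show thesis
      proof (cases "e \<le> d")
        case True
        have "step (v, b) (v, e)" using e Z Eb by (auto simp: step_def valid_def)
        then show thesis using that[of "(v, e)"] True Y by (auto simp: le_def)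
      next
        case de: False
        show thesis
        proof (cases "c = v")
          case True
          then have "E v d" "b < d" using cd Y by auto
          then have "E d (v + int n)" by (simp add: E_commute)
          then show thesis using non_crossing[of b d e "v + int n"] \<open>b < d\<close> de e Z by auto
        next
          case c: False
          then show thesis using non_crossing[of v c a d] ca c Y a cd de e by auto
        qed
      qed
    qed
  qed
qed

text \<open>A lift with gap 1 has a twist with gap n - 1, which is at least 2; there
  \<open>progress_long\<close> applies, and the step is twisted back.\<close>

lemma progress:
  assumes "valid Z" "valid Y" "le Z Y" "Z \<noteq> Y"
  obtains Z' where "step Z Z'" "le Z' Y"
proof -
  obtain v b c d where [simp]: "Z = (v, b)" "Y = (c, d)" by (cases Z, cases Y)
  show thesis
  proof (cases "v + 2 \<le> b")
    case True
    then show thesis using progress_long[of v b c d] assms that by (auto simp: le_def)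
  next
    case False
    then have b: "b = v + 1" using assms(1) by (auto simp: valid_def)
    have "valid (b, v + int n)" "valid (d, c + int n)" "b + 2 \<le> v + int n"
      using valid_twist[of Z] valid_twist[of Y] assms n_ge_3 b by (auto simp: twist_def)
    moreover have "b \<le> d" "v + int n \<le> c + int n" "(b, v + int n) \<noteq> (d, c + int n)"
      using assms(3,4) by (auto simp: le_def)
    ultimately obtain Z' where Z': "step (b, v + int n) Z'" "le Z' (d, c + int n)"
      using progress_long by blast
    obtain Z'' where Z'': "Z' = twist Z''" by (rule twist_surj)
    have "(b, v + int n) = twist Z" "(d, c + int n) = twist Y" by (auto simp: twist_def)
    then show thesis using that[of Z''] Z' unfolding Z'' by simp
  qed
qed

section \<open>Paths of the lifted quiver\<close>

definition lpath :: "(int \<times> int) list \<Rightarrow> bool" where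
  "lpath P \<longleftrightarrow> P \<noteq> [] \<and> valid (hd P) \<and> successively step P"

lemma lpath_Nil [simp]: "\<not> lpath []"
  by (simp add: lpath_def)

lemma lpath_Cons: "lpath (X # P) \<longleftrightarrow> valid X \<and> (P = [] \<or> step X (hd P) \<and> lpath P)"
  by (cases P) (auto simp: lpath_def step_valid)

lemma lpath_append_tl: "lpath P \<Longrightarrow> lpath Q \<Longrightarrow> last P = hd Q \<Longrightarrow> lpath (P @ tl Q)"
  by (cases Q) (auto simp: lpath_def successively_append_iff successively_Cons)

lemma lpath_valid_last: "lpath P \<Longrightarrow> valid (last P)"
  by (induction P) (auto simp: lpath_Cons)

lemma lpath_le: "lpath P \<Longrightarrow> le (hd P) (last P)"
proof (induction P)
  case (Cons X P)
  then show ?case by (cases P) (auto simp: lpath_Cons le_def dest!: step_le)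
qed (simp add: lpath_def)

lemma lpath_level: "lpath P \<Longrightarrow> level (hd P) = level (last P) \<Longrightarrow> P = [hd P]"
proof (cases P)
  case (Cons X P')
  assume P: "lpath P" "level (hd P) = level (last P)"
  show ?thesis
  proof (cases P')
    case (Cons Z Q)
    then have "level X < level Z" "le Z (last P')"
      using P \<open>P = X # P'\<close> lpath_le[of P'] by (auto simp: lpath_Cons dest: step_level)
    then show ?thesis using P \<open>P = X # P'\<close> Cons by (auto simp: level_def le_def)
  qed (use Cons in simp)
qed (simp add: lpath_def)

text \<open>A step supplied by \<open>progress\<close> stays below \<open>Y\<close> and raises the
  level, so the remaining gap in level is a termination measure.\<close>

lemma lpath_exists:
  assumes "valid Z" "valid Y" "le Z Y"
  obtains P where "lpath P" "hd P = Z" "last P = Y"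
proof -
  have "\<exists>P. lpath P \<and> hd P = Z \<and> last P = Y"
    using assms
  proof (induction "nat (level Y - level Z)" arbitrary: Z rule: less_induct)
    case less
    show ?case
    proof (cases "Z = Y")
      case True
      then show ?thesis using less.prems by (intro exI[of _ "[Z]"]) (simp add: lpath_def)
    next
      case False
      then obtain Z' where Z': "step Z Z'" "le Z' Y" using progress less.prems by metis
      have "level Z < level Z'" "level Z' \<le> level Y"
        using Z' step_level by (auto simp: le_def level_def)
      then have "nat (level Y - level Z') < nat (level Y - level Z)" by auto
      then obtain P where "lpath P" "hd P = Z'" "last P = Y"
        using less.hyps Z' less.prems step_valid by metis
      then show ?thesis using Z' less.prems by (intro exI[of _ "Z # P"]) (auto simp: lpath_Cons)
    qed
  qed
  then show thesis using that by blast
qed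

section \<open>Lifting arrows and paths\<close>

lemma pr_shift [simp]: "pr (shift k X) = pr X"
  by (simp add: pr_def shift_def)

lemma E_shift [simp]: "E (a + k * int n) b \<longleftrightarrow> E a b" "E a (b + k * int n) \<longleftrightarrow> E a b"
  by (simp_all add: E_def pr_def)

lemma has_diag_shift: "has_diag (v + k * int n) \<longleftrightarrow> has_diag v"
proof -
  have imp: "has_diag (v + k * int n)" if "has_diag v" for v k
  proof -
    from that obtain w where "v + 2 \<le> w" "w \<le> v + int n - 2" "E v w" by (auto simp: has_diag_def)
    then show ?thesis unfolding has_diag_def by (intro exI[of _ "w + k * int n"]) auto
  qed
  show ?thesis using imp[of v k] imp[of "v + k * int n" "- k"] by auto
qed

lemma valid_shift [simp]: "valid (shift k X) \<longleftrightarrow> valid X"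
  by (simp add: valid_def shift_def)

lemma step_shift [simp]: "step (shift k X) (shift k Y) \<longleftrightarrow> step X Y"
proof -
  have "has_diag (a + k * int n) = has_diag a" for a by (rule has_diag_shift)
  then show ?thesis unfolding step_def valid_shift by (simp add: shift_def algebra_simps)
qed

lemma level_shift: "level (shift k X) = level X + 2 * k * int n"
  by (simp add: level_def shift_def)

text \<open>The coordinates of the two lifts agree modulo n either in order or interchanged, and
  validity confines the second coordinate to a window in which its residue determines it. Two twists
  make a translation by n, so both alternatives together are one twist orbit.\<close>

lemma pr_eq_cases:
  assumes "valid X" "valid Y" "pr X = pr Y"
  obtains k where "Y = shift k X" | k where "Y = shift k (twist X)"
proof -
  have diff: "\<exists>k. y = x + k * int n" if "x mod int n = y mod int n" for x y
  proof -
    have "int n dvd y - x" using that by (simp add: mod_eq_dvd_iff dvd_diff_commute)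
    then obtain k where "y - x = int n * k" by (rule dvdE)
    then have "y = x + k * int n" by (simp add: algebra_simps)
    then show ?thesis ..
  qed
  from assms(3) consider "fst X mod int n = fst Y mod int n" "snd X mod int n = snd Y mod int n"
    | "fst X mod int n = snd Y mod int n" "snd X mod int n = fst Y mod int n"
    by (auto simp: pr_def doubleton_eq_iff nat_mod_eq_iff)
  then show thesis
  proof cases
    case 1
    then obtain k where k: "fst Y = fst X + k * int n" using diff by blast
    have "snd Y = snd X + k * int n"
      by (rule mod_inj_window) (use 1(2) assms(1,2) k in \<open>auto simp: valid_def\<close>)
    then show thesis using that(1)[of k] k by (simp add: shift_def prod_eq_iff)
  next
    case 2
    then obtain k where k: "fst Y = snd X + k * int n" using diff by blast
    have "snd Y = fst X + int n + k * int n"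
      by (rule mod_inj_window) (use 2(1) assms(1,2) k in \<open>auto simp: valid_def\<close>)
    then show thesis using that(2)[of k] k by (simp add: shift_def twist_def prod_eq_iff)
  qed
qed

text \<open>Translates differ in level by even multiples of n and twisted translates by odd ones, so
  equal levels leave only the translation by zero.\<close>

lemma pr_level_eq:
  assumes "valid X" "valid Y" "pr X = pr Y" "level X = level Y"
  shows "X = Y"
  using assms(1-3)
proof (cases rule: pr_eq_cases)
  case (1 k)
  then have "2 * k * int n = 0" using assms(4) by (simp add: level_shift)
  then have "k = 0" using n_ge_3 by simp
  then show ?thesis using 1 by (simp add: shift_def)
next
  case (2 k)
  then have "int n * (2 * k + 1) = 0" using assms(4) by (simp add: level_shift level_twist algebra_simps)
  then have "2 * k + 1 = 0" using n_ge_3 by simp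
  then have False by presburger
  then show ?thesis ..
qed

lemma edge_lift:
  assumes "e \<in> edges n \<sigma>"
  obtains X where "valid X" "pr X = e"
proof -
  have "\<exists>a b. a < n \<and> b < n \<and> a \<noteq> b \<and> e = {a, b}"
    using edge_cases[OF assms]
  proof
    assume "is_side n e"
    then obtain i where i: "i < n" "e = {i, (i + 1) mod n}" by (auto simp: is_side_def side_def)
    moreover have "i \<noteq> (i + 1) mod n" using i n_ge_3 by (cases "i + 1 = n") auto
    ultimately show ?thesis using n_ge_3 by (intro exI[of _ i] exI[of _ "(i + 1) mod n"]) auto
  qed (auto simp: is_diag_def)
  then obtain c d where cd: "c < n" "d < n" "c \<noteq> d" "e = {c, d}" by blast
  define a b where "a = min c d" and "b = max c d"
  have ab: "a < b" "b < n" "e = {a, b}"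
    using cd by (auto simp: a_def b_def min_def max_def)
  then have "pr (int a, int b) = e" by (simp add: pr_def)
  moreover have "valid (int a, int b)" using ab assms calculation by (simp add: valid_def E_def)
  ultimately show thesis using that by blast
qed

lemma vertex_neq:
  "a < b \<Longrightarrow> b < a + int n \<Longrightarrow> nat (a mod int n) \<noteq> nat (b mod int n)"
  using mod_inj_window[of a b] by (auto simp: nat_mod_eq_iff)

lemma vertex_less: "nat (a mod int n) < n"
  using n_ge_3 by (simp add: nat_less_iff)

text \<open>The residues of \<open>v\<close>, \<open>a\<close>, \<open>b\<close> are ordered only
  cyclically, whereas \<open>triangles\<close> asks for an increasing triple; every order is reduced
  to the increasing one.\<close>

lemma triangle_in_triangles:
  assumes "v < a" "a < b" "b < v + int n" "E v a" "E v b" "E a b"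
  shows "{nat (v mod int n), nat (a mod int n), nat (b mod int n)} \<in> triangles n \<sigma>"
proof -
  have tri: "{x, y, z} \<in> triangles n \<sigma>"
    if xyz: "x < n" "y < n" "z < n" "x \<noteq> y" "y \<noteq> z" "x \<noteq> z"
      "{x, y} \<in> edges n \<sigma>" "{y, z} \<in> edges n \<sigma>" "{x, z} \<in> edges n \<sigma>" for x y z
  proof -
    have sorted: "{x, y, z} \<in> triangles n \<sigma>"
      if "x < y" "y < z" "z < n" "{x, y} \<in> edges n \<sigma>" "{y, z} \<in> edges n \<sigma>" "{x, z} \<in> edges n \<sigma>" for x y z
      unfolding triangles_def mem_Collect_eq
      by (intro exI[of _ x] exI[of _ y] exI[of _ z]) (use that in simp)
    consider "x < y" "y < z" | "x < z" "z < y" | "y < x" "x < z" | "y < z" "z < x"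
      | "z < x" "x < y" | "z < y" "y < x" 
      using linorder_less_linear[of x y] linorder_less_linear[of y z] linorder_less_linear[of x z] xyz(4-6)
      by blast
    then show ?thesis
    proof cases
      case 1 then show ?thesis using sorted[of x y z] xyz by simp
    next
      case 2 then show ?thesis using sorted[of x z y] xyz by (simp add: insert_commute)
    next
      case 3 then show ?thesis using sorted[of y x z] xyz by (simp add: insert_commute)
    next
      case 4 then show ?thesis using sorted[of y z x] xyz by (simp add: insert_commute)
    next
      case 5 then show ?thesis using sorted[of z x y] xyz by (simp add: insert_commute)
    next
      case 6 then show ?thesis using sorted[of z y x] xyz by (simp add: insert_commute)
    qed
  qed
  show ?thesis
  proof (rule tri)
    show "nat (v mod int n) \<noteq> nat (a mod int n)" "nat (v mod int n) \<noteq> nat (b mod int n)"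
      by (rule vertex_neq; use assms in linarith)+
    show "nat (a mod int n) \<noteq> nat (b mod int n)" by (rule vertex_neq; use assms in linarith)
    show "{nat (v mod int n), nat (a mod int n)} \<in> edges n \<sigma>"
      "{nat (v mod int n), nat (b mod int n)} \<in> edges n \<sigma>"
      "{nat (a mod int n), nat (b mod int n)} \<in> edges n \<sigma>"
      using assms(4-6) unfolding E_def pr_def fst_conv snd_conv .
  qed (rule vertex_less)+
qed

lemma internal_arrow_lift:
  assumes "v < a" "a < b" "b < v + int n" "E v a" "E v b" "E a b"
  shows "internal_arrow n \<sigma> (pr (v, a)) (pr (v, b))"
  unfolding internal_arrow_def
proof (rule bexI[OF _ triangle_in_triangles[OF assms]], intro exI conjI)
  show "nat (v mod int n) \<noteq> nat (a mod int n)" "nat (v mod int n) \<noteq> nat (b mod int n)"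
    "nat (a mod int n) \<noteq> nat (b mod int n)"
    using vertex_neq assms by simp_all
  show "ccw_off n (nat (v mod int n)) (nat (a mod int n)) < ccw_off n (nat (v mod int n)) (nat (b mod int n))"
    using ccw_off_lift[of "a - v" v] ccw_off_lift[of "b - v" v] assms by auto
qed (auto simp: pr_def)

text \<open>All vertices are measured from the common vertex \<open>v\<close> of the two edges,
  which turns the comparison of offsets into \<open>a < b\<close>.\<close>

lemma internal_arrow_cases:
  assumes "internal_arrow n \<sigma> x y"
  obtains v a b where "v < a" "a < b" "b < v + int n" "E v a" "E v b" "E a b"
    "x = pr (v, a)" "y = pr (v, b)"
proof -
  from assms obtain T v a b where T: "T \<in> triangles n \<sigma>" "v \<in> T" "a \<in> T" "b \<in> T"
    and xy: "x = {v, a}" "y = {v, b}" and dist: "v \<noteq> a" "v \<noteq> b" "a \<noteq> b"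
    and off: "ccw_off n v a < ccw_off n v b"
    unfolding internal_arrow_def by blast
  from T(1) obtain p q r where pqr: "T = {p, q, r}" "p < q" "q < r" "r < n"
    "{p, q} \<in> edges n \<sigma>" "{q, r} \<in> edges n \<sigma>" "{p, r} \<in> edges n \<sigma>"
    unfolding triangles_def by blast
  have ed: "{s, t} \<in> edges n \<sigma>" if "s \<in> T" "t \<in> T" "s \<noteq> t" for s t
    using that pqr(5-7) unfolding pqr(1) by (elim insertE emptyE) (simp_all add: insert_commute)
  have lt: "v < n" "a < n" "b < n" using T pqr by auto
  obtain k where k: "0 \<le> k" "k < int n" "a = nat ((int v + k) mod int n)" using vertex_lift lt(2) by blast
  obtain l where l: "0 \<le> l" "l < int n" "b = nat ((int v + l) mod int n)" using vertex_lift lt(3) by blast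
  have v: "nat (int v mod int n) = v" using lt by simp
  have pv: "pr (int v, int v + k) = {v, a}" "pr (int v, int v + l) = {v, b}"
    "pr (int v + k, int v + l) = {a, b}"
    unfolding pr_def fst_conv snd_conv v k(3)[symmetric] l(3)[symmetric] by (rule refl)+
  have "nat k < nat l"
    using off ccw_off_lift[OF k(1,2), of "int v"] ccw_off_lift[OF l(1,2), of "int v"]
    unfolding v k(3)[symmetric] l(3)[symmetric] by simp
  moreover have "k \<noteq> 0"
  proof
    assume "k = 0"
    with k(3) v dist(1) show False by simp
  qed
  ultimately have "int v < int v + k" "int v + k < int v + l" "int v + l < int v + int n"
    using k(1) l(2) by auto
  then show thesis
    by (rule that) (use pv ed T dist xy in \<open>simp_all add: E_def\<close>)
qed

lemma has_diag_iff:
  "has_diag v \<longleftrightarrow> (\<exists>d\<in>\<sigma>. nat (v mod int n) \<in> d)"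
proof
  assume "has_diag v"
  then obtain w where w: "v + 2 \<le> w" "w \<le> v + int n - 2" "E v w" by (auto simp: has_diag_def)
  then have "\<not> is_side n (pr (v, w))" by (subst is_side_pr) auto
  then have "pr (v, w) \<in> \<sigma>" using w by (auto simp: E_def edges_def)
  then show "\<exists>d\<in>\<sigma>. nat (v mod int n) \<in> d" by (intro bexI[of _ "pr (v, w)"]) (simp_all add: pr_def)
next
  assume "\<exists>d\<in>\<sigma>. nat (v mod int n) \<in> d"
  then obtain d where d: "d \<in> \<sigma>" "nat (v mod int n) \<in> d" by blast
  then have diag: "is_diag n d" using triangulation by (simp add: triangulation_def)
  then obtain w where w: "w < n" "d = {nat (v mod int n), w}" "w \<noteq> nat (v mod int n)"
    using d(2) unfolding is_diag_def by (auto simp: insert_commute)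
  obtain k where k: "0 \<le> k" "k < int n" "w = nat ((v + k) mod int n)" using vertex_lift w(1) by blast
  have "k \<noteq> 0" using k(3) w(3) by auto
  have d': "d = pr (v, v + k)" using w k by (simp add: pr_def)
  then have "2 \<le> k \<and> k \<le> int n - 2"
    using diag is_diag_pr[of v "v + k"] k \<open>k \<noteq> 0\<close> by auto
  moreover have "E v (v + k)" using d d' by (simp add: E_def edges_def)
  ultimately show "has_diag v" unfolding has_diag_def by (intro exI[of _ "v + k"]) auto
qed

lemma pr_side_pair:
  fixes v :: int
  defines "w \<equiv> nat (v mod int n)"
  shows "pr (v - 1, v) = {w, (w + n - 1) mod n}" "pr (v, v + 1) = {w, (w + 1) mod n}"
proof -
  have w: "int w = v mod int n" "w < n" using n_ge_3 vertex_less by (simp_all add: w_def)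
  have "int ((w + n - 1) mod n) = (v mod int n + (int n - 1)) mod int n"
    using w n_ge_3 by (simp add: zmod_int of_nat_diff add_diff_eq)
  also have "\<dots> = (v + (int n - 1)) mod int n" by (rule mod_add_left_eq)
  also have "\<dots> = (v - 1 + int n) mod int n" by (simp add: algebra_simps)
  also have "\<dots> = (v - 1) mod int n" by (rule mod_add_self2)
  finally have "nat ((v - 1) mod int n) = (w + n - 1) mod n" by (metis nat_int)
  then show "pr (v - 1, v) = {w, (w + n - 1) mod n}"
    unfolding pr_def fst_conv snd_conv w_def[symmetric] by (simp only: insert_commute)
  have "int ((w + 1) mod n) = (v mod int n + 1) mod int n"
    using w(1) by (simp add: zmod_int add.commute)
  also have "\<dots> = (v + 1) mod int n" by (rule mod_add_left_eq)
  finally have "nat ((v + 1) mod int n) = (w + 1) mod n" by (metis nat_int)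
  then show "pr (v, v + 1) = {w, (w + 1) mod n}"
    unfolding pr_def fst_conv snd_conv w_def[symmetric] by (simp only:)
qed

lemma external_arrow_lift:
  assumes "has_diag v" shows "external_arrow n \<sigma> (pr (v - 1, v)) (pr (v, v + 1))"
  unfolding external_arrow_def using assms[unfolded has_diag_iff] vertex_less pr_side_pair[of v]
  by blast

lemma external_arrow_cases:
  assumes "external_arrow n \<sigma> x y"
  obtains v where "has_diag v" "x = pr (v - 1, v)" "y = pr (v, v + 1)"
proof -
  from assms obtain v where v: "v < n" "\<exists>d\<in>\<sigma>. v \<in> d" "x = {v, (v + n - 1) mod n}" "y = {v, (v + 1) mod n}"
    unfolding external_arrow_def by blast
  have "nat (int v mod int n) = v" using v(1) by simp
  then show thesis
    using that[of "int v"] pr_side_pair[of "int v"] v(2-4) by (simp only: has_diag_iff)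
qed

lemma step_fan:
  assumes "v < a" "a < b" "b < v + int n" "E v a" "E v b" "E a b"
  shows "step (v, a) (v, b)"
  using assms by (simp add: step_def valid_def)

lemma step_ext: "has_diag v \<Longrightarrow> step (v - 1, v) (v, v + 1)"
  using n_ge_3 E_side[of v] E_side[of "v - 1"] by (simp add: step_def valid_def)

text \<open>Up to a twist, and a translation in the external case, a step either turns an edge about
  a fixed end \<open>v\<close> or is the basic external arrow. Properties respecting these
  symmetries need be checked for two shapes instead of four.\<close>

lemma step_cases:
  assumes "step X Y"
  obtains (fan) v a b where "v < a" "a < b" "b < v + int n" "E v a" "E v b" "E a b"
      "X = (v, a) \<and> Y = (v, b) \<or> twist X = (v, a) \<and> twist Y = (v, b)"
  | (ext) v where "has_diag v"
      "X = (v - 1, v) \<and> Y = (v, v + 1) \<or> twist X = shift 1 (v - 1, v) \<and> twist Y = shift 1 (v, v + 1)"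
proof -
  obtain a b c d where [simp]: "X = (a, b)" "Y = (c, d)" by (cases X, cases Y)
  from assms consider "c = a" "b < d" "E b d" | "d = b" "a < c" "E a c"
    | "c = a + 1" "d = b + 1" "b = a + 1" "has_diag b"
    | "c = a + 1" "d = b + 1" "b = a + int n - 1" "has_diag a"
    unfolding step_def by auto
  moreover have "valid X" "valid Y" using assms step_valid by blast+
  ultimately show thesis
  proof cases
    case 1 then show thesis using fan[of a b d] \<open>valid X\<close> \<open>valid Y\<close> by (auto simp: valid_def)
  next
    case 2 then show thesis using fan[of b "a + int n" "c + int n"] \<open>valid X\<close> \<open>valid Y\<close>
      by (auto simp: valid_def twist_def E_commute)
  next
    case 3 then show thesis using ext[of b] by auto
  next
    case 4 then show thesis using ext[of a] by (auto simp: twist_def shift_def)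
  qed
qed

lemma step_arrow:
  assumes "step X Y" shows "(pr X, pr Y) \<in> arrows n \<sigma>"
  using assms
proof (cases rule: step_cases)
  case (fan v a b)
  have "pr X = pr (v, a)" "pr Y = pr (v, b)" using fan(7) pr_twist by metis+
  then show ?thesis using internal_arrow_lift[OF fan(1-6)] by (simp add: arrows_def)
next
  case (ext v)
  have "pr X = pr (v - 1, v)" "pr Y = pr (v, v + 1)" using ext(2) pr_twist pr_shift by metis+
  then show ?thesis using external_arrow_lift[OF ext(1)] by (simp add: arrows_def)
qed

text \<open>Any lift of the arrow starts in the fibre of \<open>X\<close>, and the symmetry carrying
  its source to \<open>X\<close> carries the whole step along. This is arrow lifting for the
  covering of the quiver by its lifts.\<close>

lemma arrow_step:
  assumes "(pr X, y) \<in> arrows n \<sigma>" "valid X"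
  obtains Y where "step X Y" "pr Y = y"
proof -
  from assms(1) consider "internal_arrow n \<sigma> (pr X) y" | "external_arrow n \<sigma> (pr X) y"
    by (auto simp: arrows_def)
  then obtain X0 Y0 where 0: "step X0 Y0" "pr X0 = pr X" "pr Y0 = y"
  proof cases
    case 1
    then obtain v a b where "v < a" "a < b" "b < v + int n" "E v a" "E v b" "E a b"
      "pr X = pr (v, a)" "y = pr (v, b)" by (rule internal_arrow_cases)
    then show thesis using that[OF step_fan[of v a b]] by simp
  next
    case 2
    then obtain v where "has_diag v" "pr X = pr (v - 1, v)" "y = pr (v, v + 1)" by (rule external_arrow_cases)
    then show thesis using that[OF step_ext[of v]] by simp
  qed
  from 0 have "valid X0" using step_valid by blast
  from this assms(2) 0(2) show thesis
  proof (cases rule: pr_eq_cases)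
    case (1 k)
    then show thesis using that[of "shift k Y0"] 0 by simp
  next
    case (2 k)
    then show thesis using that[of "shift k (twist Y0)"] 0 by simp
  qed
qed

lemma valid_pr_edge: "valid X \<Longrightarrow> pr X \<in> edges n \<sigma>"
  by (simp add: valid_def E_def)

lemma lpath_is_path: "lpath P \<Longrightarrow> is_path n \<sigma> (map pr P)"
proof (induction P)
  case (Cons X P)
  then show ?case
    by (cases P) (auto simp: lpath_Cons is_path_iff_successively valid_pr_edge step_arrow)
qed simp

lemma path_lift:
  assumes "is_path n \<sigma> p" "valid X" "pr X = hd p"
  obtains P where "lpath P" "hd P = X" "map pr P = p"
proof -
  have "\<exists>P. lpath P \<and> hd P = X \<and> map pr P = p"
    using assms
  proof (induction p arbitrary: X)
    case (Cons x p)
    show ?case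
    proof (cases p)
      case Nil
      then show ?thesis using Cons.prems by (intro exI[of _ "[X]"]) (simp add: lpath_Cons)
    next
      case (Cons y p')
      then have p: "is_path n \<sigma> p" "(pr X, y) \<in> arrows n \<sigma>"
        using Cons.prems by (auto simp: is_path_iff_successively)
      obtain Y where Y: "step X Y" "pr Y = y" using arrow_step[OF p(2) Cons.prems(2)] by blast
      have "pr Y = hd p" using Y(2) Cons by simp
      then obtain P where P: "lpath P" "hd P = Y" "map pr P = p"
        using Cons.IH[OF p(1) step_valid(2)[OF Y(1)]] by blast
      then have "lpath (X # P)" using Y(1) step_valid(1)[OF Y(1)] by (simp add: lpath_Cons)
      moreover have "map pr (X # P) = x # p" using P(3) Cons.prems(3) by simp
      ultimately show ?thesis by (intro exI[of _ "X # P"]) simp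
    qed
  qed (simp add: is_path_def)
  then show thesis using that by blast
qed

text \<open>The arc length of an arrow, in units of a side; modulo \<open>n\<close> it is the increment
  of the sum of the two endpoints of the edge.\<close>

definition arrow_deg :: "nat set \<Rightarrow> nat set \<Rightarrow> int" where
  "arrow_deg x y = (int (\<Sum>y) - int (\<Sum>x)) mod int n"

fun path_deg :: "nat set list \<Rightarrow> int" where
  "path_deg (x # y # p) = arrow_deg x y + path_deg (y # p)"
| "path_deg _ = 0"

lemma path_deg_append_tl:
  "p \<noteq> [] \<Longrightarrow> q \<noteq> [] \<Longrightarrow> last p = hd q \<Longrightarrow> path_deg (p @ tl q) = path_deg p + path_deg q"
proof (induction p rule: path_deg.induct)
  case (1 x y p)
  then show ?case by simp
next
  case ("2_2" x)
  then show ?case by (cases q) simp_all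
qed simp

lemma int_Sum_pr:
  assumes "fst X < snd X" "snd X < fst X + int n"
  shows "int (\<Sum>(pr X)) mod int n = level X mod int n"
proof -
  have "nat (fst X mod int n) \<noteq> nat (snd X mod int n)" using vertex_neq assms by blast
  then have "int (\<Sum>(pr X)) = fst X mod int n + snd X mod int n" using n_ge_3 by (simp add: pr_def)
  then show ?thesis by (simp add: level_def mod_simps)
qed

lemma arrow_deg_pr:
  assumes "valid X" "valid Y"
  shows "arrow_deg (pr X) (pr Y) = (level Y - level X) mod int n"
proof -
  have "int (\<Sum>(pr Z)) mod int n = level Z mod int n" if "valid Z" for Z
    using that int_Sum_pr by (auto simp: valid_def)
  then show ?thesis unfolding arrow_deg_def using assms by (metis mod_diff_cong)
qed

text \<open>Together with \<open>step_level\<close> this confines the increment to the range from 1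
  to n - 1, where the residue recorded by \<open>arrow_deg\<close> loses nothing.\<close>

lemma step_level_less:
  assumes "step X Y" shows "level Y < level X + int n"
  using assms
proof (cases rule: step_cases)
  case (fan v a b)
  then show ?thesis
    using level_twist[of X] level_twist[of Y] by (auto simp: level_def)
next
  case (ext v)
  then show ?thesis using n_ge_3 by (auto simp: level_def twist_def shift_def)
qed

lemma path_deg_map_pr: "lpath P \<Longrightarrow> path_deg (map pr P) = level (last P) - level (hd P)"
proof (induction P)
  case (Cons X P)
  show ?case
  proof (cases P)
    case (Cons Y Q)
    then have XY: "step X Y" "lpath P" using Cons.prems by (auto simp: lpath_Cons)
    then have "arrow_deg (pr X) (pr Y) = level Y - level X"
      using step_valid[OF XY(1)] step_level[OF XY(1)] step_level_less[OF XY(1)]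
      by (simp add: arrow_deg_pr)
    then show ?thesis using Cons Cons.IH XY by simp
  qed simp
qed simp

end

section \<open>Cyclic derivatives of the minimal cycles\<close>

lemma cyc_deriv_absent:
  assumes "\<And>i. 1 \<le> i \<Longrightarrow> i < length c \<Longrightarrow> (c ! (i - 1), c ! i) \<noteq> a"
  shows "cyc_deriv a c = 0"
proof -
  have "{i. 1 \<le> i \<and> i < length c \<and> (c ! (i - 1), c ! i) = a \<and> drop i c @ tl (take i c) = r} = {}" for r
    using assms by blast
  then show ?thesis unfolding cyc_deriv_def by (simp only: card.empty of_nat_0 zero_fun_def)
qed

text \<open>Distinct entries of \<open>tl c\<close> mean distinct targets of arrows, so the arrow
  occurs once and the derivative is the single path from its target round to its source. For a
  closed path the repeated base vertex sits in the head that \<open>tl\<close> drops.\<close>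

lemma cyc_deriv_unique:
  assumes c: "c = u @ [x, y] @ w" and dist: "distinct (tl c)"
  shows "cyc_deriv (x, y) c = path_elem (y # w @ tl (u @ [x]))"
proof
  fix r
  have at: "1 \<le> i \<and> i < length c \<and> (c ! (i - 1), c ! i) = (x, y) \<longleftrightarrow> i = Suc (length u)" for i
  proof
    assume i: "1 \<le> i \<and> i < length c \<and> (c ! (i - 1), c ! i) = (x, y)"
    then have "tl c ! (i - 1) = y" "i - 1 < length (tl c)" by (auto simp: nth_tl)
    moreover have "tl c ! length u = y" "length u < length (tl c)" by (simp_all add: c nth_tl nth_append)
    ultimately have "i - 1 = length u" using dist nth_eq_iff_index_eq by metis
    then show "i = Suc (length u)" using conjunct1[OF i] by linarith
  qed (simp add: c nth_append)
  have "{i. 1 \<le> i \<and> i < length c \<and> (c ! (i - 1), c ! i) = (x, y) \<and> drop i c @ tl (take i c) = r}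
      = {i. i = Suc (length u) \<and> drop i c @ tl (take i c) = r}"
    using at by blast
  also have "\<dots> = (if r = y # w @ tl (u @ [x]) then {Suc (length u)} else {})"
    by (auto simp: c)
  finally have "{i. 1 \<le> i \<and> i < length c \<and> (c ! (i - 1), c ! i) = (x, y) \<and> drop i c @ tl (take i c) = r}
      = (if r = y # w @ tl (u @ [x]) then {Suc (length u)} else {})" .
  then show "cyc_deriv (x, y) c r = (path_elem (y # w @ tl (u @ [x])) :: 'a pathalg) r"
    unfolding cyc_deriv_def path_elem_def by simp
qed

lemma sorted_adjacent_split:
  fixes k l :: "'a::linorder"
  assumes "sorted_wrt (<) xs" "k \<in> set xs" "l \<in> set xs" "k < l"
    and gap: "\<And>m. m \<in> set xs \<Longrightarrow> k < m \<Longrightarrow> \<not> m < l"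
  obtains ys zs where "xs = ys @ [k, l] @ zs"
proof -
  obtain ys r where r: "xs = ys @ k # r" using assms(2) split_list by fast
  have "l \<in> set r" using assms by (auto simp: r sorted_wrt_append)
  then obtain m zs where zs: "r = m # zs" by (cases r) auto
  have "k < m" "m \<le> l" using assms(1) \<open>l \<in> set r\<close> by (auto simp: r zs sorted_wrt_append)
  then have "m = l" using gap[of m] by (force simp: r zs)
  then show thesis using that r zs by simp
qed

lemma successively_if_splits:
  assumes "\<And>xs x y ys. zs = xs @ [x, y] @ ys \<Longrightarrow> P x y"
  shows "successively P zs"
  using assms
proof (induction zs)
  case (Cons z zs)
  have "successively P zs" by (rule Cons.IH) (use Cons.prems[of "z # _"] in auto)
  moreover have "P z (hd zs)" if "zs \<noteq> []" using Cons.prems[of "[]" z "hd zs" "tl zs"] that by simp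
  ultimately show ?case by (auto simp: successively_Cons)
qed simp

lemma tri_cycle_sorted:
  assumes "p < q" "q < r"
  shows "tri_cycle {p, q, r} = [{p, q}, {p, r}, {q, r}, {p, q}]"
proof -
  have "Min {p, q, r} = p" "Max {p, q, r} = r" using assms by (auto intro!: Min_eqI Max_eqI)
  moreover have "(THE x. x \<in> {p, q, r} \<and> x \<noteq> p \<and> x \<noteq> r) = q" using assms by (intro the_equality) auto
  ultimately show ?thesis unfolding tri_cycle_def Let_def by simp
qed

context triangulated_polygon
begin

lemma triangle_cases:
  assumes "T \<in> triangles n \<sigma>"
  obtains p q r where "T = {p, q, r}" "p < q" "q < r" "r < n"
    "{p, q} \<in> edges n \<sigma>" "{q, r} \<in> edges n \<sigma>" "{p, r} \<in> edges n \<sigma>"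
  using assms unfolding triangles_def by blast

lemma finite_triangles: "finite (triangles n \<sigma>)"
proof (rule finite_subset)
  show "triangles n \<sigma> \<subseteq> Pow {..<n}"
  proof
    fix T assume "T \<in> triangles n \<sigma>"
    then obtain p q r where "T = {p, q, r}" "p < q" "q < r" "r < n" by (rule triangle_cases)
    then show "T \<in> Pow {..<n}" by simp
  qed
qed simp

lemma finite_big_vertices: "finite (big_vertices n \<sigma>)"
  by (rule finite_subset[of _ "{..<n}"]) (auto simp: big_vertices_def)

text \<open>Two edges of a triangle already contain its three vertices; an arrow therefore lies in
  at most one cyclic triangle.\<close>

lemma tri_cycle_arrow_union:
  assumes "T \<in> triangles n \<sigma>" "1 \<le> i" "i < length (tri_cycle T)"
    "(tri_cycle T ! (i - 1), tri_cycle T ! i) = (x, y)"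
  shows "T = x \<union> y"
proof -
  obtain p q r where T: "T = {p, q, r}" "p < q" "q < r" by (rule triangle_cases[OF assms(1)])
  have t: "tri_cycle T = [{p, q}, {p, r}, {q, r}, {p, q}]" using tri_cycle_sorted T by simp
  then have "i = 1 \<or> i = 2 \<or> i = 3" using assms(2,3) by auto
  then show ?thesis using assms(4) unfolding t by (elim disjE) (simp_all, auto simp: T(1))
qed

text \<open>Reduction modulo n breaks the chain \<open>v < a < b\<close> in at most one place. The
  three rotations correspond to the three positions of an arrow in \<open>tri_cycle\<close>, whose
  base point is the edge between the two smallest vertices.\<close>

lemma cyclic_order:
  assumes "v < a" "a < b" "b < v + int n"
  shows "nat (v mod int n) < nat (a mod int n) \<and> nat (a mod int n) < nat (b mod int n)
    \<or> nat (a mod int n) < nat (b mod int n) \<and> nat (b mod int n) < nat (v mod int n)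
    \<or> nat (b mod int n) < nat (v mod int n) \<and> nat (v mod int n) < nat (a mod int n)"
proof -
  define k where "k = v div int n * int n"
  have v: "v mod int n = v - k" by (simp add: k_def minus_div_mult_eq_mod)
  have v': "0 \<le> v - k" "v - k < int n" using n_ge_3 by (simp_all flip: v)
  have m: "c mod int n = (if c - k < int n then c - k else c - k - int n)" if "v < c" "c < v + int n" for c
  proof -
    have "c mod int n = (c - k) mod int n" 
      using mod_mult_self1[of "c - k" "v div int n" "int n"] by (simp add: k_def)
    also have "\<dots> = (if c - k < int n then c - k else c - k - int n)"
    proof (cases "c - k < int n")
      case False
      have "(c - k) mod int n = (c - k - int n) mod int n" by simp
      also have "\<dots> = c - k - int n" by (rule mod_pos_pos_trivial) (use False v' that in auto)
      finally show ?thesis using False by simp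
    qed (use v' that in simp)
    finally show ?thesis .
  qed
  show ?thesis
    unfolding v m[of a, OF assms(1) order.strict_trans[OF assms(2,3)]]
      m[of b, OF order.strict_trans[OF assms(1,2)] assms(3)]
    using assms v' by auto
qed

text \<open>The arrow is the first, second or third one of the closed path; removing it always
  leaves the other two in the same cyclic order.\<close>

lemma cyc_deriv_tri_cycle:
  assumes "v < a" "a < b" "b < v + int n"
  shows "cyc_deriv (pr (v, a), pr (v, b))
      (tri_cycle {nat (v mod int n), nat (a mod int n), nat (b mod int n)})
    = path_elem [pr (v, b), pr (a, b), pr (v, a)]"
proof -
  define v' a' b' where v'_def: "v' = nat (v mod int n)" and a'_def: "a' = nat (a mod int n)"
    and b'_def: "b' = nat (b mod int n)"
  have pr: "pr (v, a) = {v', a'}" "pr (v, b) = {v', b'}" "pr (a, b) = {a', b'}"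
    by (simp_all add: pr_def v'_def a'_def b'_def)
  consider "v' < a'" "a' < b'" | "a' < b'" "b' < v'" | "b' < v'" "v' < a'"
    using cyclic_order[OF assms] unfolding v'_def a'_def b'_def by blast
  then show ?thesis
    unfolding pr v'_def[symmetric] a'_def[symmetric] b'_def[symmetric]
  proof cases
    case 1
    have "tri_cycle {v', a', b'} = [] @ [{v', a'}, {v', b'}] @ [{a', b'}, {v', a'}]"
      using tri_cycle_sorted[OF 1] by simp
    from cyc_deriv_unique[OF this] 1
    show "cyc_deriv ({v', a'}, {v', b'}) (tri_cycle {v', a', b'})
        = path_elem [{v', b'}, {a', b'}, {v', a'}]"
      by (simp add: tri_cycle_sorted doubleton_eq_iff)
  next
    case 2
    have T: "{v', a', b'} = {a', b', v'}" by blast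
    have t: "tri_cycle {v', a', b'} = [{a', b'}] @ [{v', a'}, {v', b'}] @ [{a', b'}]"
      unfolding T using tri_cycle_sorted[OF 2] by (simp add: insert_commute)
    show "cyc_deriv ({v', a'}, {v', b'}) (tri_cycle {v', a', b'})
        = path_elem [{v', b'}, {a', b'}, {v', a'}]"
      using cyc_deriv_unique[OF t] 2 unfolding t by (simp add: doubleton_eq_iff)
  next
    case 3
    have T: "{v', a', b'} = {b', v', a'}" by blast
    have t: "tri_cycle {v', a', b'} = [{v', b'}, {a', b'}] @ [{v', a'}, {v', b'}] @ []"
      unfolding T using tri_cycle_sorted[OF 3] by (simp add: insert_commute)
    show "cyc_deriv ({v', a'}, {v', b'}) (tri_cycle {v', a', b'})
        = path_elem [{v', b'}, {a', b'}, {v', a'}]"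
      using cyc_deriv_unique[OF t] 3 unfolding t by (simp add: doubleton_eq_iff)
  qed
qed

section \<open>Fans of edges at a vertex and big cycles\<close>

definition fan :: "int \<Rightarrow> nat list" where
  "fan v = filter (\<lambda>k. E v (v + int k)) [1..<n]"

lemma set_fan: "set (fan v) = {k. 1 \<le> k \<and> k < n \<and> E v (v + int k)}"
  by (auto simp: fan_def)

lemma sorted_fan: "sorted_wrt (<) (fan v)"
  unfolding fan_def by (rule sorted_wrt_filter) simp

lemma hd_fan: "fan v = 1 # tl (fan v)"
proof -
  have "[1..<n] = 1 # [2..<n]" using n_ge_3 by (simp add: upt_conv_Cons numeral_2_eq_2)
  then show ?thesis using E_side[of v] by (simp add: fan_def)
qed

lemma last_fan: "last (fan v) = n - 1"
proof -
  have "[1..<n] = [1..<n - 1] @ [n - 1]" using n_ge_3 upt_Suc_append[of 1 "n - 1"] by simp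
  moreover have "E v (v + int (n - 1))"
    using E_side[of "v - 1"] E_add_n(2)[of v "v - 1"] n_ge_3 by (simp add: E_commute of_nat_diff algebra_simps)
  ultimately show ?thesis by (simp add: fan_def)
qed

text \<open>No edge at \<open>v\<close> lies between neighbouring entries, so
  \<open>E_consecutive\<close> supplies the triangle that makes this a step.\<close>

lemma fan_adjacent:
  assumes "fan v = xs @ [k, l] @ ys"
  shows "step (v, v + int k) (v, v + int l)"
proof -
  have kl: "k \<in> set (fan v)" "l \<in> set (fan v)" by (simp_all add: assms)
  have s: "sorted_wrt (<) (xs @ [k, l] @ ys)" using sorted_fan assms by metis
  then have "k < l" by (simp add: sorted_wrt_append)
  have "\<not> E v c" if c: "v + int k < c" "c < v + int l" for c
  proof
    assume "E v c"
    then have "nat (c - v) \<in> set (fan v)" using c kl by (auto simp: set_fan)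
    moreover have "k < nat (c - v)" "nat (c - v) < l" using c by auto
    ultimately show False using s by (auto simp: assms sorted_wrt_append)
  qed
  then have "E (v + int k) (v + int l)"
    using E_consecutive[of v "v + int k" "v + int l"] kl \<open>k < l\<close> by (auto simp: set_fan)
  then show ?thesis using kl \<open>k < l\<close> by (intro step_fan) (auto simp: set_fan)
qed

lemma pr_offset: "pr (v, v + int k) = {nat (v mod int n), (nat (v mod int n) + k) mod n}"
proof -
  have "int ((nat (v mod int n) + k) mod n) = (v mod int n + int k) mod int n"
    using n_ge_3 by (simp add: zmod_int)
  also have "\<dots> = (v + int k) mod int n" by (rule mod_add_left_eq)
  finally have "nat ((v + int k) mod int n) = (nat (v mod int n) + k) mod n" by (metis nat_int)
  then show ?thesis by (simp add: pr_def)
qed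

lemma big_cycle_fan:
  "big_cycle n \<sigma> (nat (v mod int n)) = map (\<lambda>k. pr (v, v + int k)) (fan v) @ [pr (v, v + 1)]"
proof -
  have "pr (v, v + 1) = {nat (v mod int n), (nat (v mod int n) + 1) mod n}" using pr_offset[of v 1] by simp
  then show ?thesis unfolding big_cycle_def fan_def E_def pr_offset by simp
qed

lemma inj_on_fan: "inj_on (\<lambda>k. pr (v, v + int k)) (set (fan v))"
proof (rule inj_onI)
  fix k l assume kl: "k \<in> set (fan v)" "l \<in> set (fan v)" and eq: "pr (v, v + int k) = pr (v, v + int l)"
  have "nat ((v + int k) mod int n) = nat ((v + int l) mod int n)"
    using eq vertex_neq[of v "v + int k"] vertex_neq[of v "v + int l"] kl
    unfolding pr_def by (simp add: doubleton_eq_iff set_fan)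
  then have "(v + int k) mod int n = (v + int l) mod int n" by (simp only: nat_mod_eq_iff)
  then have "v + int k = v + int l" by (rule mod_inj_window) (use kl in \<open>auto simp: set_fan\<close>)
  then show "k = l" by simp
qed

lemma distinct_tl_big_cycle: "distinct (tl (big_cycle n \<sigma> (nat (v mod int n))))"
proof -
  have d: "distinct (fan v)" using sorted_fan strict_sorted_iff by blast
  have "distinct (map (\<lambda>k. pr (v, v + int k)) (1 # tl (fan v)))"
    using d inj_on_fan hd_fan[of v] by (metis distinct_map)
  then show ?thesis unfolding big_cycle_fan by (subst hd_fan) (simp add: distinct_map)
qed

lemma big_cycle_contains:
  assumes "i < length (big_cycle n \<sigma> w)" shows "w \<in> big_cycle n \<sigma> w ! i"
proof -
  have "\<forall>e\<in>set (big_cycle n \<sigma> w). w \<in> e" by (auto simp: big_cycle_def)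
  then show ?thesis using assms nth_mem by blast
qed

text \<open>What remains of the cycle runs from \<open>{v, b}\<close> through the rest of the fan,
  takes the external arrow and returns through the beginning of the fan to \<open>{v, a}\<close>.
  The return part is twisted on lifts, so the end is \<open>(a, v + n)\<close>, as for the triangle.
  That the first step avoids \<open>(a, b)\<close> later identifies it with the other arrow leaving
  \<open>(v, b)\<close>.\<close>

lemma cyc_deriv_big_cycle:
  assumes vab: "v < a" "a < b" "b < v + int n" "E v a" "E v b" "E a b"
    and nonfrozen: "\<not> (a = v + 1 \<and> b = v + int n - 1)"
  obtains Q where "lpath Q" "hd Q = (v, b)" "last Q = (a, v + int n)" "1 < length Q" "Q ! 1 \<noteq> (a, b)"
    "cyc_deriv (pr (v, a), pr (v, b)) (big_cycle n \<sigma> (nat (v mod int n))) = path_elem (map pr Q)"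
proof -
  define k l where "k = nat (a - v)" and "l = nat (b - v)"
  have k: "a = v + int k" "k \<in> set (fan v)" and l: "b = v + int l" "l \<in> set (fan v)" and kl: "k < l"
    using vab by (auto simp: k_def l_def set_fan)
  \<comment> \<open>An edge from \<open>v\<close> to a vertex strictly between \<open>a\<close> and
    \<open>b\<close> would cross \<open>{a, b}\<close>, so the two offsets are neighbours in the
    fan.\<close>
  have "\<not> m < l" if "m \<in> set (fan v)" "k < m" for m
    using non_crossing[of v a "v + int m" b] that vab by (auto simp: k l set_fan)
  then obtain ys zs where split: "fan v = ys @ [k, l] @ zs"
    using sorted_adjacent_split[OF sorted_fan k(2) l(2) kl] by blast
  let ?f = "\<lambda>m. pr (v, v + int m)"
  \<comment> \<open>\<open>A\<close> is the part of the fan from \<open>b\<close> on;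
    \<open>B\<close> is the part up to \<open>a\<close>, twisted because it follows the external
    arrow.\<close>
  define A B where "A = map (\<lambda>m. (v, v + int m)) (l # zs)"
    and "B = map (\<lambda>m. twist (v, v + int m)) (ys @ [k])"
  define Q where "Q = A @ B"
  have hd1: "hd (ys @ [k]) = 1" using hd_fan[of v] split by (cases ys) simp_all
  have last1: "last (l # zs) = n - 1" using last_fan[of v] split by simp
  have stp: "successively (\<lambda>k l. step (v, v + int k) (v, v + int l)) xs" if "fan v = us @ xs @ ws" for us xs ws
    by (rule successively_if_splits) (use fan_adjacent[of v "us @ _" _ _ "_ @ ws"] that in simp)
  have sA: "successively step A" using stp[of "ys @ [k]" "l # zs" "[]"] split
    unfolding A_def successively_map by simp
  have sB: "successively step B" using stp[of "[]" "ys @ [k]" "l # zs"] split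
    unfolding B_def successively_map by simp
  have v1: "has_diag v" using has_diagI vab nonfrozen by blast
  have "hd B = (v + 1, v + int n)" using hd1 by (cases ys) (simp_all add: B_def twist_def)
  moreover have "last A = (v, v + int n - 1)"
    using last1 n_ge_3 unfolding A_def by (subst last_map) (simp_all add: of_nat_diff)
  moreover have "step (v, v + int n - 1) (v + 1, v + int n)"
    using step_ext[OF v1] by (simp flip: step_twist[of "(v - 1, v)"] add: twist_def algebra_simps)
  ultimately have "successively step Q"
    using sA sB by (simp add: Q_def successively_append_iff)
  moreover have "valid (hd Q)" using vab by (simp add: Q_def A_def valid_def l(1)[symmetric])
  ultimately have 1: "lpath Q" by (simp add: lpath_def Q_def A_def)
  have 2: "hd Q = (v, b)" by (simp add: Q_def A_def l(1))
  have 3: "last Q = (a, v + int n)" by (simp add: Q_def B_def k(1) twist_def)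
  have 4: "1 < length Q" by (simp add: Q_def A_def B_def)
  have 5: "Q ! 1 \<noteq> (a, b)"
  proof (cases zs)
    case Nil
    then have "Q ! 1 = hd B" by (cases ys) (simp_all add: Q_def A_def B_def)
    then show ?thesis using \<open>hd B = (v + 1, v + int n)\<close> vab by simp
  next
    case (Cons z zs')
    then have "Q ! 1 = (v, v + int z)" by (simp add: Q_def A_def)
    then show ?thesis using vab by simp
  qed
  have c: "big_cycle n \<sigma> (nat (v mod int n)) = map ?f ys @ [?f k, ?f l] @ (map ?f zs @ [?f 1])"
    unfolding big_cycle_fan split by simp
  have fB: "map pr B = ?f 1 # tl (map ?f ys @ [?f k])"
    using hd1 by (cases ys) (simp_all add: B_def)
  have "cyc_deriv (pr (v, a), pr (v, b)) (big_cycle n \<sigma> (nat (v mod int n)))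
      = path_elem (?f l # (map ?f zs @ [?f 1]) @ tl (map ?f ys @ [?f k]))"
    unfolding k(1) l(1) by (rule cyc_deriv_unique[OF c distinct_tl_big_cycle])
  also have "?f l # (map ?f zs @ [?f 1]) @ tl (map ?f ys @ [?f k]) = map pr Q"
    by (simp add: Q_def A_def fB)
  finally show thesis using that[OF 1 2 3 4 5] by blast
qed

text \<open>Exactly one cyclic triangle and one big cycle contribute: the two edges together span
  the triangle, and \<open>v\<close> is their only common vertex. Excluding two sides ensures a
  diagonal at \<open>v\<close>, so that this big cycle does occur in the potential.\<close>

lemma dW_internal:
  assumes vab: "v < a" "a < b" "b < v + int n" "E v a" "E v b" "E a b"
    and nonfrozen: "\<not> (a = v + 1 \<and> b = v + int n - 1)"
  obtains Q where "lpath Q" "hd Q = (v, b)" "last Q = (a, v + int n)" "1 < length Q" "Q ! 1 \<noteq> (a, b)"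
    "dW n \<sigma> (pr (v, a), pr (v, b)) =
      path_elem (map pr [(v, b), (a, b), (a, v + int n)]) - path_elem (map pr Q)"
proof -
  let ?v = "nat (v mod int n)" and ?a = "nat (a mod int n)" and ?b = "nat (b mod int n)"
  let ?T = "{?v, ?a, ?b}" and ?\<alpha> = "(pr (v, a), pr (v, b))"
  obtain Q where Q: "lpath Q" "hd Q = (v, b)" "last Q = (a, v + int n)" "1 < length Q" "Q ! 1 \<noteq> (a, b)"
    "cyc_deriv ?\<alpha> (big_cycle n \<sigma> ?v) = (path_elem (map pr Q) :: 'a pathalg)"
    using cyc_deriv_big_cycle[OF assms] by metis
  have T: "?T \<in> triangles n \<sigma>" by (rule triangle_in_triangles[OF vab])
  have "cyc_deriv ?\<alpha> (tri_cycle S) = (0 :: 'a pathalg)" if "S \<in> triangles n \<sigma> - {?T}" for S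
  proof (rule cyc_deriv_absent)
    fix i assume i: "1 \<le> i" "i < length (tri_cycle S)"
    show "(tri_cycle S ! (i - 1), tri_cycle S ! i) \<noteq> ?\<alpha>"
    proof
      assume "(tri_cycle S ! (i - 1), tri_cycle S ! i) = ?\<alpha>"
      then have "S = pr (v, a) \<union> pr (v, b)" using tri_cycle_arrow_union i that by blast
      then show False using that by (simp add: pr_def insert_commute)
    qed
  qed
  then have "(\<Sum>S\<in>triangles n \<sigma>. cyc_deriv ?\<alpha> (tri_cycle S)) = (cyc_deriv ?\<alpha> (tri_cycle ?T) :: 'a pathalg)"
    using sum.remove[OF finite_triangles T, of "\<lambda>S. cyc_deriv ?\<alpha> (tri_cycle S) :: 'a pathalg"] by simp
  also have "\<dots> = path_elem [pr (v, b), pr (a, b), pr (v, a)]" by (rule cyc_deriv_tri_cycle[OF vab(1-3)])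
  finally have 1: "(\<Sum>S\<in>triangles n \<sigma>. cyc_deriv ?\<alpha> (tri_cycle S))
    = (path_elem [pr (v, b), pr (a, b), pr (v, a)] :: 'a pathalg)" .
  have "has_diag v" using has_diagI vab nonfrozen by blast
  then have v: "?v \<in> big_vertices n \<sigma>" using has_diag_iff vertex_less by (simp add: big_vertices_def)
  have "cyc_deriv ?\<alpha> (big_cycle n \<sigma> w) = (0 :: 'a pathalg)" if w: "w \<in> big_vertices n \<sigma> - {?v}" for w
  proof (rule cyc_deriv_absent)
    fix i assume i: "1 \<le> i" "i < length (big_cycle n \<sigma> w)"
    show "(big_cycle n \<sigma> w ! (i - 1), big_cycle n \<sigma> w ! i) \<noteq> ?\<alpha>"
    proof
      assume "(big_cycle n \<sigma> w ! (i - 1), big_cycle n \<sigma> w ! i) = ?\<alpha>"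
      then have "w \<in> pr (v, a)" "w \<in> pr (v, b)"
        using big_cycle_contains[of "i - 1" w] big_cycle_contains[of i w] i by auto
      then have "w = ?v" using vertex_neq[OF vab(2)] vab by (auto simp: pr_def)
      then show False using w by blast
    qed
  qed
  then have "(\<Sum>w\<in>big_vertices n \<sigma>. cyc_deriv ?\<alpha> (big_cycle n \<sigma> w)) = (path_elem (map pr Q) :: 'a pathalg)"
    using sum.remove[OF finite_big_vertices v, of "\<lambda>w. cyc_deriv ?\<alpha> (big_cycle n \<sigma> w) :: 'a pathalg"] Q(6)
    by simp
  moreover have "pr (a, v + int n) = pr (v, a)" using pr_twist[of "(v, a)"] by (simp add: twist_def)
  ultimately have "dW n \<sigma> ?\<alpha> =
      path_elem (map pr [(v, b), (a, b), (a, v + int n)]) - (path_elem (map pr Q) :: 'a pathalg)"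
    using 1 by (simp add: dW_def)
  then show thesis using that Q(1-5) by blast
qed

end

section \<open>The Jacobian ideal\<close>

lemma last_append_tl: "S \<noteq> [] \<Longrightarrow> last P = hd S \<Longrightarrow> last (P @ tl S) = last S"
  by (cases S) auto

lemma supp_scal: "{r. scal c f r \<noteq> 0} \<subseteq> {r. f r \<noteq> 0}"
  by (auto simp: scal_def)

lemma pmult_scal_left:
  assumes "finite {p. f p \<noteq> 0}" "finite {p. g p \<noteq> 0}"
  shows "pmult (scal c f) g = scal c (pmult f g)"
proof (cases "c = 0")
  case False
  then have "{p. scal c f p \<noteq> 0} = {p. f p \<noteq> 0}" by (auto simp: scal_def)
  then show ?thesis
    unfolding pmult_def by (auto simp: scal_def fun_eq_iff sum_distrib_left mult.assoc intro!: sum.cong)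
qed (simp add: pmult_def scal_def)

context triangulated_polygon
begin

lemma PA_add_eq: "add PA f g = f + g"
  by (simp add: plus_fun_def)

lemma PA_plus: "f \<in> carrier PA \<Longrightarrow> g \<in> carrier PA \<Longrightarrow> f + g \<in> carrier PA"
  using add_in_PA by (simp add: plus_fun_def)

lemma PA_scal: "f \<in> carrier PA \<Longrightarrow> scal c f \<in> carrier PA"
  using supp_scal[of c f] finite_subset unfolding PA_carrier by blast

lemma PA_uminus: "f \<in> carrier PA \<Longrightarrow> - f \<in> carrier PA"
  using PA_scal[of f "-1"] by (simp add: scal_def fun_Compl_def)

lemma PA_minus: "f \<in> carrier PA \<Longrightarrow> g \<in> carrier PA \<Longrightarrow> f - g \<in> carrier PA"
  using PA_plus[of f "- g"] PA_uminus[of g] by simp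

lemma pmult_plus_left:
  "f \<in> carrier PA \<Longrightarrow> g \<in> carrier PA \<Longrightarrow> h \<in> carrier PA \<Longrightarrow> pmult (f + g) h = pmult f h + pmult g h"
  using pmult_add_left[of f g h] by (simp add: PA_finite plus_fun_def)

lemma pmult_plus_right:
  "f \<in> carrier PA \<Longrightarrow> g \<in> carrier PA \<Longrightarrow> h \<in> carrier PA \<Longrightarrow> pmult h (f + g) = pmult h f + pmult h g"
  using pmult_add_right[of f g h] by (simp add: PA_finite plus_fun_def)

lemma pmult_minus_left:
  assumes "f \<in> carrier PA" "g \<in> carrier PA" "h \<in> carrier PA"
  shows "pmult (f - g) h = pmult f h - pmult g h"
  using pmult_plus_left[OF PA_minus[OF assms(1,2)] assms(2,3)] by (simp add: algebra_simps)

lemma pmult_minus_right: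
  assumes "f \<in> carrier PA" "g \<in> carrier PA" "h \<in> carrier PA"
  shows "pmult h (f - g) = pmult h f - pmult h g"
  using pmult_plus_right[OF PA_minus[OF assms(1,2)] assms(2,3)] by (simp add: algebra_simps)

lemma PA_one_left: "f \<in> carrier PA \<Longrightarrow> pmult (\<Sum>i\<in>edges n \<sigma>. path_elem [i]) f = f"
  using ring.ring_simprules(12)[OF ring_PA] by (metis PA_sel(1,4) monoid.l_one ring.is_monoid ring_PA)

section \<open>Class sums and the ideal on which they vanish\<close>

definition class_sum :: "nat set \<Rightarrow> nat set \<Rightarrow> int \<Rightarrow> 'k::field pathalg \<Rightarrow> 'k" where
  "class_sum e e' d = weighted_sum (\<lambda>p c. if hd p = e \<and> last p = e' \<and> path_deg p = d then c else 0)"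

lemma additive_class_weight:
  "additive_weight (\<lambda>p c :: 'k::field. if hd p = e \<and> last p = e' \<and> path_deg p = d then c else 0)"
  by (auto simp: additive_weight_def)

lemma class_sum_plus:
  "f \<in> carrier PA \<Longrightarrow> g \<in> carrier PA \<Longrightarrow> class_sum e e' d (f + g) = class_sum e e' d f + class_sum e e' d g"
  unfolding class_sum_def plus_fun_def by (intro weighted_sum_add additive_class_weight PA_finite)

lemma class_sum_minus:
  "f \<in> carrier PA \<Longrightarrow> g \<in> carrier PA \<Longrightarrow> class_sum e e' d (f - g) = class_sum e e' d f - class_sum e e' d g"
  using class_sum_plus[of "f - g" g e e' d] PA_minus[of f g] by (simp add: algebra_simps)

lemma class_sum_path_elem:
  "class_sum e e' d (path_elem p) = (if hd p = e \<and> last p = e' \<and> path_deg p = d then 1 else 0)"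
  unfolding class_sum_def by (rule weighted_sum_path_elem[OF additive_class_weight])

lemma supp_path: "f \<in> carrier PA \<Longrightarrow> f p \<noteq> 0 \<Longrightarrow> is_path n \<sigma> p"
  by (simp add: PA_carrier)

lemma path_ends:
  "is_path n \<sigma> p \<Longrightarrow> is_path n \<sigma> q \<Longrightarrow> last p = hd q \<Longrightarrow>
    hd (p @ tl q) = hd p \<and> last (p @ tl q) = last q \<and> path_deg (p @ tl q) = path_deg p + path_deg q"
  using path_deg_append_tl[of p q] by (cases q) (auto simp: is_path_def)

lemma class_sum_pmult:
  assumes "f \<in> carrier PA" "g \<in> carrier PA"
  shows "class_sum e e' d (pmult f g) = (\<Sum>p | f p \<noteq> 0. \<Sum>q | g q \<noteq> 0.
    if last p = hd q \<and> hd p = e \<and> last q = e' \<and> path_deg p + path_deg q = d then f p * g q else 0)"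
proof -
  have "class_sum e e' d (pmult f g) = (\<Sum>p | f p \<noteq> 0. \<Sum>q | g q \<noteq> 0. if last p = hd q then
      (if hd (p @ tl q) = e \<and> last (p @ tl q) = e' \<and> path_deg (p @ tl q) = d then f p * g q else 0) else 0)"
    unfolding class_sum_def
    by (rule weighted_sum_pmult[OF PA_finite[OF assms(1)] PA_finite[OF assms(2)] additive_class_weight])
  also have "\<dots> = (\<Sum>p | f p \<noteq> 0. \<Sum>q | g q \<noteq> 0.
    if last p = hd q \<and> hd p = e \<and> last q = e' \<and> path_deg p + path_deg q = d then f p * g q else 0)"
  proof (intro sum.cong refl)
    fix p q assume "p \<in> {p. f p \<noteq> 0}" "q \<in> {q. g q \<noteq> 0}"
    then have "is_path n \<sigma> p" "is_path n \<sigma> q" using assms supp_path by blast+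
    then show "(if last p = hd q then
      (if hd (p @ tl q) = e \<and> last (p @ tl q) = e' \<and> path_deg (p @ tl q) = d then f p * g q else 0) else 0)
     = (if last p = hd q \<and> hd p = e \<and> last q = e' \<and> path_deg p + path_deg q = d then f p * g q else 0)"
      using path_ends[of p q] by (cases "last p = hd q") simp_all
  qed
  finally show ?thesis .
qed

text \<open>For a fixed path \<open>p\<close> of \<open>f\<close> the inner sum is a multiple of one
  class sum of \<open>g\<close>, with source \<open>last p\<close> and degree lowered by that of
  \<open>p\<close>. With its mirror image this makes \<open>class_kernel\<close> a two-sided
  ideal.\<close>

lemma class_sum_pmult_zero_right:
  assumes "f \<in> carrier PA" "g \<in> carrier PA" "\<And>e e' d. class_sum e e' d g = 0"
  shows "class_sum e e' d (pmult f g) = 0"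
  unfolding class_sum_pmult[OF assms(1,2)]
proof (rule sum.neutral, rule ballI)
  fix p
  have "(\<Sum>q | g q \<noteq> 0. if last p = hd q \<and> hd p = e \<and> last q = e' \<and> path_deg p + path_deg q = d
        then f p * g q else 0)
     = (if hd p = e then f p else 0) * class_sum (last p) e' (d - path_deg p) g"
    unfolding class_sum_def weighted_sum_def sum_distrib_left by (intro sum.cong refl) auto
  then show "(\<Sum>q | g q \<noteq> 0. if last p = hd q \<and> hd p = e \<and> last q = e' \<and> path_deg p + path_deg q = d
        then f p * g q else 0) = 0" using assms(3) by simp
qed

lemma class_sum_pmult_zero_left:
  assumes "f \<in> carrier PA" "g \<in> carrier PA" "\<And>e e' d. class_sum e e' d f = 0"
  shows "class_sum e e' d (pmult f g) = 0"
  unfolding class_sum_pmult[OF assms(1,2)]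
proof (subst sum.swap, rule sum.neutral, rule ballI)
  fix q
  have "(\<Sum>p | f p \<noteq> 0. if last p = hd q \<and> hd p = e \<and> last q = e' \<and> path_deg p + path_deg q = d
        then f p * g q else 0)
     = class_sum e (hd q) (d - path_deg q) f * (if last q = e' then g q else 0)"
    unfolding class_sum_def weighted_sum_def sum_distrib_right by (intro sum.cong refl) auto
  then show "(\<Sum>p | f p \<noteq> 0. if last p = hd q \<and> hd p = e \<and> last q = e' \<and> path_deg p + path_deg q = d
        then f p * g q else 0) = 0" using assms(3) by simp
qed

definition class_kernel :: "'k::field pathalg set" where
  "class_kernel = {f \<in> carrier PA. \<forall>e e' d. class_sum e e' d f = 0}"

lemma class_kernel_ideal: "ideal (class_kernel :: 'k::field pathalg set) PA"
proof (rule idealI[OF ring_PA])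
  interpret ring "PA :: 'k pathalg ring" by (rule ring_PA)
  show "subgroup class_kernel (add_monoid (PA :: 'k pathalg ring))"
  proof (rule add.subgroupI)
    show "class_kernel \<subseteq> carrier (PA :: 'k pathalg ring)" by (auto simp: class_kernel_def)
    have "(0 :: 'k pathalg) \<in> class_kernel"
      using zero_in_PA by (simp add: class_kernel_def zero_fun_def class_sum_def)
    then show "class_kernel \<noteq> ({} :: 'k pathalg set)" by blast
  next
    fix f :: "'k pathalg" assume f: "f \<in> class_kernel"
    then have fc: "f \<in> carrier PA" by (simp add: class_kernel_def)
    have "\<ominus>\<^bsub>PA\<^esub> f = - f"
      by (rule minus_equality) (use fc PA_uminus in \<open>simp_all add: zero_fun_def fun_eq_iff\<close>)
    moreover have "class_sum e e' d (0 - f) = 0" for e e' d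
      using class_sum_minus[of 0 f e e' d] fc f zero_in_PA
      by (simp add: class_kernel_def zero_fun_def class_sum_def)
    ultimately show "\<ominus>\<^bsub>PA\<^esub> f \<in> class_kernel" using fc PA_uminus by (simp add: class_kernel_def)
  next
    fix f g :: "'k pathalg" assume "f \<in> class_kernel" "g \<in> class_kernel"
    then show "f \<oplus>\<^bsub>PA\<^esub> g \<in> class_kernel"
      unfolding PA_add_eq by (simp add: class_kernel_def class_sum_plus PA_plus)
  qed
qed (auto simp: class_kernel_def pmult_in_PA class_sum_pmult_zero_left class_sum_pmult_zero_right)

section \<open>The relators and the ideal they generate\<close>

definition relators :: "'k::field pathalg set" where
  "relators = {dW n \<sigma> a | a. a \<in> arrows n \<sigma> \<and> (fst a \<notin> frozen n \<or> snd a \<notin> frozen n)}"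

lemma pr_frozen: "v < a \<Longrightarrow> a < v + int n \<Longrightarrow> pr (v, a) \<in> frozen n \<longleftrightarrow> a = v + 1 \<or> a = v + int n - 1"
  unfolding frozen_def mem_Collect_eq by (rule is_side_pr)

text \<open>An external arrow joins two sides and contributes no relator; an internal one gives the
  triangle path minus the big-cycle path of \<open>dW_internal\<close>, whose lifts share both ends.
  Equal ends of lifts force equal degrees, so the class sums of a relator vanish.\<close>

lemma relator_cases:
  assumes "g \<in> relators"
  obtains P Q where "lpath P" "lpath Q" "hd P = hd Q" "last P = last Q"
    "g = path_elem (map pr P) - path_elem (map pr Q)"
proof -
  from assms obtain x y where g: "g = dW n \<sigma> (x, y)" "(x, y) \<in> arrows n \<sigma>" "x \<notin> frozen n \<or> y \<notin> frozen n"
    unfolding relators_def by auto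
  from g(2) consider "internal_arrow n \<sigma> x y" | "external_arrow n \<sigma> x y" by (auto simp: arrows_def)
  then show thesis
  proof cases
    case 1
    then obtain v a b where vab: "v < a" "a < b" "b < v + int n" "E v a" "E v b" "E a b"
      and xy: "x = pr (v, a)" "y = pr (v, b)" by (rule internal_arrow_cases)
    have nf: "\<not> (a = v + 1 \<and> b = v + int n - 1)" using g(3) vab by (auto simp: xy pr_frozen)
    obtain Q where Q: "lpath Q" "hd Q = (v, b)" "last Q = (a, v + int n)"
      "dW n \<sigma> (pr (v, a), pr (v, b)) = (path_elem (map pr [(v, b), (a, b), (a, v + int n)]) :: 'a pathalg) - path_elem (map pr Q)"
      using dW_internal[OF vab nf] by metis
    have "lpath [(v, b), (a, b), (a, v + int n)]"
      using vab by (simp add: lpath_Cons step_def valid_def E_commute)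
    then show thesis using that[of _ Q] Q g(1) xy by fastforce
  next
    case 2
    then obtain v where "x = pr (v - 1, v)" "y = pr (v, v + 1)" by (rule external_arrow_cases)
    then show thesis using g(3) pr_frozen[of "v - 1" v] pr_frozen[of v "v + 1"] n_ge_3 by simp
  qed
qed

lemma relators_in_kernel: "(relators :: 'k::field pathalg set) \<subseteq> class_kernel"
proof
  fix g :: "'k pathalg" assume "g \<in> relators"
  then obtain P Q where PQ: "lpath P" "lpath Q" "hd P = hd Q" "last P = last Q"
    and g: "g = path_elem (map pr P) - path_elem (map pr Q)" by (rule relator_cases)
  have ne: "P \<noteq> []" "Q \<noteq> []" using PQ by auto
  have c: "path_elem (map pr P) \<in> carrier PA" "path_elem (map pr Q) \<in> carrier PA"
    using PQ path_elem_in_PA lpath_is_path by blast+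
  have "class_sum e e' d g = 0" for e e' d
    unfolding g class_sum_minus[OF c] class_sum_path_elem
    using PQ ne path_deg_map_pr[of P] path_deg_map_pr[of Q] by (simp add: hd_map last_map)
  then show "g \<in> class_kernel" using PA_minus[OF c] g by (simp add: class_kernel_def)
qed

abbreviation J :: "'k::field pathalg set" where "J \<equiv> jac_ideal n \<sigma>"

lemma J_eq: "J = genideal PA relators"
  by (simp add: jac_ideal_def relators_def)

lemma relators_in_PA: "(relators :: 'k::field pathalg set) \<subseteq> carrier PA"
  using relators_in_kernel by (auto simp: class_kernel_def)

lemma J_ideal: "ideal (J :: 'k::field pathalg set) PA"
  unfolding J_eq by (rule ring.genideal_ideal[OF ring_PA relators_in_PA])

lemma J_subset_kernel: "(J :: 'k::field pathalg set) \<subseteq> class_kernel"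
  unfolding J_eq by (rule ring.genideal_minimal[OF ring_PA class_kernel_ideal relators_in_kernel])

lemma relators_in_J: "(relators :: 'k::field pathalg set) \<subseteq> J"
  unfolding J_eq by (rule ring.genideal_self[OF ring_PA relators_in_PA])

lemma J_in_PA: "(f :: 'k::field pathalg) \<in> J \<Longrightarrow> f \<in> carrier PA"
  using J_subset_kernel by (auto simp: class_kernel_def)

lemma J_plus: "(f :: 'k::field pathalg) \<in> J \<Longrightarrow> g \<in> J \<Longrightarrow> f + g \<in> J"
  using additive_subgroup.a_closed[OF ideal.axioms(1)[OF J_ideal], of f g] by (simp only: PA_add_eq)

lemma J_zero: "(0 :: 'k::field pathalg) \<in> J"
  using additive_subgroup.zero_closed[OF ideal.axioms(1)[OF J_ideal]]
  by (simp add: zero_fun_def)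

lemma J_mult_left: "(g :: 'k::field pathalg) \<in> J \<Longrightarrow> f \<in> carrier PA \<Longrightarrow> pmult f g \<in> J"
  using ideal.I_l_closed[OF J_ideal, of g f] by simp

lemma J_mult_right: "(g :: 'k::field pathalg) \<in> J \<Longrightarrow> f \<in> carrier PA \<Longrightarrow> pmult g f \<in> J"
  using ideal.I_r_closed[OF J_ideal, of g f] by simp

text \<open>An ideal is closed only under ring multiplication, so the scalar is realised as
  multiplication by a scaled identity.\<close>

lemma J_scal: assumes "(f :: 'k::field pathalg) \<in> J" shows "scal c f \<in> J"
proof -
  let ?e = "(\<Sum>i\<in>edges n \<sigma>. path_elem [i]) :: 'k pathalg"
  have e: "?e \<in> carrier PA" by (rule trivial_paths_in_PA) simp
  have "pmult (scal c ?e) f = scal c f"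
    using pmult_scal_left[of ?e f c] PA_finite[OF e] PA_finite[OF J_in_PA[OF assms]]
      PA_one_left[OF J_in_PA[OF assms]] by simp
  then show ?thesis using J_mult_left[OF assms PA_scal[OF e, of c]] by simp
qed

lemma J_uminus: "(f :: 'k::field pathalg) \<in> J \<Longrightarrow> - f \<in> J"
  using J_scal[of f "-1"] by (simp add: scal_def fun_Compl_def)

lemma J_sum: "(\<And>i. i \<in> S \<Longrightarrow> (f i :: 'k::field pathalg) \<in> J) \<Longrightarrow> (\<Sum>i\<in>S. f i) \<in> J"
  by (induction S rule: infinite_finite_induct) (auto simp: J_zero J_plus)

end

text \<open>The type argument fixes the coefficient field: equivalence of paths depends on it, but the
  type of the relation does not mention it.\<close>

locale frozen_jacobian_algebra = triangulated_polygon +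
  fixes K :: "'k::field itself"
begin

section \<open>Equivalence of paths modulo the Jacobian ideal\<close>

definition equiv_path :: "nat set list \<Rightarrow> nat set list \<Rightarrow> bool" where
  "equiv_path p q \<longleftrightarrow> (path_elem p - path_elem q :: 'k pathalg) \<in> J"

lemma equiv_refl [simp]: "equiv_path p p"
  by (simp add: equiv_path_def J_zero)

lemma equiv_sym: "equiv_path p q \<Longrightarrow> equiv_path q p"
  unfolding equiv_path_def using J_uminus by fastforce

lemma equiv_trans: "equiv_path p q \<Longrightarrow> equiv_path q r \<Longrightarrow> equiv_path p r"
  unfolding equiv_path_def using J_plus by fastforce

lemma equiv_append_right:
  assumes "equiv_path p q" "is_path n \<sigma> p" "is_path n \<sigma> q" "is_path n \<sigma> r" "last p = hd r" "last q = hd r"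
  shows "equiv_path (p @ tl r) (q @ tl r)"
proof -
  have "pmult (path_elem p - path_elem q) (path_elem r) \<in> (J :: 'k pathalg set)"
    by (rule J_mult_right) (use assms in \<open>simp_all add: equiv_path_def path_elem_in_PA\<close>)
  then show ?thesis
    using assms by (simp add: equiv_path_def pmult_minus_left path_elem_in_PA pmult_path_elem)
qed

lemma equiv_append_left:
  assumes "equiv_path p q" "is_path n \<sigma> p" "is_path n \<sigma> q" "is_path n \<sigma> r" "last r = hd p" "last r = hd q"
  shows "equiv_path (r @ tl p) (r @ tl q)"
proof -
  have "pmult (path_elem r) (path_elem p - path_elem q) \<in> (J :: 'k pathalg set)"
    by (rule J_mult_left) (use assms in \<open>simp_all add: equiv_path_def path_elem_in_PA\<close>)
  then show ?thesis
    using assms by (simp add: equiv_path_def pmult_minus_right path_elem_in_PA pmult_path_elem)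
qed

definition equiv_lpath :: "(int \<times> int) list \<Rightarrow> (int \<times> int) list \<Rightarrow> bool" where
  "equiv_lpath P Q \<longleftrightarrow> equiv_path (map pr P) (map pr Q)"

lemma equiv_lpath_append:
  assumes "equiv_lpath P Q" "lpath P" "lpath Q" "lpath R" "last P = hd R" "last Q = hd R"
  shows "equiv_lpath (P @ tl R) (Q @ tl R)"
proof -
  have "P \<noteq> []" "Q \<noteq> []" "R \<noteq> []" using assms by auto
  then show ?thesis
    using equiv_append_right[of "map pr P" "map pr Q" "map pr R"] assms
    by (simp add: equiv_lpath_def lpath_is_path last_map hd_map map_tl)
qed

lemma equiv_lpath_Cons:
  assumes "equiv_lpath P Q" "lpath (X # P)" "lpath (X # Q)" "P \<noteq> []" "Q \<noteq> []" "hd P = hd Q"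
  shows "equiv_lpath (X # P) (X # Q)"
proof -
  have "lpath [X, hd P]" "lpath P" "lpath Q" using assms by (auto simp: lpath_Cons step_valid)
  then have "equiv_path (map pr [X, hd P] @ tl (map pr P)) (map pr [X, hd P] @ tl (map pr Q))"
    using assms lpath_is_path
    by (intro equiv_append_left) (auto simp: equiv_lpath_def hd_map simp del: list.map(2), auto simp: hd_map)
  then show ?thesis using assms by (cases P; cases Q) (auto simp: equiv_lpath_def)
qed

text \<open>A diamond over two steps out of \<open>X\<close>, with its tip held below
  \<open>Y\<close>. The bound serves the induction: from the tip the common end of the compared
  paths must still be within reach of \<open>lpath_exists\<close>.\<close>

definition joinable :: "int \<times> int \<Rightarrow> int \<times> int \<Rightarrow> int \<times> int \<Rightarrow> int \<times> int \<Rightarrow> bool" where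
  "joinable X X1 X2 Y \<longleftrightarrow> (\<exists>R1 R2. lpath (X # X1 # R1) \<and> lpath (X # X2 # R2) \<and>
     last (X1 # R1) = last (X2 # R2) \<and> le (last (X1 # R1)) Y \<and> equiv_lpath (X # X1 # R1) (X # X2 # R2))"

lemma joinable_sym: "joinable X X1 X2 Y \<Longrightarrow> joinable X X2 X1 Y"
  unfolding joinable_def equiv_lpath_def using equiv_sym by metis

lemma map_twist_surj: obtains Q where "P = map twist Q"
  using that[of "map (\<lambda>X. (snd X - int n, fst X)) P"] by (simp add: twist_def comp_def)

lemma lpath_map_twist: "lpath (map twist P) \<longleftrightarrow> lpath P"
  by (induction P) (auto simp: lpath_Cons hd_map)

text \<open>Steps and order are invariant under a twist of all lifts, and the projected paths do not
  change at all.\<close>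

lemma joinable_twist:
  assumes "joinable (twist X) (twist X1) (twist X2) (twist Y)"
  shows "joinable X X1 X2 Y"
proof -
  from assms obtain R1 R2 where R: "lpath (twist X # twist X1 # R1)" "lpath (twist X # twist X2 # R2)"
    "last (twist X1 # R1) = last (twist X2 # R2)" "le (last (twist X1 # R1)) (twist Y)"
    "equiv_lpath (twist X # twist X1 # R1) (twist X # twist X2 # R2)"
    unfolding joinable_def by blast
  obtain Q1 Q2 where Q: "R1 = map twist Q1" "R2 = map twist Q2" by (metis map_twist_surj)
  have last_eq: "last (twist Z # map twist Q) = twist (last (Z # Q))" for Z Q
    using last_map[of "Z # Q" twist] by simp
  have pr: "map pr (map twist P) = map pr P" for P by simp
  have "lpath (X # X1 # Q1)" "lpath (X # X2 # Q2)"
    using R(1,2) lpath_map_twist[of "X # X1 # Q1"] lpath_map_twist[of "X # X2 # Q2"] by (simp_all add: Q)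
  moreover have "last (X1 # Q1) = last (X2 # Q2)" "le (last (X1 # Q1)) Y"
    using R(3,4) unfolding Q last_eq by simp_all
  moreover have "equiv_lpath (X # X1 # Q1) (X # X2 # Q2)"
    using R(5) by (simp add: equiv_lpath_def Q comp_def)
  ultimately show ?thesis unfolding joinable_def by blast
qed

text \<open>Raising the first coordinate must lead to the apex of the triangle below. The other
  possible step goes to the apex of the triangle above or, when \<open>{v, b}\<close> is the side
  before \<open>v\<close>, is external. A second apex on the same side of the edge would create a
  crossing.\<close>

lemma step_long_unique:
  assumes vab: "v < a" "a < b" "b < v + int n" "E v a" "E v b" "E a b"
    and "step (v, b) Y" "step (v, b) Y'" "Y \<noteq> (a, b)" "Y' \<noteq> (a, b)"
  shows "Y = Y'"
proof -
  have cases: "(\<exists>d. Z = (v, d) \<and> b < d \<and> d < v + int n \<and> E b d \<and> E v d) \<or> b = v + int n - 1 \<and> Z = (v + 1, v + int n)"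
    if Z: "step (v, b) Z" "Z \<noteq> (a, b)" for Z
  proof -
    obtain c d where [simp]: "Z = (c, d)" by (cases Z)
    have False if c: "d = b" "v < c" "E v c"
    proof -
      have "E c b" "c < b" using Z c by (auto simp: step_def valid_def)
      moreover have "c \<noteq> a" using Z c by auto
      ultimately show False using non_crossing[of v c a b] non_crossing[of v a c b] vab c
        by (cases "c < a") auto
    qed
    then show ?thesis using Z vab by (auto simp: step_def valid_def)
  qed
  from cases[OF assms(7,9)] cases[OF assms(8,10)] show ?thesis
  proof (elim disjE exE conjE)
    fix d d' assume *: "Y = (v, d)" "Y' = (v, d')" "b < d" "b < d'" "d < v + int n" "d' < v + int n"
      "E b d" "E b d'" "E v d" "E v d'"
    have "d = d'"
    proof (rule ccontr)
      assume "d \<noteq> d'"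
      then show False
        using non_crossing[of v b d d'] non_crossing[of v b d' d] * vab by (cases "d < d'") auto
    qed
    then show ?thesis using * by simp
  qed auto
qed

text \<open>The relation of the arrow \<open>{v,a} \<rightarrow> {v,b}\<close>: both of its sides start at \<open>{v,b}\<close>
  and leave it through the two different arrows.\<close>

lemma joinable_relation:
  assumes vab: "v < a" "a < b" "b < v + int n" "E v a" "E v b" "E a b"
    and X2: "step (v, b) X2" "X2 \<noteq> (a, b)" and Y: "le (a, v + int n) Y"
  shows "joinable (v, b) (a, b) X2 Y"
proof -
  \<comment> \<open>The second arrow makes the relation available: were \<open>{v, a}\<close> and
    \<open>{v, b}\<close> both sides, \<open>X2\<close> would force a diagonal at \<open>v\<close>,
    and this diagonal would cross \<open>{a, b}\<close>.\<close>
  have nf: "\<not> (a = v + 1 \<and> b = v + int n - 1)"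
  proof
    assume *: "a = v + 1 \<and> b = v + int n - 1"
    have "has_diag v"
    proof (cases "snd X2 = b")
      case True
      then have "v < fst X2" "fst X2 < b" "E v (fst X2)" "fst X2 \<noteq> a"
        using X2 by (auto simp: step_def valid_def prod_eq_iff)
      then show ?thesis using * unfolding has_diag_def by (intro exI[of _ "fst X2"]) auto
    next
      case False
      then show ?thesis using X2 vab * by (auto simp: step_def valid_def)
    qed
    then obtain w where w: "v + 2 \<le> w" "w \<le> v + int n - 2" "E v w" by (auto simp: has_diag_def)
    then show False using non_crossing[of v a w b] vab * by auto
  qed
  obtain Q where Q: "lpath Q" "hd Q = (v, b)" "last Q = (a, v + int n)" "1 < length Q" "Q ! 1 \<noteq> (a, b)"
    and dW: "dW n \<sigma> (pr (v, a), pr (v, b)) =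
      (path_elem (map pr [(v, b), (a, b), (a, v + int n)]) :: 'k pathalg) - path_elem (map pr Q)"
    using dW_internal[OF vab nf] by metis
  then obtain Z R where QZ: "Q = (v, b) # Z # R" by (cases Q; cases "tl Q") auto
  have "step (v, b) Z" "Z \<noteq> (a, b)" using Q QZ by (auto simp: lpath_Cons)
  \<comment> \<open>The big-cycle side of the relation leaves through an arrow other than the one to
    \<open>(a, b)\<close>, and \<open>X2\<close> is the only such arrow.\<close>
  then have "Z = X2" using step_long_unique[OF vab] X2 by blast
  have "pr (v, a) \<notin> frozen n \<or> pr (v, b) \<notin> frozen n" using nf vab by (auto simp: pr_frozen)
  moreover have "(pr (v, a), pr (v, b)) \<in> arrows n \<sigma>" using internal_arrow_lift[OF vab] by (simp add: arrows_def)
  ultimately have "(dW n \<sigma> (pr (v, a), pr (v, b)) :: 'k pathalg) \<in> relators" unfolding relators_def by fastforce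
  then have "equiv_lpath [(v, b), (a, b), (a, v + int n)] Q"
    using relators_in_J dW unfolding equiv_lpath_def equiv_path_def by auto
  moreover have "lpath [(v, b), (a, b), (a, v + int n)]"
    using vab by (simp add: lpath_Cons step_def valid_def E_commute)
  ultimately show ?thesis
    unfolding joinable_def using Q Y QZ \<open>Z = X2\<close>
    by (intro exI[of _ "[(a, v + int n)]"] exI[of _ R]) auto
qed

text \<open>One of the two steps goes to \<open>(a, b)\<close>. With \<open>e\<close> the apex
  above, two relations can start here: that of \<open>{v, a}\<close> to \<open>{v, b}\<close>,
  ending at \<open>(a, v + n)\<close>, and that of \<open>{b, e}\<close> to \<open>{b, v}\<close>,
  ending at \<open>(b, e)\<close>. The first fits below \<open>Y\<close> when \<open>snd Y\<close>
  is at least \<open>v + n\<close>; otherwise the other step is to \<open>(v, e)\<close> and the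
  second relation fits.\<close>

lemma joinable_long:
  assumes X: "v + 2 \<le> b" and st: "step (v, b) X1" "step (v, b) X2" "X1 \<noteq> X2"
    and Y: "valid Y" "le X1 Y" "le X2 Y"
  shows "joinable (v, b) X1 X2 Y"
proof -
  have vb: "E v b" "b < v + int n" using st by (auto simp: step_def valid_def)
  obtain a where a: "v < a" "a < b" "E v a" "E a b" using triangle_below[OF X vb(2,1)] by blast
  have main: "joinable (v, b) (a, b) X2 Y"
    if X2: "step (v, b) X2" "X2 \<noteq> (a, b)" and le: "le (a, b) Y" "le X2 Y" for X2
  proof (cases "v + int n \<le> snd Y")
    case True
    then show ?thesis using joinable_relation[OF a(1,2) vb(2) a(3) vb(1) a(4) X2] le by (auto simp: le_def)
  next
    case False
    have "fst X2 = v \<and> b < snd X2 \<and> snd X2 < v + int n \<and> E v (snd X2) \<and> E b (snd X2)"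
    proof -
      have "snd X2 \<noteq> v + int n" using False le by (auto simp: le_def)
      moreover have "snd X2 \<noteq> b"
      proof
        assume s: "snd X2 = b"
        then have "valid X2" "v < fst X2" "E v (fst X2)" using X2(1) by (auto simp: step_def valid_def)
        moreover have "fst X2 \<noteq> a" using s X2(2) by (auto simp: prod_eq_iff)
        ultimately show False
          using non_crossing[of v "fst X2" a b] non_crossing[of v a "fst X2" b] a vb s
          by (cases "fst X2 < a") (auto simp: valid_def)
      qed
      ultimately show ?thesis using X2(1) X by (auto simp: step_def valid_def)
    qed
    then obtain e where e: "X2 = (v, e)" "b < e" "e < v + int n" "E v e" "E b e" by (cases X2) auto
    \<comment> \<open>Otherwise \<open>v < fst Y < b < snd Y < v + n\<close>, and the edge of
      \<open>Y\<close> would cross \<open>{v, b}\<close>.\<close>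
    have "b \<le> fst Y"
      using non_crossing[of v "fst Y" b "snd Y"] False le e a vb Y(1) by (force simp: le_def valid_def)
    then have "le (e, b + int n) (twist Y)" using le e by (simp add: le_def twist_def)
    moreover have "step (b, v + int n) (twist (a, b))"
      using a vb st(1) step_twist[of "(v, b)" "(a, b)"] X by (auto simp: twist_def step_def valid_def E_commute)
    moreover have "twist (a, b) \<noteq> (e, v + int n)" using a e by (auto simp: twist_def)
    \<comment> \<open>The relation of the arrow from \<open>{b, e}\<close> to \<open>{b, v}\<close>,
      in twisted coordinates with \<open>b\<close> as the centre.\<close>
    ultimately have "joinable (b, v + int n) (e, v + int n) (twist (a, b)) (twist Y)"
      using joinable_relation[of b e "v + int n" "twist (a, b)" "twist Y"] e vb a
      by (simp add: E_commute)
    then have "joinable (twist (v, b)) (twist X2) (twist (a, b)) (twist Y)" by (simp add: twist_def e)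
    then show ?thesis using joinable_twist joinable_sym by blast
  qed
  show ?thesis
  proof (cases "X1 = (a, b)")
    case True
    then show ?thesis using main[of X2] st Y by auto
  next
    case False
    then have "X2 = (a, b)" using step_long_unique[OF a(1,2) vb(2) a(3) vb(1) a(4) st(1,2)] st(3) by blast
    then show ?thesis using main[of X1] st Y joinable_sym by blast
  qed
qed

lemma joinable:
  assumes st: "step X X1" "step X X2" "X1 \<noteq> X2" and Y: "valid Y" "le X1 Y" "le X2 Y"
  shows "joinable X X1 X2 Y"
proof (cases "fst X + 2 \<le> snd X")
  case True
  then show ?thesis using joinable_long[of "fst X" "snd X" X1 X2 Y] assms by simp
next
  case False
  then have "snd X = fst X + 1" using st(1) by (auto simp: step_def valid_def)
  then have "twist X = (fst X + 1, fst X + int n)" by (simp add: twist_def)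
  then have "joinable (twist X) (twist X1) (twist X2) (twist Y)"
    using joinable_long[of "fst X + 1" "fst X + int n" "twist X1" "twist X2" "twist Y"] assms n_ge_3
      step_twist[of X X1] step_twist[of X X2] by simp
  then show ?thesis by (rule joinable_twist)
qed

text \<open>Induction on the gap in level, as in the proof that local confluence implies confluence.
  If the first steps differ, the diamond from \<open>joinable\<close> is prolonged to
  \<open>Y\<close>. One prolongation shares its first step with \<open>P\<close>, the other with
  \<open>Q\<close>, and the tails after these steps have a smaller gap. Nothing is cancelled in the
  quotient.\<close>

lemma equiv_lpath_same_ends:
  assumes "lpath P" "lpath Q" "hd P = hd Q" "last P = last Q"
  shows "equiv_lpath P Q"
  using assms
proof (induction "nat (level (last P) - level (hd P))" arbitrary: P Q rule: less_induct)
  case less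
  obtain X P' Q' where PQ: "P = X # P'" "Q = X # Q'"
    using less.prems by (cases P; cases Q) auto
  define Y where "Y = last P"
  show ?case
  proof (cases "P' = [] \<or> Q' = []")
    case True
    then have "level (hd P) = level (last P)" using less.prems PQ by auto
    then have "P = [hd P]" "Q = [hd Q]"
      using lpath_level[OF less.prems(1)] lpath_level[OF less.prems(2)] less.prems(3,4) by argo+
    then have "P = Q" using less.prems(3) by metis
    then show ?thesis by (simp add: equiv_lpath_def)
  next
    case False
    have tail: "equiv_lpath (X # A) (X # B)"
      if "lpath (X # A)" "lpath (X # B)" "A \<noteq> []" "B \<noteq> []" "hd A = hd B" "last A = Y" "last B = Y" for A B
    proof -
      have A: "lpath A" "lpath B" "step X (hd A)" using that by (auto simp: lpath_Cons)
      have "level X < level (hd A)" "level (hd A) \<le> level (last A)"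
        using step_level[OF A(3)] lpath_le[OF A(1)] by (auto simp: le_def level_def)
      then have "nat (level (last A) - level (hd A)) < nat (level (last P) - level (hd P))"
        using that by (simp add: Y_def PQ)
      then have "equiv_lpath A B" using less.hyps A that by simp
      then show ?thesis using equiv_lpath_Cons that by blast
    qed
    have lastY: "last P' = Y" "last Q' = Y" using False PQ less.prems by (auto simp: Y_def)
    show ?thesis
    proof (cases "hd P' = hd Q'")
      case True
      then show ?thesis using tail[of P' Q'] False PQ less.prems lastY by simp
    next
      case neq: False
      have P': "lpath P'" "lpath Q'" "step X (hd P')" "step X (hd Q')"
        using less.prems False PQ by (auto simp: lpath_Cons)
      have "valid Y" "le (hd P') Y" "le (hd Q') Y"
        using lpath_le[OF P'(1)] lpath_le[OF P'(2)] lpath_valid_last[OF P'(1)] lastY by auto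
      then obtain R1 R2 where R: "lpath (X # hd P' # R1)" "lpath (X # hd Q' # R2)"
        "last (hd P' # R1) = last (hd Q' # R2)" "le (last (hd P' # R1)) Y"
        "equiv_lpath (X # hd P' # R1) (X # hd Q' # R2)"
        using joinable[OF P'(3,4) neq] unfolding joinable_def by blast
      obtain S where S: "lpath S" "hd S = last (hd P' # R1)" "last S = Y"
        using lpath_exists[of "last (hd P' # R1)" Y] lpath_valid_last[OF R(1)] \<open>valid Y\<close> R(4) by auto
      have l1: "lpath (X # (hd P' # R1) @ tl S)" and l2: "lpath (X # (hd Q' # R2) @ tl S)"
        using lpath_append_tl[OF R(1) S(1)] lpath_append_tl[OF R(2) S(1)] S R(3) by auto
      have "S \<noteq> []" using S(1) by auto
      then have lS: "last ((hd P' # R1) @ tl S) = Y" "last ((hd Q' # R2) @ tl S) = Y"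
        using last_append_tl[of S "hd P' # R1"] last_append_tl[of S "hd Q' # R2"] S(2,3) R(3) by simp_all
      have 1: "equiv_lpath P (X # (hd P' # R1) @ tl S)"
        unfolding PQ(1)
      proof (rule tail)
        show "lpath (X # P')" using less.prems(1) PQ(1) by simp
        show "P' \<noteq> []" using False by simp
      qed (use l1 lS(1) lastY(1) in simp_all)
      have 2: "equiv_lpath (X # (hd Q' # R2) @ tl S) Q"
        unfolding PQ(2)
      proof (rule tail)
        show "lpath (X # Q')" using less.prems(2) PQ(2) by simp
        show "Q' \<noteq> []" using False by simp
      qed (use l2 lS(2) lastY(2) in simp_all)
      have "equiv_lpath ((X # hd P' # R1) @ tl S) ((X # hd Q' # R2) @ tl S)"
        by (rule equiv_lpath_append[OF R(5,1,2) S(1)]) (use S(2) R(3) in simp_all)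
      then have "equiv_lpath (X # (hd P' # R1) @ tl S) (X # (hd Q' # R2) @ tl S)" by simp
      with 1 2 show ?thesis unfolding equiv_lpath_def by (blast intro: equiv_trans)
    qed
  qed
qed

text \<open>Lifts with a common start end over the same edge, and the degree fixes the level of the
  end, hence the end itself.\<close>

lemma equiv_path_iff:
  assumes "is_path n \<sigma> p" "is_path n \<sigma> q" "hd p = hd q" "last p = last q" "path_deg p = path_deg q"
  shows "equiv_path p q"
proof -
  have "hd p \<in> edges n \<sigma>" using assms(1) hd_in_set unfolding is_path_def by blast
  then obtain X where X: "valid X" "pr X = hd p" by (rule edge_lift)
  obtain P where P: "lpath P" "hd P = X" "map pr P = p" using path_lift[OF assms(1) X] by blast
  obtain Q where Q: "lpath Q" "hd Q = X" "map pr Q = q" using path_lift[OF assms(2) X(1)] X(2) assms(3) by auto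
  have ne: "P \<noteq> []" "Q \<noteq> []" using P Q by auto
  have "level (last P) = level (last Q)"
    using path_deg_map_pr[OF P(1)] path_deg_map_pr[OF Q(1)] assms(5) P Q by simp
  moreover have "pr (last P) = pr (last Q)"
    using assms(4) last_map[OF ne(1), of pr] last_map[OF ne(2), of pr] P Q by simp
  ultimately have "last P = last Q"
    using pr_level_eq lpath_valid_last P(1) Q(1) by blast
  then show ?thesis using equiv_lpath_same_ends[OF P(1) Q(1)] P Q by (simp add: equiv_lpath_def)
qed

text \<open>Replacing each path by a chosen representative of its class changes \<open>f\<close> by
  an element of \<open>J\<close>, and afterwards the representatives cancel because all class sums
  vanish.\<close>

lemma class_kernel_subset_J: "(class_kernel :: 'k pathalg set) \<subseteq> J"
proof
  fix f :: "'k pathalg" assume f: "f \<in> class_kernel"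
  then have fc: "f \<in> carrier PA" by (simp add: class_kernel_def)
  let ?S = "{p. f p \<noteq> 0}"
  have fin: "finite ?S" using PA_finite[OF fc] .
  define rep where "rep p = (SOME q. is_path n \<sigma> q \<and> hd q = hd p \<and> last q = last p \<and> path_deg q = path_deg p)"
    for p
  have rep: "is_path n \<sigma> (rep p) \<and> hd (rep p) = hd p \<and> last (rep p) = last p \<and> path_deg (rep p) = path_deg p"
    if "p \<in> ?S" for p
    unfolding rep_def by (rule someI[of _ p]) (use that supp_path[OF fc] in blast)
  have rep_cong: "rep p = rep q" if "hd p = hd q" "last p = last q" "path_deg p = path_deg q" for p q
    unfolding rep_def that ..
  have zero: "(\<Sum>p\<in>?S. if rep p = r then f p else 0) = 0" for r
  proof (cases "r \<in> rep ` ?S")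
    case True
    then obtain q where q: "q \<in> ?S" "r = rep q" by blast
    have "rep p = r \<longleftrightarrow> hd p = hd r \<and> last p = last r \<and> path_deg p = path_deg r" if "p \<in> ?S" for p
      using rep[OF that] rep[OF q(1)] rep_cong[of p q] q(2) by metis
    then have "(\<Sum>p\<in>?S. if rep p = r then f p else 0) = class_sum (hd r) (last r) (path_deg r) f"
      unfolding class_sum_def weighted_sum_def by (intro sum.cong refl) simp
    then show ?thesis using f by (simp add: class_kernel_def)
  next
    case False
    then show ?thesis by (intro sum.neutral) auto
  qed
  have "f = (\<Sum>p\<in>?S. scal (f p) (path_elem p - path_elem (rep p)))"
  proof
    fix r
    have "(\<Sum>p\<in>?S. scal (f p) (path_elem p - path_elem (rep p))) r
       = (\<Sum>p\<in>?S. (if p = r then f p else 0) - (if rep p = r then f p else 0))"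
      unfolding sum_fun_apply by (intro sum.cong refl) (simp add: scal_def path_elem_def)
    also have "\<dots> = (\<Sum>p\<in>?S. if p = r then f p else 0)"
      unfolding sum_subtractf zero by simp
    also have "\<dots> = f r" using fin by (simp add: sum.delta)
    finally show "f r = (\<Sum>p\<in>?S. scal (f p) (path_elem p - path_elem (rep p))) r" ..
  qed
  moreover have "(\<Sum>p\<in>?S. scal (f p) (path_elem p - path_elem (rep p))) \<in> J"
  proof (rule J_sum)
    fix p assume p: "p \<in> ?S"
    have "equiv_path p (rep p)"
      by (rule equiv_path_iff) (use p rep[OF p] supp_path[OF fc] in auto)
    then show "scal (f p) (path_elem p - path_elem (rep p)) \<in> J" unfolding equiv_path_def by (rule J_scal)
  qed
  ultimately show "f \<in> J" by simp
qed

lemma J_eq_class_kernel: "(J :: 'k pathalg set) = class_kernel"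
  using class_kernel_subset_J J_subset_kernel by blast

end

section \<open>Paths between sides and minimal cycles\<close>

context triangulated_polygon
begin

lemma side_eq_pr: "i < n \<Longrightarrow> side n i = pr (int i, int i + 1)"
  using pr_offset[of "int i" 1] by (simp add: side_def)

lemma valid_side: "valid (v, v + 1)"
  using E_side n_ge_3 by (simp add: valid_def)

lemma side_inj: "i < n \<Longrightarrow> j < n \<Longrightarrow> side n i = side n j \<Longrightarrow> i = j"
proof -
  assume ij: "i < n" "j < n" and eq: "side n i = side n j"
  have "pr (int i, int i + 1) = pr (int j, int j + 1)" using eq ij by (simp add: side_eq_pr)
  with valid_side valid_side show "i = j"
  proof (cases rule: pr_eq_cases)
    case (1 k)
    then have "int j = int i + k * int n" by (simp add: shift_def)
    then have "int i mod int n = int j mod int n" by simp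
    then show "i = j" using ij by simp
  next
    case (2 k)
    then show "i = j" using n_ge_3 by (simp add: shift_def twist_def)
  qed
qed

lemma frozen_eq: "frozen n = side n ` {..<n}"
  by (auto simp: frozen_def is_side_def)

lemma frozen_subset: "frozen n \<subseteq> edges n \<sigma>"
  by (auto simp: frozen_def edges_def)

text \<open>The lift of a path from side \<open>i\<close> to side \<open>j\<close> which starts at \<open>(i, i+1)\<close> ends at the
  \<open>l\<close>-th twist of \<open>(j, j+1)\<close>, and the order on lifts bounds \<open>l\<close> from below.\<close>

lemma side_path_deg:
  assumes p: "is_path n \<sigma> p" "hd p = side n i" "last p = side n j" "i < n" "j < n"
  obtains l where "path_deg p = int n * l + 2 * int j - 2 * int i" "tile_exp n i j \<le> l"
proof -
  obtain P where P: "lpath P" "hd P = (int i, int i + 1)" "map pr P = p"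
    using path_lift[OF p(1) valid_side, of "int i"] p(2,4) side_eq_pr by auto
  have ne: "P \<noteq> []" using P(1) by auto
  have pl: "pr (int j, int j + 1) = pr (last P)"
    using p(3,5) last_map[OF ne, of pr] P(3) side_eq_pr by simp
  have deg: "path_deg p = level (last P) - (2 * int i + 1)"
    using path_deg_map_pr[OF P(1)] P(2,3) by (simp add: level_def)
  have le: "le (int i, int i + 1) (last P)" using lpath_le[OF P(1)] P(2) by simp
  from valid_side lpath_valid_last[OF P(1)] pl show thesis
  proof (cases rule: pr_eq_cases)
    \<comment> \<open>Translates account for the even numbers of twists, \<open>l = 2 * k\<close>;
      the twisted translates of the other case give \<open>l = 2 * k + 1\<close>.\<close>
    case (1 k)
    have "int i \<le> int j + k * int n" using le 1 by (simp add: le_def shift_def)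
    have "0 \<le> k"
    proof (rule ccontr)
      assume "\<not> 0 \<le> k"
      then have "k * int n \<le> (-1) * int n" by (intro mult_right_mono) auto
      then show False using \<open>int i \<le> int j + k * int n\<close> p(5) by linarith
    qed
    moreover have "1 \<le> k" if "j < i"
    proof (rule ccontr)
      assume "\<not> 1 \<le> k"
      then have "k = 0" using \<open>0 \<le> k\<close> by simp
      then show False using \<open>int i \<le> int j + k * int n\<close> that by simp
    qed
    ultimately have "tile_exp n i j \<le> 2 * k" by (auto simp: tile_exp_def)
    moreover have "path_deg p = int n * (2 * k) + 2 * int j - 2 * int i"
      using deg 1 by (simp add: level_def shift_def algebra_simps)
    ultimately show thesis using that by blast
  next
    case (2 k)
    have i: "int i \<le> int j + 1 + k * int n" using le 2 by (simp add: le_def shift_def twist_def)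
    have "-1 \<le> k"
    proof (rule ccontr)
      assume "\<not> -1 \<le> k"
      then have "k * int n \<le> (-2) * int n" by (intro mult_right_mono) auto
      then show False using i p(5) by linarith
    qed
    \<comment> \<open>The only negative number of twists: the end is then the lift
      \<open>(0, n - 1)\<close> of the last side, above \<open>(0, 1)\<close>. This produces the
      corner exponent -1.\<close>
    moreover have "i = 0 \<and> j = n - 1" if "k = -1" using i p(5) that by auto
    moreover have "i \<le> j + 1" if "k = 0" using i that by simp
    ultimately have "tile_exp n i j \<le> 2 * k + 1"
      using p(5) by (cases "k = -1"; cases "k = 0") (auto simp: tile_exp_def)
    moreover have "path_deg p = int n * (2 * k + 1) + 2 * int j - 2 * int i"
      using deg 2 by (simp add: level_def shift_def twist_def algebra_simps)
    ultimately show thesis using that by blast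
  qed
qed

text \<open>The bounds in \<open>tile_exp\<close> are what puts the \<open>l\<close>-th twist of
  \<open>(j, j + 1)\<close> above \<open>(i, i + 1)\<close> in both coordinates;
  \<open>lpath_exists\<close> then joins the two lifts. Even and odd \<open>l\<close> are the
  translates and the twisted translates.\<close>

lemma side_path_exists:
  assumes "i < n" "j < n" "tile_exp n i j \<le> l"
  obtains p where "is_path n \<sigma> p" "hd p = side n i" "last p = side n j"
    "path_deg p = int n * l + 2 * int j - 2 * int i"
proof -
  have "\<exists>Y. valid Y \<and> pr Y = side n j \<and> le (int i, int i + 1) Y \<and>
    level Y = int n * l + 2 * int j + 1"
  proof (cases "even l")
    case True
    then obtain k where k: "l = 2 * k" by (rule evenE)
    have "0 \<le> k" "j < i \<Longrightarrow> 1 \<le> k" using assms(3) k by (auto simp: tile_exp_def split: if_splits)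
    then have "0 \<le> k * int n" "j < i \<Longrightarrow> int n \<le> k * int n"
      using mult_right_mono[of 1 k "int n"] by auto
    then have "int i \<le> int j + k * int n" using assms(1) by linarith
    then have "le (int i, int i + 1) (shift k (int j, int j + 1))" by (simp add: le_def shift_def)
    moreover have "level (shift k (int j, int j + 1)) = int n * l + 2 * int j + 1"
      by (simp add: level_def shift_def k algebra_simps)
    ultimately show ?thesis using assms(2) side_eq_pr valid_side
      by (intro exI[of _ "shift k (int j, int j + 1)"]) simp
  next
    case False
    then obtain k where k: "l = 2 * k + 1" by (rule oddE)
    have k': "i = 0 \<and> j = n - 1 \<and> k = -1 \<or> 0 \<le> k \<and> i \<le> j + 1 \<or> 1 \<le> k"
      using assms(3) k by (auto simp: tile_exp_def split: if_splits)
    have "int i \<le> int j + 1 + k * int n \<and> int i \<le> int j + int n - 1 + k * int n"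
      using k'
    proof (elim disjE)
      assume *: "0 \<le> k \<and> i \<le> j + 1"
      then have "0 \<le> k * int n" by simp
      then show ?thesis using n_ge_3 * by linarith
    next
      assume "1 \<le> k"
      then have "int n \<le> k * int n" using mult_right_mono[of 1 k "int n"] by simp
      then show ?thesis using assms(1) n_ge_3 by linarith
    qed (use n_ge_3 in auto)
    then have "le (int i, int i + 1) (shift k (twist (int j, int j + 1)))"
      by (simp add: le_def shift_def twist_def)
    moreover have "level (shift k (twist (int j, int j + 1))) = int n * l + 2 * int j + 1"
      by (simp add: level_def shift_def twist_def k algebra_simps)
    ultimately show ?thesis using assms(2) side_eq_pr valid_side
      by (intro exI[of _ "shift k (twist (int j, int j + 1))"]) simp
  qed
  then obtain Y where Y: "valid Y" "pr Y = side n j" "le (int i, int i + 1) Y"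
    "level Y = int n * l + 2 * int j + 1" by blast
  obtain P where P: "lpath P" "hd P = (int i, int i + 1)" "last P = Y"
    using lpath_exists[OF valid_side Y(1,3)] by blast
  then have "P \<noteq> []" by auto
  then show thesis
    using that[of "map pr P"] P lpath_is_path[OF P(1)] path_deg_map_pr[OF P(1)] Y assms side_eq_pr
    by (simp add: hd_map last_map level_def)
qed

text \<open>One turn around the triangle takes the lift \<open>(p, q)\<close> to
  \<open>(q, p + n)\<close>, so the three arc lengths add up to n.\<close>

lemma triangle_cycle_lift:
  assumes "T \<in> triangles n \<sigma>"
  obtains P where "lpath P" "last P = twist (hd P)" "map pr P = tri_cycle T"
proof -
  obtain p q r where T: "T = {p, q, r}" "p < q" "q < r" "r < n"
    "{p, q} \<in> edges n \<sigma>" "{q, r} \<in> edges n \<sigma>" "{p, r} \<in> edges n \<sigma>" by (rule triangle_cases[OF assms])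
  have E: "E (int p) (int q)" "E (int q) (int r)" "E (int p) (int r)"
    using T by (simp_all add: E_def pr_def)
  have s: "step (int p, int q) (int p, int r)" using step_fan[of "int p" "int q" "int r"] E T by simp
  have "step (int p, int r) (int q, int r)" using E T by (simp add: step_def valid_def)
  moreover have "step (int q, int r) (int q, int p + int n)" using E T by (simp add: step_def valid_def E_commute)
  ultimately have "lpath [(int p, int q), (int p, int r), (int q, int r), (int q, int p + int n)]"
    using s step_valid by (simp add: lpath_Cons)
  moreover have "map pr [(int p, int q), (int p, int r), (int q, int r), (int q, int p + int n)] = tri_cycle T"
    using T by (simp add: tri_cycle_sorted pr_def insert_commute)
  ultimately show thesis using that by (simp add: twist_def)
qed

lemma big_cycle_lift:
  assumes "w \<in> big_vertices n \<sigma>"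
  obtains P where "lpath P" "last P = twist (hd P)" "map pr P = big_cycle n \<sigma> w"
proof -
  define v where "v = int w"
  have w: "w < n" "nat (v mod int n) = w" using assms by (auto simp: big_vertices_def v_def)
  then have hd: "has_diag v" using assms has_diag_iff by (simp add: big_vertices_def)
  define A where "A = map (\<lambda>m. (v, v + int m)) (fan v)"
  have ne: "fan v \<noteq> []" using hd_fan[of v] by auto
  have "successively (\<lambda>k l. step (v, v + int k) (v, v + int l)) (fan v)"
    by (rule successively_if_splits) (rule fan_adjacent)
  then have "successively step A" unfolding A_def successively_map .
  moreover have lA: "last A = (v, v + int n - 1)"
    using last_fan[of v] n_ge_3 ne unfolding A_def by (subst last_map) (simp_all add: of_nat_diff)
  moreover have "step (v, v + int n - 1) (v + 1, v + int n)"
    using step_ext[OF hd] by (simp flip: step_twist[of "(v - 1, v)"] add: twist_def algebra_simps)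
  ultimately have "successively step (A @ [(v + 1, v + int n)])"
    by (simp add: successively_append_iff)
  moreover have hA: "hd A = (v, v + 1)" unfolding A_def by (subst hd_fan) simp
  moreover have "A \<noteq> []" using ne by (simp add: A_def)
  ultimately have "lpath (A @ [(v + 1, v + int n)])" using valid_side by (simp add: lpath_def)
  moreover have "last (A @ [(v + 1, v + int n)]) = twist (hd (A @ [(v + 1, v + int n)]))"
    using hA \<open>A \<noteq> []\<close> by (simp add: twist_def)
  moreover have "map pr (A @ [(v + 1, v + int n)]) = big_cycle n \<sigma> w"
    using big_cycle_fan[of v] pr_twist[of "(v, v + 1)"] by (simp add: w A_def twist_def)
  ultimately show thesis using that by blast
qed

definition minimal_cycle :: "nat set list \<Rightarrow> bool" where
  "minimal_cycle c \<longleftrightarrow> c \<in> tri_cycle ` triangles n \<sigma> \<or> c \<in> big_cycle n \<sigma> ` big_vertices n \<sigma>"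

lemma minimal_cycle_props:
  assumes "minimal_cycle c"
  shows "is_path n \<sigma> c" "hd c = last c" "path_deg c = int n"
proof -
  obtain P where P: "lpath P" "last P = twist (hd P)" "map pr P = c"
    using assms triangle_cycle_lift big_cycle_lift unfolding minimal_cycle_def by blast
  then have "P \<noteq> []" by auto
  then show "is_path n \<sigma> c" "hd c = last c" "path_deg c = int n"
    using lpath_is_path[OF P(1)] path_deg_map_pr[OF P(1)] P(2)
    by (simp_all add: P(3)[symmetric] hd_map last_map level_twist)
qed

lemma is_path_appendD: "is_path n \<sigma> (u @ w) \<Longrightarrow> u \<noteq> [] \<Longrightarrow> is_path n \<sigma> u"
  "is_path n \<sigma> (u @ w) \<Longrightarrow> w \<noteq> [] \<Longrightarrow> is_path n \<sigma> w"
  by (auto simp: is_path_iff_successively successively_append_iff)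

text \<open>Cutting at \<open>j\<close> gives two pieces that, the path being closed, can also be
  composed in the other order; the degree is additive and does not notice.\<close>

lemma rotate_cycle_props:
  assumes c: "is_path n \<sigma> c" "hd c = last c" and j: "j < length c - 1"
  shows "is_path n \<sigma> (rotate_cycle j c)" "hd (rotate_cycle j c) = c ! j" "last (rotate_cycle j c) = c ! j"
    "path_deg (rotate_cycle j c) = path_deg c"
proof -
  let ?A = "take (Suc j) c" and ?B = "drop j c"
  have ne: "?A \<noteq> []" "?B \<noteq> []" using j by auto
  have AB: "is_path n \<sigma> ?A" "is_path n \<sigma> ?B"
    using is_path_appendD(1)[of ?A "drop (Suc j) c"] is_path_appendD(2)[of "take j c" ?B] ne c(1) by simp_all
  have lA: "last ?A = c ! j" "hd ?B = c ! j" using j by (simp_all add: take_Suc_conv_app_nth hd_drop_conv_nth)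
  have lB: "last ?B = last c" "hd ?A = hd c" using j by (simp_all add: hd_take)
  have "c = ?A @ tl ?B" by (simp only: tl_drop drop_Suc[symmetric] append_take_drop_id)
  then have d: "path_deg c = path_deg ?A + path_deg ?B"
    using path_deg_append_tl[OF ne] lA by metis
  have m: "last ?B = hd ?A" using lB c(2) by simp
  show "is_path n \<sigma> (rotate_cycle j c)"
    unfolding rotate_cycle_def by (rule is_path_append_tl[OF AB(2,1) m])
  show "hd (rotate_cycle j c) = c ! j" "last (rotate_cycle j c) = c ! j"
    "path_deg (rotate_cycle j c) = path_deg c"
    unfolding rotate_cycle_def using path_ends[OF AB(2,1) m] lA d by simp_all
qed

lemma min_cycles_at_props:
  assumes "c \<in> min_cycles_at n \<sigma> e"
  shows "is_path n \<sigma> c" "hd c = e" "last c = e" "path_deg c = int n"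
proof -
  obtain d j where dj: "c = rotate_cycle j d" "minimal_cycle d" "j < length d - 1" "d ! j = e"
    using assms unfolding min_cycles_at_def minimal_cycle_def by blast
  then show "is_path n \<sigma> c" "hd c = e" "last c = e" "path_deg c = int n"
    using rotate_cycle_props[OF minimal_cycle_props(1,2)[OF dj(2)] dj(3)] minimal_cycle_props(3)[OF dj(2)]
    by simp_all
qed

text \<open>Every edge borders a triangle: of a lift and its twist one has gap at least 2, and
  \<open>triangle_below\<close> applies to it. This justifies the choice by \<open>SOME\<close> in
  \<open>C_elem\<close>.\<close>

lemma min_cycles_at_nonempty:
  assumes "e \<in> edges n \<sigma>" shows "min_cycles_at n \<sigma> e \<noteq> {}"
proof -
  obtain X where X: "valid X" "pr X = e" by (rule edge_lift[OF assms])
  obtain v b where vb: "v + 2 \<le> b" "valid (v, b)" "pr (v, b) = e"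
  proof (cases "fst X + 2 \<le> snd X")
    case True
    then show thesis using that[of "fst X" "snd X"] X by simp
  next
    case False
    then have "snd X = fst X + 1" using X(1) by (auto simp: valid_def)
    then show thesis using that[of "snd X" "fst X + int n"] valid_twist[of X] pr_twist[of X] X n_ge_3
      by (simp add: twist_def)
  qed
  then have "E v b" "b < v + int n" by (auto simp: valid_def)
  then obtain a where a: "v < a" "a < b" "E v a" "E a b" using triangle_below[OF vb(1)] by blast
  let ?T = "{nat (v mod int n), nat (a mod int n), nat (b mod int n)}"
  have T: "?T \<in> triangles n \<sigma>"
    by (rule triangle_in_triangles) (use a \<open>E v b\<close> \<open>b < v + int n\<close> in auto)
  then obtain p q r where pqr: "?T = {p, q, r}" "p < q" "q < r" by (rule triangle_cases)
  have tri: "tri_cycle ?T = [{p, q}, {p, r}, {q, r}, {p, q}]" unfolding pqr(1) using pqr by (intro tri_cycle_sorted)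
  have "nat (v mod int n) \<noteq> nat (b mod int n)"
    by (rule vertex_neq) (use a \<open>b < v + int n\<close> in auto)
  moreover have "nat (v mod int n) \<in> {p, q, r}" "nat (b mod int n) \<in> {p, q, r}" using pqr(1) by blast+
  ultimately have "e = {p, q} \<or> e = {p, r} \<or> e = {q, r}"
    unfolding vb(3)[symmetric] pr_def fst_conv snd_conv by (elim insertE emptyE) (simp_all add: insert_commute)
  then obtain j where j: "j < 3" "tri_cycle ?T ! j = e"
  proof (elim disjE)
    assume "e = {p, q}" then show thesis using that[of 0] tri by simp
  next
    assume "e = {p, r}" then show thesis using that[of 1] tri by simp
  next
    assume "e = {q, r}" then show thesis using that[of 2] tri by simp
  qed
  have "rotate_cycle j (tri_cycle ?T) \<in> min_cycles_at n \<sigma> e"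
    unfolding min_cycles_at_def mem_Collect_eq
    by (intro exI[of _ "tri_cycle ?T"] exI[of _ j]) (use j tri imageI[OF T, of tri_cycle] in auto)
  then show ?thesis by blast
qed

end

section \<open>The isomorphism with the tiled order\<close>

definition X_fract :: "'k::field poly fract" where "X_fract = Fract [:0, 1:] 1"

definition const_fract :: "'k::field \<Rightarrow> 'k poly fract" where "const_fract c = Fract [:c:] 1"

lemma Fract_one_add: "Fract (p + q) 1 = Fract p 1 + (Fract q 1 :: 'a::idom fract)"
  by simp

lemma Fract_one_mult: "Fract (p * q) 1 = Fract p 1 * (Fract q 1 :: 'a::idom fract)"
  by simp

lemma Fract_one_inj: "Fract p 1 = (Fract q 1 :: 'a::idom fract) \<longleftrightarrow> p = q"
  by (simp add: eq_fract)

lemma Fract_one_zero: "Fract 0 1 = (0 :: 'a::idom fract)"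
  by (simp add: Zero_fract_def)

lemma Fract_one_sum: "Fract (\<Sum>i\<in>S. f i) 1 = (\<Sum>i\<in>S. Fract (f i) 1 :: 'a::idom fract)"
  by (induction S rule: infinite_finite_induct) (simp_all only: sum.infinite sum.empty sum.insert Fract_one_zero Fract_one_add not_False_eq_True)

lemma X_fract_nonzero: "(X_fract :: 'k::field poly fract) \<noteq> 0"
  unfolding X_fract_def Fract_one_zero[symmetric] Fract_one_inj by simp

lemma const_fract_simps: "const_fract 0 = (0 :: 'k::field poly fract)" "const_fract 1 = (1 :: 'k poly fract)"
  "const_fract (a + b) = const_fract a + (const_fract b :: 'k poly fract)"
  "const_fract (a * b) = const_fract a * (const_fract b :: 'k poly fract)"
  by (simp_all add: const_fract_def Zero_fract_def One_fract_def mult.commute flip: one_pCons)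

lemma Fract_monom: "Fract (monom c m) 1 = const_fract c * (X_fract :: 'k::field poly fract) ^ m"
proof (induction m)
  case (Suc m)
  have "monom c (Suc m) = [:0, 1:] * monom c m" by (simp add: monom_Suc)
  then show ?case using Suc unfolding X_fract_def by (metis Fract_one_mult mult.left_commute power_Suc)
qed (simp add: const_fract_def monom_0)

lemma Fract_poly_sum: "Fract p 1 = (\<Sum>k\<le>degree p. const_fract (coeff p k) * (X_fract :: 'k::field poly fract) ^ k)"
proof -
  have "Fract p 1 = Fract (\<Sum>k\<le>degree p. monom (coeff p k) k) 1" by (simp only: poly_as_sum_of_monoms)
  then show ?thesis by (simp only: Fract_one_sum Fract_monom)
qed

lemma X_powi_add: "(X_fract :: 'k::field poly fract) powi (a + b) = X_fract powi a * X_fract powi b"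
  by (rule power_int_add) (simp add: X_fract_nonzero)

context triangulated_polygon
begin

text \<open>The number of twists at the end of the lifted path, solved from
  \<open>path_deg p = n * l + 2 * j - 2 * i\<close>: the lift \<open>(i, i + 1)\<close> has level
  \<open>2 * i + 1\<close> and each twist adds n. On paths between the two sides the division is
  exact.\<close>

definition side_level :: "nat \<Rightarrow> nat \<Rightarrow> nat set list \<Rightarrow> int" where
  "side_level i j p = (path_deg p + 2 * int i - 2 * int j) div int n"

lemma side_level_eq:
  assumes "is_path n \<sigma> p" "hd p = side n i" "last p = side n j" "i < n" "j < n"
  shows "path_deg p = int n * side_level i j p + 2 * int j - 2 * int i" "tile_exp n i j \<le> side_level i j p"
proof -
  obtain l where l: "path_deg p = int n * l + 2 * int j - 2 * int i" "tile_exp n i j \<le> l"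
    using side_path_deg[OF assms] .
  then have "side_level i j p = l" using n_ge_3 by (simp add: side_level_def)
  then show "path_deg p = int n * side_level i j p + 2 * int j - 2 * int i" "tile_exp n i j \<le> side_level i j p"
    using l by simp_all
qed

lemma side_level_append:
  assumes p: "is_path n \<sigma> p" "hd p = side n i" "last p = side n k"
    and q: "is_path n \<sigma> q" "hd q = side n k" "last q = side n j"
    and ijk: "i < n" "j < n" "k < n"
  shows "side_level i j (p @ tl q) = side_level i k p + side_level k j q"
proof -
  have "path_deg (p @ tl q) + 2 * int i - 2 * int j = int n * (side_level i k p + side_level k j q)"
    using path_ends[OF p(1) q(1)] p(3) q(2) side_level_eq(1)[OF p ijk(1,3)] side_level_eq(1)[OF q ijk(3,2)]
    by (simp add: algebra_simps)
  then show ?thesis using n_ge_3 unfolding side_level_def by simp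
qed

definition entry_weight :: "nat \<Rightarrow> nat \<Rightarrow> nat set list \<Rightarrow> 'k::field \<Rightarrow> 'k poly fract" where
  "entry_weight i j p c =
     (if hd p = side n i \<and> last p = side n j then const_fract c * X_fract powi side_level i j p else 0)"

definition entry :: "nat \<Rightarrow> nat \<Rightarrow> 'k::field pathalg \<Rightarrow> 'k poly fract" where
  "entry i j = weighted_sum (entry_weight i j)"

lemma additive_entry_weight: "additive_weight (entry_weight i j)"
  by (auto simp: additive_weight_def entry_weight_def const_fract_simps algebra_simps)

lemma entry_plus:
  "f \<in> carrier PA \<Longrightarrow> g \<in> carrier PA \<Longrightarrow> entry i j (f + g) = entry i j f + entry i j g"
  unfolding entry_def plus_fun_def by (intro weighted_sum_add additive_entry_weight PA_finite)

lemma entry_zero: "entry i j 0 = 0"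
  by (simp add: entry_def zero_fun_def)

lemma entry_minus:
  "f \<in> carrier PA \<Longrightarrow> g \<in> carrier PA \<Longrightarrow> entry i j (f - g) = entry i j f - entry i j g"
  using entry_plus[of "f - g" g i j] PA_minus[of f g] by (simp add: algebra_simps)

lemma entry_path_elem:
  "entry i j (path_elem p) = (if hd p = side n i \<and> last p = side n j then X_fract powi side_level i j p else 0)"
  unfolding entry_def weighted_sum_path_elem[OF additive_entry_weight] by (simp add: entry_weight_def const_fract_simps)

lemma entry_scal:
  assumes "f \<in> carrier PA"
  shows "entry i j (scal c f) = const_fract c * entry i j f"
proof -
  have "entry i j (scal c f) = (\<Sum>p | f p \<noteq> 0. entry_weight i j p (scal c f p))"
    unfolding entry_def
    by (rule weighted_sum_superset) (use PA_finite[OF assms] supp_scal in \<open>auto simp: entry_weight_def const_fract_simps scal_def\<close>)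
  also have "\<dots> = const_fract c * entry i j f"
    unfolding entry_def weighted_sum_def sum_distrib_left
    by (intro sum.cong refl) (simp add: entry_weight_def scal_def const_fract_simps mult.assoc)
  finally show ?thesis .
qed

lemma PA_sum: "(\<And>x. x \<in> S \<Longrightarrow> f x \<in> carrier PA) \<Longrightarrow> (\<Sum>x\<in>S. f x) \<in> carrier PA"
  by (induction S rule: infinite_finite_induct) (use zero_in_PA in \<open>auto simp: PA_plus zero_fun_def\<close>)

lemma entry_sum:
  "(\<And>x. x \<in> S \<Longrightarrow> f x \<in> carrier PA) \<Longrightarrow> entry i j (\<Sum>x\<in>S. f x) = (\<Sum>x\<in>S. entry i j (f x))"
  by (induction S rule: infinite_finite_induct) (auto simp: entry_zero entry_plus PA_sum)

text \<open>When the right factor starts at sides only, a composable pair meets at exactly one side,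
  which the sum over \<open>k\<close> picks out, and the numbers of twists add. The left factor is
  not confined to the corner, so that it can be the element C with its loops at diagonals.\<close>

lemma entry_pmult:
  assumes f: "f \<in> carrier PA" and g: "g \<in> carrier PA" and hd: "\<And>q. g q \<noteq> 0 \<Longrightarrow> hd q \<in> frozen n"
    and ij: "i < n" "j < n"
  shows "entry i j (pmult f g) = (\<Sum>k<n. entry i k f * entry k j g)"
proof -
  have "entry i j (pmult f g) = (\<Sum>p | f p \<noteq> 0. \<Sum>q | g q \<noteq> 0.
      if last p = hd q then entry_weight i j (p @ tl q) (f p * g q) else 0)"
    unfolding entry_def
    by (rule weighted_sum_pmult[OF PA_finite[OF f] PA_finite[OF g] additive_entry_weight])
  also have "\<dots> = (\<Sum>p | f p \<noteq> 0. \<Sum>q | g q \<noteq> 0. \<Sum>k<n. entry_weight i k p (f p) * entry_weight k j q (g q))"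
  proof (intro sum.cong refl)
    fix p q assume "p \<in> {p. f p \<noteq> 0}" "q \<in> {q. g q \<noteq> 0}"
    then have pq: "is_path n \<sigma> p" "is_path n \<sigma> q" "hd q \<in> frozen n" using f g hd supp_path by blast+
    then obtain m where m: "m < n" "hd q = side n m" by (auto simp: frozen_eq)
    have "entry_weight i k p (f p) * entry_weight k j q (g q) = 0" if "k \<in> {..<n} - {m}" for k
      using that side_inj[of k m] m by (auto simp: entry_weight_def)
    then have "(\<Sum>k\<in>{..<n} - {m}. entry_weight i k p (f p) * entry_weight k j q (g q)) = 0"
      by (intro sum.neutral) blast
    then have "(\<Sum>k<n. entry_weight i k p (f p) * entry_weight k j q (g q))
      = entry_weight i m p (f p) * entry_weight m j q (g q)"
      using sum.remove[of "{..<n}" m "\<lambda>k. entry_weight i k p (f p) * entry_weight k j q (g q)"] m(1) by simp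
    also have "\<dots> = (if last p = hd q then entry_weight i j (p @ tl q) (f p * g q) else 0)"
    proof (cases "last p = hd q \<and> hd p = side n i \<and> last q = side n j")
      case True
      then show ?thesis
        using path_ends[OF pq(1,2)] side_level_append[OF pq(1) _ _ pq(2), of i m j] m ij
        by (simp add: entry_weight_def const_fract_simps X_powi_add mult_ac)
    next
      case False
      then show ?thesis using path_ends[OF pq(1,2)] m by (auto simp: entry_weight_def)
    qed
    finally show "(if last p = hd q then entry_weight i j (p @ tl q) (f p * g q) else 0)
      = (\<Sum>k<n. entry_weight i k p (f p) * entry_weight k j q (g q))" ..
  qed
  also have "\<dots> = (\<Sum>p | f p \<noteq> 0. \<Sum>k<n. \<Sum>q | g q \<noteq> 0. entry_weight i k p (f p) * entry_weight k j q (g q))"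
    by (intro sum.cong refl sum.swap)
  also have "\<dots> = (\<Sum>k<n. \<Sum>p | f p \<noteq> 0. \<Sum>q | g q \<noteq> 0. entry_weight i k p (f p) * entry_weight k j q (g q))"
    by (rule sum.swap)
  also have "\<dots> = (\<Sum>k<n. entry i k f * entry k j g)"
    unfolding entry_def weighted_sum_def sum_product ..
  finally show ?thesis .
qed

text \<open>The entry with the power \<open>X_fract powi tile_exp n i j\<close> split off. The
  conversion by \<open>nat\<close> loses nothing, since the twists of a path between sides are
  bounded below by \<open>tile_exp\<close>.\<close>

definition entry_poly :: "nat \<Rightarrow> nat \<Rightarrow> 'k::field pathalg \<Rightarrow> 'k poly" where
  "entry_poly i j f = (\<Sum>p | f p \<noteq> 0. if hd p = side n i \<and> last p = side n j
     then monom (f p) (nat (side_level i j p - tile_exp n i j)) else 0)"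

lemma entry_eq_entry_poly:
  assumes f: "f \<in> carrier PA" and ij: "i < n" "j < n"
  shows "entry i j f = Fract (entry_poly i j f) 1 * X_fract powi tile_exp n i j"
  unfolding entry_def weighted_sum_def entry_poly_def Fract_one_sum sum_distrib_right
proof (intro sum.cong refl)
  fix p assume "p \<in> {p. f p \<noteq> 0}"
  then have p: "is_path n \<sigma> p" using supp_path f by blast
  show "entry_weight i j p (f p) = Fract (if hd p = side n i \<and> last p = side n j
      then monom (f p) (nat (side_level i j p - tile_exp n i j)) else 0) 1 * X_fract powi tile_exp n i j"
  proof (cases "hd p = side n i \<and> last p = side n j")
    case True
    then have le: "tile_exp n i j \<le> side_level i j p" using side_level_eq(2)[OF p _ _ ij] by blast
    have "(X_fract :: 'a poly fract) ^ nat (side_level i j p - tile_exp n i j) * X_fract powi tile_exp n i j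
       = X_fract powi (side_level i j p - tile_exp n i j + tile_exp n i j)"
      unfolding X_powi_add using le by (simp add: power_int_def)
    then have "(X_fract :: 'a poly fract) ^ nat (side_level i j p - tile_exp n i j) * X_fract powi tile_exp n i j
       = X_fract powi side_level i j p" by simp
    then show ?thesis using True by (simp add: entry_weight_def Fract_monom mult.assoc)
  next
    case False
    then show ?thesis by (auto simp: entry_weight_def Fract_one_zero)
  qed
qed

text \<open>Degree and number of twists determine each other between fixed sides, so each
  coefficient collects precisely one class of paths. This is the dictionary between matrix entries
  and the kernel.\<close>

lemma coeff_entry_poly:
  assumes f: "f \<in> carrier PA" and ij: "i < n" "j < n"
  shows "coeff (entry_poly i j f) k =
    class_sum (side n i) (side n j) (int n * (int k + tile_exp n i j) + 2 * int j - 2 * int i) f"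
  unfolding entry_poly_def coeff_sum class_sum_def weighted_sum_def
proof (intro sum.cong refl)
  fix p assume "p \<in> {p. f p \<noteq> 0}"
  then have p: "is_path n \<sigma> p" using supp_path f by blast
  show "coeff (if hd p = side n i \<and> last p = side n j
        then monom (f p) (nat (side_level i j p - tile_exp n i j)) else 0) k
    = (if hd p = side n i \<and> last p = side n j \<and>
        path_deg p = int n * (int k + tile_exp n i j) + 2 * int j - 2 * int i then f p else 0)"
  proof (cases "hd p = side n i \<and> last p = side n j")
    case True
    then have l: "path_deg p = int n * side_level i j p + 2 * int j - 2 * int i"
      "tile_exp n i j \<le> side_level i j p" using side_level_eq[OF p _ _ ij] by blast+
    have "path_deg p = int n * (int k + tile_exp n i j) + 2 * int j - 2 * int i
      \<longleftrightarrow> side_level i j p = int k + tile_exp n i j"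
      using l(1) n_ge_3 by simp
    also have "\<dots> \<longleftrightarrow> nat (side_level i j p - tile_exp n i j) = k" using l(2) by auto
    finally show ?thesis using True by simp
  qed auto
qed

definition corner_elems :: "'k::field pathalg set" where
  "corner_elems = {f \<in> carrier PA. \<forall>p. f p \<noteq> 0 \<longrightarrow> hd p \<in> frozen n \<and> last p \<in> frozen n}"

text \<open>A nonzero class sum is witnessed by a path between two sides; its number of twists makes
  the class sum a coefficient of the corresponding entry, which would then be nonzero.\<close>

lemma corner_elems_kernel:
  fixes f :: "'a::field pathalg"
  assumes f: "f \<in> corner_elems" and zero: "\<And>i j. i < n \<Longrightarrow> j < n \<Longrightarrow> entry i j f = 0"
  shows "f \<in> class_kernel"
proof -
  have fc: "f \<in> carrier PA" using f by (simp add: corner_elems_def)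
  have poly0: "entry_poly i j f = 0" if "i < n" "j < n" for i j
  proof -
    have "Fract (entry_poly i j f) 1 * X_fract powi tile_exp n i j = (0 :: 'a poly fract)"
      using zero[OF that] entry_eq_entry_poly[OF fc that] by simp
    then have "Fract (entry_poly i j f) 1 = (Fract 0 1 :: 'a poly fract)"
      using X_fract_nonzero[where 'k = 'a] by (simp add: Fract_one_zero)
    then show ?thesis by (simp only: Fract_one_inj)
  qed
  have "class_sum e e' d f = 0" for e e' d
  proof (rule ccontr)
    assume ns: "class_sum e e' d f \<noteq> 0"
    then obtain p where p: "f p \<noteq> 0" "hd p = e" "last p = e'" "path_deg p = d"
      unfolding class_sum_def weighted_sum_def
      by (elim sum.not_neutral_contains_not_neutral) (auto split: if_splits)
    have "hd p \<in> frozen n" "last p \<in> frozen n" using f p(1) by (auto simp: corner_elems_def)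
    then obtain i j where ij: "i < n" "j < n" "hd p = side n i" "last p = side n j"
      by (auto simp: frozen_eq)
    have pp: "is_path n \<sigma> p" using supp_path[OF fc p(1)] .
    let ?k = "nat (side_level i j p - tile_exp n i j)"
    have "int ?k + tile_exp n i j = side_level i j p" using side_level_eq(2)[OF pp ij(3,4,1,2)] by simp
    then have "d = int n * (int ?k + tile_exp n i j) + 2 * int j - 2 * int i"
      using side_level_eq(1)[OF pp ij(3,4,1,2)] p(4) by simp
    then have "class_sum e e' d f = coeff (entry_poly i j f) ?k"
      using coeff_entry_poly[OF fc ij(1,2)] p(2,3) ij(3,4) by simp
    then show False using ns poly0 ij by simp
  qed
  then show ?thesis using fc by (simp add: class_kernel_def)
qed

lemma kernel_entry: "f \<in> class_kernel \<Longrightarrow> i < n \<Longrightarrow> j < n \<Longrightarrow> entry i j f = 0"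
proof -
  assume f: "f \<in> class_kernel" and ij: "i < n" "j < n"
  then have fc: "f \<in> carrier PA" by (simp add: class_kernel_def)
  have "entry_poly i j f = 0"
    using coeff_entry_poly[OF fc ij] f by (intro poly_eqI) (simp add: class_kernel_def)
  then show ?thesis using entry_eq_entry_poly[OF fc ij] by (simp add: Fract_one_zero)
qed

section \<open>The element C and its matrix\<close>

definition base_cycle :: "nat set \<Rightarrow> nat set list" where
  "base_cycle e = (SOME c. c \<in> min_cycles_at n \<sigma> e)"

lemma base_cycle_props:
  assumes "e \<in> edges n \<sigma>"
  shows "is_path n \<sigma> (base_cycle e)" "hd (base_cycle e) = e" "last (base_cycle e) = e"
    "path_deg (base_cycle e) = int n"
proof -
  have "base_cycle e \<in> min_cycles_at n \<sigma> e"
    unfolding base_cycle_def using min_cycles_at_nonempty[OF assms] by (simp add: some_in_eq)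
  then show "is_path n \<sigma> (base_cycle e)" "hd (base_cycle e) = e" "last (base_cycle e) = e"
    "path_deg (base_cycle e) = int n" by (rule min_cycles_at_props)+
qed

lemma C_elem_eq: "C_elem n \<sigma> = (\<Sum>e\<in>edges n \<sigma>. path_elem (base_cycle e))"
  by (simp add: C_elem_def base_cycle_def)

lemma C_elem_in_PA: "C_elem n \<sigma> \<in> carrier PA"
  unfolding C_elem_eq by (rule PA_sum) (simp add: path_elem_in_PA base_cycle_props)

text \<open>A minimal cycle has degree n, which is one twist, whichever cycle was chosen at the
  side.\<close>

lemma entry_C_elem:
  assumes "i < n" "j < n"
  shows "entry i j (C_elem n \<sigma>) = (if i = j then X_fract else 0)"
proof -
  have side: "side n i \<in> edges n \<sigma>" using frozen_subset frozen_eq assms by auto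
  have "entry i j (C_elem n \<sigma>) = (\<Sum>e\<in>edges n \<sigma>. entry i j (path_elem (base_cycle e)))"
    unfolding C_elem_eq by (rule entry_sum) (simp add: path_elem_in_PA base_cycle_props)
  also have "\<dots> = (\<Sum>e\<in>edges n \<sigma>. if e = side n i then (if i = j then X_fract else 0) else 0)"
  proof (intro sum.cong refl)
    fix e assume "e \<in> edges n \<sigma>"
    note b = base_cycle_props[OF this]
    have "side_level i i (base_cycle e) = 1" using b(4) n_ge_3 by (simp add: side_level_def)
    then show "entry i j (path_elem (base_cycle e)) = (if e = side n i then (if i = j then X_fract else 0) else 0)"
      unfolding entry_path_elem b(2,3) using side_inj[OF assms] by auto
  qed
  also have "\<dots> = (if i = j then X_fract else 0)" using side finite_edges by simp
  finally show ?thesis .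
qed

lemma entry_C_pmult:
  assumes f: "f \<in> corner_elems" and ij: "i < n" "j < n"
  shows "entry i j (pmult (C_elem n \<sigma>) f) = X_fract * entry i j f"
proof -
  have "entry i j (pmult (C_elem n \<sigma>) f) = (\<Sum>k<n. entry i k (C_elem n \<sigma>) * entry k j f)"
    by (rule entry_pmult) (use f ij C_elem_in_PA in \<open>auto simp: corner_elems_def\<close>)
  also have "\<dots> = (\<Sum>k<n. if k = i then X_fract * entry i j f else 0)"
    by (intro sum.cong refl) (use ij in \<open>auto simp: entry_C_elem\<close>)
  also have "\<dots> = X_fract * entry i j f" using ij by simp
  finally show ?thesis .
qed

lemma corner_elems_in_PA: "f \<in> corner_elems \<Longrightarrow> f \<in> carrier PA"
  by (simp add: corner_elems_def)

lemma corner_elems_plus: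
  assumes "f \<in> corner_elems" "g \<in> corner_elems" shows "f + g \<in> corner_elems"
proof -
  have "hd p \<in> frozen n \<and> last p \<in> frozen n" if "(f + g) p \<noteq> 0" for p
    using that assms by (cases "f p = 0") (auto simp: corner_elems_def)
  then show ?thesis using assms PA_plus by (auto simp: corner_elems_def)
qed

lemma corner_elems_scal: "f \<in> corner_elems \<Longrightarrow> scal c f \<in> corner_elems"
  using supp_scal[of c f] PA_scal unfolding corner_elems_def by blast

lemma corner_elems_zero: "0 \<in> corner_elems"
  using zero_in_PA by (simp add: corner_elems_def zero_fun_def)

lemma corner_elems_sum: "(\<And>x. x \<in> S \<Longrightarrow> f x \<in> corner_elems) \<Longrightarrow> (\<Sum>x\<in>S. f x) \<in> corner_elems"
  by (induction S rule: infinite_finite_induct) (auto simp: corner_elems_plus corner_elems_zero)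

lemma corner_elems_minus: "f \<in> corner_elems \<Longrightarrow> g \<in> corner_elems \<Longrightarrow> f - g \<in> corner_elems"
  using corner_elems_plus[of f "scal (-1) g"] corner_elems_scal[of g "-1"]
  by (simp add: scal_def plus_fun_def fun_diff_def)

lemma corner_elems_pmult:
  assumes "f \<in> corner_elems" "g \<in> corner_elems" shows "pmult f g \<in> corner_elems"
proof -
  have "hd r \<in> frozen n \<and> last r \<in> frozen n" if r: "pmult f g r \<noteq> 0" for r
  proof -
    have "r \<in> (\<lambda>(p, q). p @ tl q) ` {(p, q). f p \<noteq> 0 \<and> g q \<noteq> 0 \<and> last p = hd q}"
      using r supp_pmult[of f g] by blast
    then obtain p q where pq: "f p \<noteq> 0" "g q \<noteq> 0" "last p = hd q" "r = p @ tl q" by auto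
    moreover have "is_path n \<sigma> p" "is_path n \<sigma> q"
      using pq assms supp_path[of f p] supp_path[of g q] by (simp_all add: corner_elems_def)
    ultimately show ?thesis using assms path_ends[of p q] by (simp add: corner_elems_def)
  qed
  then show ?thesis using assms pmult_in_PA by (auto simp: corner_elems_def)
qed

lemma path_elem_corner:
  "is_path n \<sigma> p \<Longrightarrow> hd p \<in> frozen n \<Longrightarrow> last p \<in> frozen n \<Longrightarrow> path_elem p \<in> corner_elems"
  using path_elem_in_PA[of p] by (auto simp: corner_elems_def path_elem_def)

lemma finite_frozen: "finite (frozen n)"
  by (simp add: frozen_eq)

definition frozen_idem :: "'k::field pathalg" where
  "frozen_idem = (\<Sum>i\<in>frozen n. path_elem [i])"

lemma frozen_idem_corner: "frozen_idem \<in> corner_elems"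
  unfolding frozen_idem_def
  by (intro corner_elems_sum path_elem_corner) (use frozen_subset is_path_singleton in auto)

lemma frozen_idem_left:
  "f \<in> carrier PA \<Longrightarrow> pmult frozen_idem f = (\<lambda>r. if hd r \<in> frozen n then f r else 0)"
  unfolding frozen_idem_def by (rule pmult_trivial_paths_left[OF finite_frozen PA_finite PA_Nil])

lemma frozen_idem_right:
  "f \<in> carrier PA \<Longrightarrow> pmult f frozen_idem = (\<lambda>r. if last r \<in> frozen n then f r else 0)"
  unfolding frozen_idem_def by (rule pmult_trivial_paths_right[OF finite_frozen PA_finite PA_Nil])

lemma frozen_idem_conj:
  assumes "f \<in> carrier PA"
  shows "pmult (pmult frozen_idem f) frozen_idem \<in> corner_elems"
proof -
  have c: "pmult frozen_idem f \<in> carrier PA"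
    by (rule pmult_in_PA[OF corner_elems_in_PA[OF frozen_idem_corner] assms])
  then have "pmult (pmult frozen_idem f) frozen_idem \<in> carrier PA"
    by (rule pmult_in_PA[OF _ corner_elems_in_PA[OF frozen_idem_corner]])
  moreover have "hd r \<in> frozen n \<and> last r \<in> frozen n"
    if "pmult (pmult frozen_idem f) frozen_idem r \<noteq> 0" for r
  proof -
    have "last r \<in> frozen n" "pmult frozen_idem f r \<noteq> 0"
      using that unfolding frozen_idem_right[OF c] by (simp_all split: if_splits)
    then show ?thesis unfolding frozen_idem_left[OF assms] by (simp split: if_splits)
  qed
  ultimately show ?thesis by (simp add: corner_elems_def)
qed

lemma frozen_idem_conj_id:
  assumes "f \<in> corner_elems" shows "pmult (pmult frozen_idem f) frozen_idem = f"
proof -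
  have 1: "pmult frozen_idem f = f"
    unfolding frozen_idem_left[OF corner_elems_in_PA[OF assms]]
    using assms by (intro ext) (auto simp: corner_elems_def)
  show ?thesis
    unfolding 1 frozen_idem_right[OF corner_elems_in_PA[OF assms]]
    using assms by (intro ext) (auto simp: corner_elems_def)
qed

lemma entry_frozen_idem:
  assumes "i < n" "j < n"
  shows "entry i j frozen_idem = (if i = j then 1 else 0)"
proof -
  have side: "side n i \<in> frozen n" using frozen_eq assms by auto
  have "entry i j frozen_idem = (\<Sum>e\<in>frozen n. entry i j (path_elem [e]))"
    unfolding frozen_idem_def
    by (rule entry_sum) (use frozen_subset is_path_singleton path_elem_in_PA in auto)
  also have "\<dots> = (\<Sum>e\<in>frozen n. if e = side n i then (if i = j then 1 else 0) else 0)"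
    by (intro sum.cong refl) (use side_inj[OF assms] in \<open>auto simp: entry_path_elem side_level_def\<close>)
  also have "\<dots> = (if i = j then 1 else 0)" using side finite_frozen by simp
  finally show ?thesis .
qed

section \<open>The matrix of a corner element\<close>

definition corner_mat :: "'k::field pathalg \<Rightarrow> 'k poly fract mat" where
  "corner_mat f = mat n n (\<lambda>(i, j). entry i j f)"

lemma corner_mat_pmult:
  assumes "f \<in> corner_elems" "g \<in> corner_elems"
  shows "corner_mat (pmult f g) = corner_mat f * corner_mat g"
proof (rule eq_matI)
  fix i j assume "i < dim_row (corner_mat f * corner_mat g)" "j < dim_col (corner_mat f * corner_mat g)"
  then have ij: "i < n" "j < n" by (simp_all add: corner_mat_def)
  have "entry i j (pmult f g) = (\<Sum>k<n. entry i k f * entry k j g)"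
    by (rule entry_pmult) (use assms ij in \<open>auto simp: corner_elems_def\<close>)
  then show "corner_mat (pmult f g) $$ (i, j) = (corner_mat f * corner_mat g) $$ (i, j)"
    using ij by (simp add: corner_mat_def scalar_prod_def atLeast0LessThan)
qed (simp_all add: corner_mat_def)

lemma corner_mat_plus:
  "f \<in> carrier PA \<Longrightarrow> g \<in> carrier PA \<Longrightarrow> corner_mat (f + g) = corner_mat f + corner_mat g"
  by (rule eq_matI) (simp_all add: corner_mat_def entry_plus)

lemma corner_mat_idem: "corner_mat frozen_idem = 1\<^sub>m n"
  by (rule eq_matI) (simp_all add: corner_mat_def entry_frozen_idem)

lemma corner_mat_tiled:
  assumes "f \<in> carrier PA" shows "corner_mat f \<in> carrier (tiled_order n)"
proof -
  have "corner_mat f $$ (i, j) \<in> xpowR (tile_exp n i j)" if ij: "i < n" "j < n" for i j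
    using ij entry_eq_entry_poly[OF assms ij] unfolding xpowR_def X_fract_def[symmetric]
    by (auto simp: corner_mat_def)
  then show ?thesis by (simp add: tiled_order_def corner_mat_def)
qed

text \<open>The monomial of degree \<open>k\<close> in the polynomial part of an entry is realised
  by a path from side \<open>i\<close> to side \<open>j\<close> with
  \<open>k + tile_exp n i j\<close> twists; \<open>side_path_exists\<close> provides one for every
  \<open>k\<close>.\<close>

lemma corner_mat_surj:
  fixes A :: "'k::field poly fract mat"
  assumes A: "A \<in> carrier (tiled_order n)"
  obtains f where "f \<in> corner_elems" "corner_mat f = A"
proof -
  have Ac: "A \<in> carrier_mat n n" "\<And>i j. i < n \<Longrightarrow> j < n \<Longrightarrow> A $$ (i, j) \<in> xpowR (tile_exp n i j)"
    using A by (simp_all add: tiled_order_def)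
  have "\<exists>q. i < n \<and> j < n \<longrightarrow> A $$ (i, j) = Fract q 1 * X_fract powi tile_exp n i j" for i j
    using Ac(2)[of i j] unfolding xpowR_def X_fract_def[symmetric] by blast
  then obtain q where q: "\<And>i j. i < n \<Longrightarrow> j < n \<Longrightarrow> A $$ (i, j) = Fract (q i j) 1 * X_fract powi tile_exp n i j"
    by metis
  have "\<exists>p. i < n \<and> j < n \<longrightarrow> is_path n \<sigma> p \<and> hd p = side n i \<and> last p = side n j \<and>
      path_deg p = int n * (int k + tile_exp n i j) + 2 * int j - 2 * int i" for i j k
    using side_path_exists[of i j "int k + tile_exp n i j"] by fastforce
  then obtain P where P: "\<And>i j k. i < n \<Longrightarrow> j < n \<Longrightarrow> is_path n \<sigma> (P i j k) \<and> hd (P i j k) = side n i \<and>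
      last (P i j k) = side n j \<and> path_deg (P i j k) = int n * (int k + tile_exp n i j) + 2 * int j - 2 * int i"
    by metis
  define t where "t i j k = (scal (coeff (q i j) k) (path_elem (P i j k)) :: 'k pathalg)" for i j k
  have t: "t i j k \<in> corner_elems" if "i < n" "j < n" for i j k
    unfolding t_def by (intro corner_elems_scal path_elem_corner) (use P[OF that] that frozen_eq in auto)
  have te: "entry i' j' (t i j k) = (if i = i' \<and> j = j'
      then const_fract (coeff (q i j) k) * X_fract ^ k * X_fract powi tile_exp n i j else 0)"
    if "i < n" "j < n" "i' < n" "j' < n" for i j k i' j'
  proof -
    have "side_level i j (P i j k) = int k + tile_exp n i j"
      using P[OF that(1,2), of k] n_ge_3 by (simp add: side_level_def)
    moreover have "side n i = side n i' \<longleftrightarrow> i = i'" "side n j = side n j' \<longleftrightarrow> j = j'"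
      using side_inj that by blast+
    moreover have "(path_elem (P i j k) :: 'k pathalg) \<in> carrier PA"
      using P[OF that(1,2), of k] by (intro path_elem_in_PA) blast
    ultimately show ?thesis
      using P[OF that(1,2), of k]
      by (cases "i = i' \<and> j = j'") (auto simp: t_def entry_scal entry_path_elem X_powi_add mult.assoc)
  qed
  define f where "f = (\<Sum>i<n. \<Sum>j<n. \<Sum>k\<le>degree (q i j). t i j k)"
  have f: "f \<in> corner_elems" unfolding f_def by (intro corner_elems_sum t) auto
  have "entry i' j' f = A $$ (i', j')" if ij: "i' < n" "j' < n" for i' j'
  proof -
    have tc: "t i j k \<in> carrier PA" if "i < n" "j < n" for i j k
      using t[OF that] by (rule corner_elems_in_PA)
    have "entry i' j' f = (\<Sum>i<n. entry i' j' (\<Sum>j<n. \<Sum>k\<le>degree (q i j). t i j k))"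
      unfolding f_def by (rule entry_sum) (use tc in \<open>auto intro!: PA_sum\<close>)
    also have "\<dots> = (\<Sum>i<n. \<Sum>j<n. entry i' j' (\<Sum>k\<le>degree (q i j). t i j k))"
      by (rule sum.cong[OF refl], rule entry_sum) (use tc in \<open>auto intro!: PA_sum\<close>)
    also have "\<dots> = (\<Sum>i<n. \<Sum>j<n. \<Sum>k\<le>degree (q i j). entry i' j' (t i j k))"
      by (rule sum.cong[OF refl], rule sum.cong[OF refl], rule entry_sum) (use tc in auto)
    also have "\<dots> = (\<Sum>i<n. \<Sum>j<n. if i = i' \<and> j = j' then A $$ (i', j') else 0)"
    proof (intro sum.cong refl)
      fix i j assume "i \<in> {..<n}" "j \<in> {..<n}"
      then have ij2: "i < n" "j < n" by auto
      have "Fract (q i j) 1 * X_fract powi tile_exp n i j =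
          (\<Sum>k\<le>degree (q i j). const_fract (coeff (q i j) k) * X_fract ^ k * X_fract powi tile_exp n i j)"
        unfolding Fract_poly_sum[of "q i j"] sum_distrib_right ..
      then show "(\<Sum>k\<le>degree (q i j). entry i' j' (t i j k)) = (if i = i' \<and> j = j' then A $$ (i', j') else 0)"
        using q[OF ij2] te[OF ij2 ij] by (cases "i = i' \<and> j = j'") auto
    qed
    also have "\<dots> = (\<Sum>i<n. if i = i' then \<Sum>j<n. if j = j' then A $$ (i', j') else 0 else 0)"
      by (intro sum.cong refl) auto
    also have "\<dots> = A $$ (i', j')" using ij by simp
    finally show ?thesis .
  qed
  then have "corner_mat f = A" using Ac(1) by (intro eq_matI) (simp_all add: corner_mat_def)
  then show thesis using that f by blast
qed

definition C_poly :: "'k::field poly \<Rightarrow> 'k pathalg" where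
  "C_poly p = finsum PA (\<lambda>k. scal (coeff p k) (C_elem n \<sigma> [^]\<^bsub>PA\<^esub> k)) {..degree p}"

lemma C_pow_in_PA: "C_elem n \<sigma> [^]\<^bsub>PA\<^esub> (k::nat) \<in> carrier PA"
  using monoid.nat_pow_closed[OF ring.is_monoid[OF ring_PA] C_elem_in_PA] .

lemma finsum_PA:
  fixes f :: "'i \<Rightarrow> 'k::field pathalg"
  assumes "finite S" "\<And>x. x \<in> S \<Longrightarrow> f x \<in> carrier PA"
  shows "finsum PA f S = (\<Sum>x\<in>S. f x)"
  using assms
proof (induction S rule: finite_induct)
  case empty
  then show ?case
    using abelian_monoid.finsum_empty[OF abelian_group.axioms(1)[OF ring.is_abelian_group[OF ring_PA]], of f]
    by (simp add: zero_fun_def)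
next
  case (insert x F)
  then show ?case
    using abelian_monoid.finsum_insert[OF abelian_group.axioms(1)[OF ring.is_abelian_group[OF ring_PA]], of F x f]
    by (simp add: PA_add_eq Pi_def plus_fun_def)
qed

lemma C_poly_eq: "C_poly p = (\<Sum>k\<le>degree p. scal (coeff p k) (C_elem n \<sigma> [^]\<^bsub>PA\<^esub> k))"
  unfolding C_poly_def by (rule finsum_PA) (auto intro: PA_scal C_pow_in_PA)

lemma C_poly_in_PA: "C_poly p \<in> carrier PA"
  unfolding C_poly_eq by (intro PA_sum PA_scal C_pow_in_PA)

text \<open>The summands of C are loops, so multiplication on the left does not move the start of a
  path.\<close>

lemma C_pmult_corner:
  assumes f: "f \<in> corner_elems" shows "pmult (C_elem n \<sigma>) f \<in> corner_elems"
proof -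
  have "hd r \<in> frozen n \<and> last r \<in> frozen n" if r: "pmult (C_elem n \<sigma>) f r \<noteq> 0" for r
  proof -
    have "r \<in> (\<lambda>(p, q). p @ tl q) ` {(p, q). C_elem n \<sigma> p \<noteq> (0 :: 'a) \<and> f q \<noteq> 0 \<and> last p = hd q}"
      using r supp_pmult[of "C_elem n \<sigma>" f] by blast
    then obtain p q where pq: "C_elem n \<sigma> p \<noteq> (0 :: 'a)" "f q \<noteq> 0" "last p = hd q" "r = p @ tl q" by auto
    have "(\<Sum>e\<in>edges n \<sigma>. path_elem (base_cycle e) p) \<noteq> (0 :: 'a)"
      using pq(1) by (simp add: C_elem_eq sum_fun_apply)
    then obtain e where "e \<in> edges n \<sigma>" "path_elem (base_cycle e) p \<noteq> (0 :: 'a)"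
      by (rule sum.not_neutral_contains_not_neutral)
    then have "hd p = last p" "is_path n \<sigma> p"
      using base_cycle_props[of e] by (auto simp: path_elem_def split: if_splits)
    moreover have "is_path n \<sigma> q" "hd q \<in> frozen n" "last q \<in> frozen n"
      using f pq(2) supp_path[of f q] by (auto simp: corner_elems_def)
    ultimately show ?thesis using path_ends[of p q] pq(3,4) by simp
  qed
  then show ?thesis using pmult_in_PA[OF C_elem_in_PA corner_elems_in_PA[OF f]] by (simp add: corner_elems_def)
qed

text \<open>The action on corner elements is followed instead of the powers themselves, which may
  have loops at diagonals. One factor is peeled off next to \<open>f\<close>, so the hypothesis is
  applied to \<open>pmult (C_elem n \<sigma>) f\<close>; hence the generalisation over
  \<open>f\<close>.\<close>

lemma C_pow_pmult:
  assumes "f \<in> corner_elems"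
  shows "pmult (C_elem n \<sigma> [^]\<^bsub>PA\<^esub> (k::nat)) f \<in> corner_elems \<and>
    (\<forall>i<n. \<forall>j<n. entry i j (pmult (C_elem n \<sigma> [^]\<^bsub>PA\<^esub> k) f) = X_fract ^ k * entry i j f)"
  using assms
proof (induction k arbitrary: f)
  case 0
  have "C_elem n \<sigma> [^]\<^bsub>PA\<^esub> (0::nat) = (\<Sum>i\<in>edges n \<sigma>. path_elem [i] :: 'a pathalg)"
    unfolding nat_pow_0 by (rule PA_sel(4))
  then have "pmult (C_elem n \<sigma> [^]\<^bsub>PA\<^esub> (0::nat)) f = f"
    using PA_one_left[OF corner_elems_in_PA[OF 0]] by (simp only:)
  then show ?case using 0 by (simp only: power_0 mult_1_left) blast
next
  case (Suc k)
  have "C_elem n \<sigma> [^]\<^bsub>PA\<^esub> Suc k = pmult (C_elem n \<sigma> [^]\<^bsub>PA\<^esub> k) (C_elem n \<sigma> :: 'a pathalg)"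
    by simp
  then have "pmult (C_elem n \<sigma> [^]\<^bsub>PA\<^esub> Suc k) f
      = pmult (C_elem n \<sigma> [^]\<^bsub>PA\<^esub> k) (pmult (C_elem n \<sigma>) f)"
    by (simp only:) (rule pmult_assoc[OF PA_finite[OF C_pow_in_PA] PA_finite[OF C_elem_in_PA]
        PA_finite[OF corner_elems_in_PA[OF Suc.prems]] PA_Nil[OF C_elem_in_PA]])
  then show ?case
    using Suc.IH[OF C_pmult_corner[OF Suc.prems]] entry_C_pmult[OF Suc.prems] by (simp add: mult_ac)
qed

lemma pmult_zero_left: "pmult 0 f = 0"
  by (simp add: pmult_def zero_fun_def)

lemma pmult_sum_left:
  "(\<And>x. x \<in> S \<Longrightarrow> g x \<in> carrier PA) \<Longrightarrow> f \<in> carrier PA \<Longrightarrow> pmult (\<Sum>x\<in>S. g x) f = (\<Sum>x\<in>S. pmult (g x) f)"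
proof (induction S rule: infinite_finite_induct)
  case (insert x F)
  have "pmult (g x + (\<Sum>x\<in>F. g x)) f = pmult (g x) f + pmult (\<Sum>x\<in>F. g x) f"
    by (rule pmult_plus_left[OF _ PA_sum]) (use insert.prems in auto)
  moreover have "pmult (\<Sum>x\<in>F. g x) f = (\<Sum>x\<in>F. pmult (g x) f)"
    by (rule insert.IH) (use insert.prems in auto)
  ultimately show ?case by (simp only: sum.insert[OF insert.hyps])
qed (simp_all only: sum.infinite sum.empty pmult_zero_left not_False_eq_True)

lemma C_poly_pmult:
  assumes f: "f \<in> corner_elems"
  shows "pmult (C_poly p) f \<in> corner_elems"
    "corner_mat (pmult (C_poly p) f) = Fract p 1 \<cdot>\<^sub>m corner_mat f"
proof -
  let ?C = "C_elem n \<sigma> :: 'a pathalg"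
  have e: "pmult (C_poly p) f = (\<Sum>k\<le>degree p. scal (coeff p k) (pmult (?C [^]\<^bsub>PA\<^esub> k) f))"
    unfolding C_poly_eq
    by (subst pmult_sum_left)
      (auto intro!: sum.cong pmult_scal_left PA_finite PA_scal C_pow_in_PA corner_elems_in_PA[OF f])
  show c: "pmult (C_poly p) f \<in> corner_elems"
    unfolding e by (intro corner_elems_sum corner_elems_scal conjunct1[OF C_pow_pmult[OF f]])
  have "entry i j (pmult (C_poly p) f) = Fract p 1 * entry i j f" if ij: "i < n" "j < n" for i j
  proof -
    have k: "pmult (?C [^]\<^bsub>PA\<^esub> k) f \<in> carrier PA" for k :: nat
      using C_pow_pmult[OF f] corner_elems_in_PA by blast
    have "entry i j (pmult (C_poly p) f)
        = (\<Sum>k\<le>degree p. entry i j (scal (coeff p k) (pmult (?C [^]\<^bsub>PA\<^esub> k) f)))"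
      unfolding e by (rule entry_sum) (rule PA_scal[OF k])
    also have "\<dots> = (\<Sum>k\<le>degree p. const_fract (coeff p k) * X_fract ^ k * entry i j f)"
      using C_pow_pmult[OF f] ij by (intro sum.cong refl) (simp add: entry_scal[OF k] mult.assoc)
    also have "\<dots> = Fract p 1 * entry i j f"
      unfolding Fract_poly_sum[of p] sum_distrib_right ..
    finally show ?thesis .
  qed
  then show "corner_mat (pmult (C_poly p) f) = Fract p 1 \<cdot>\<^sub>m corner_mat f"
    by (intro eq_matI) (simp_all add: corner_mat_def)
qed

end

section \<open>Passage to the quotient and the isomorphism\<close>

context frozen_jacobian_algebra
begin

abbreviation \<Gamma> :: "'k pathalg set ring" where "\<Gamma> \<equiv> frozen_jacobian n \<sigma>"

lemma cls_mult:
  fixes f g :: "'k pathalg"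
  assumes "f \<in> carrier PA" "g \<in> carrier PA"
  shows "cls n \<sigma> f \<otimes>\<^bsub>\<Gamma>\<^esub> cls n \<sigma> g = cls n \<sigma> (pmult f g)"
  using ideal.rcoset_mult_add[OF J_ideal assms] by (simp add: frozen_jacobian_def FactRing_def cls_def)

lemma cls_add:
  fixes f g :: "'k pathalg"
  assumes "f \<in> carrier PA" "g \<in> carrier PA"
  shows "cls n \<sigma> f \<oplus>\<^bsub>\<Gamma>\<^esub> cls n \<sigma> g = cls n \<sigma> (f + g)"
  using ideal.a_rcos_sum[OF J_ideal assms] unfolding PA_add_eq
  by (simp add: frozen_jacobian_def FactRing_def cls_def)

lemma carrier_Gamma: "carrier \<Gamma> = cls n \<sigma> ` carrier PA"
  by (auto simp: frozen_jacobian_def FactRing_def A_RCOSETS_def' cls_def)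

text \<open>The coset criterion for \<open>J\<close> is restated through
  \<open>class_kernel\<close>, where matrix entries can test membership.\<close>

lemma cls_eq_iff:
  fixes f g :: "'k pathalg"
  assumes "f \<in> carrier PA" "g \<in> carrier PA"
  shows "cls n \<sigma> f = cls n \<sigma> g \<longleftrightarrow> f - g \<in> class_kernel"
proof -
  interpret ring "PA :: 'k pathalg ring" by (rule ring_PA)
  have "\<ominus>\<^bsub>PA\<^esub> g = - g"
    by (rule minus_equality) (use assms PA_uminus in \<open>simp_all add: fun_eq_iff\<close>)
  then have "f \<ominus>\<^bsub>PA\<^esub> g = f - g" unfolding a_minus_def PA_add_eq by simp
  then show ?thesis
    using quotient_eq_iff_same_a_r_cos[OF J_ideal assms] by (simp add: cls_def J_eq_class_kernel)
qed

lemma eF_eq: "eF n \<sigma> = cls n \<sigma> (frozen_idem :: 'k pathalg)"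
  by (simp add: eF_def frozen_idem_def)

abbreviation corner_ring :: "'k pathalg set ring" where "corner_ring \<equiv> corner \<Gamma> (eF n \<sigma>)"

text \<open>Conjugation by the idempotent keeps only paths between sides and fixes combinations of
  such paths, so each coset of the corner has a representative in
  \<open>corner_elems\<close>.\<close>

lemma carrier_corner: "carrier corner_ring = cls n \<sigma> ` corner_elems"
proof -
  let ?e = "frozen_idem :: 'k pathalg"
  have e: "?e \<in> carrier PA" by (rule corner_elems_in_PA[OF frozen_idem_corner])
  have conj: "eF n \<sigma> \<otimes>\<^bsub>\<Gamma>\<^esub> cls n \<sigma> f \<otimes>\<^bsub>\<Gamma>\<^esub> eF n \<sigma> = cls n \<sigma> (pmult (pmult ?e f) ?e)"
    if "f \<in> carrier PA" for f
    unfolding eF_eq cls_mult[OF e that] by (rule cls_mult[OF pmult_in_PA[OF e that] e])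
  show ?thesis
  proof
    show "carrier corner_ring \<subseteq> cls n \<sigma> ` corner_elems"
      unfolding corner_def carrier_Gamma using conj frozen_idem_conj by auto
    show "cls n \<sigma> ` corner_elems \<subseteq> carrier corner_ring"
    proof
      fix a assume "a \<in> cls n \<sigma> ` (corner_elems :: 'k pathalg set)"
      then obtain f :: "'k pathalg" where f: "a = cls n \<sigma> f" "f \<in> corner_elems" by blast
      then have "a = eF n \<sigma> \<otimes>\<^bsub>\<Gamma>\<^esub> cls n \<sigma> f \<otimes>\<^bsub>\<Gamma>\<^esub> eF n \<sigma>"
        using conj[OF corner_elems_in_PA[OF f(2)]] frozen_idem_conj_id[OF f(2)] by simp
      then show "a \<in> carrier corner_ring"
        using corner_elems_in_PA[OF f(2)] by (auto simp: corner_def carrier_Gamma)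
    qed
  qed
qed

text \<open>A chosen representative suffices because entries between sides vanish on the kernel; the
  choice need not lie in \<open>corner_elems\<close>.\<close>

definition corner_iso :: "'k pathalg set \<Rightarrow> 'k poly fract mat" where
  "corner_iso a = corner_mat (SOME f. f \<in> carrier PA \<and> cls n \<sigma> f = a)"

lemma corner_iso_cls:
  assumes f: "f \<in> carrier PA" shows "corner_iso (cls n \<sigma> f) = corner_mat f"
proof -
  define g where "g = (SOME g. g \<in> carrier PA \<and> cls n \<sigma> g = cls n \<sigma> f)"
  have "g \<in> carrier PA \<and> cls n \<sigma> g = cls n \<sigma> f"
    unfolding g_def by (rule someI[of _ f]) (use f in simp)
  then have g: "g \<in> carrier PA" "g - f \<in> class_kernel" using cls_eq_iff f by blast+
  have "entry i j g = entry i j f" if "i < n" "j < n" for i j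
    using kernel_entry[OF g(2) that] entry_minus[OF g(1) f] by simp
  then have "corner_mat g = corner_mat f" by (intro eq_matI) (simp_all add: corner_mat_def)
  then show ?thesis by (simp add: corner_iso_def g_def)
qed

text \<open>The confluence argument pays off here: equal matrices give a difference without class
  sums, and such a difference lies in \<open>J\<close>.\<close>

lemma corner_mat_inj:
  assumes "f \<in> corner_elems" "g \<in> corner_elems" "corner_mat f = corner_mat g"
  shows "cls n \<sigma> f = cls n \<sigma> (g :: 'k pathalg)"
proof -
  note c = assms(1,2)[THEN corner_elems_in_PA]
  have "f - g \<in> class_kernel"
  proof (rule corner_elems_kernel)
    fix i j assume ij: "i < n" "j < n"
    then have "entry i j f = entry i j g"
      using arg_cong[OF assms(3), of "\<lambda>A. A $$ (i, j)"] by (simp add: corner_mat_def)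
    then show "entry i j (f - g) = 0" using entry_minus[OF c] by simp
  qed (rule corner_elems_minus[OF assms(1,2)])
  then show ?thesis using cls_eq_iff[OF c] by simp
qed

lemma corner_iso_ring_iso: "corner_iso \<in> ring_iso corner_ring (tiled_order n)"
proof -
  have sel: "Group.monoid.mult corner_ring = Group.monoid.mult \<Gamma>" "add corner_ring = add \<Gamma>"
    "one corner_ring = eF n \<sigma>" by (simp_all add: corner_def)
  have tsel: "Group.monoid.mult (tiled_order n) = ((*) :: 'k poly fract mat \<Rightarrow> _)"
    "add (tiled_order n) = ((+) :: 'k poly fract mat \<Rightarrow> _)"
    "one (tiled_order n) = (1\<^sub>m n :: 'k poly fract mat)" by (simp_all add: tiled_order_def)
  have iso: "corner_iso (cls n \<sigma> f) = corner_mat f" if "f \<in> corner_elems" for f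
    by (rule corner_iso_cls[OF corner_elems_in_PA[OF that]])
  have tiled: "corner_iso a \<in> carrier (tiled_order n)" if a: "a \<in> carrier corner_ring" for a
  proof -
    obtain f where "f \<in> corner_elems" "a = cls n \<sigma> f" using a unfolding carrier_corner by blast
    then show ?thesis using iso corner_mat_tiled[OF corner_elems_in_PA] by simp
  qed
  have "corner_iso \<in> Ring.ring_hom corner_ring (tiled_order n)"
  proof (rule ring_hom_memI)
    fix a assume "a \<in> carrier corner_ring"
    then show "corner_iso a \<in> carrier (tiled_order n)" by (rule tiled)
  next
    fix a b assume "a \<in> carrier corner_ring" "b \<in> carrier corner_ring"
    then obtain f g :: "'k pathalg" where fg: "f \<in> corner_elems" "g \<in> corner_elems"
      and ab: "a = cls n \<sigma> f" "b = cls n \<sigma> g" unfolding carrier_corner by blast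
    note c = fg[THEN corner_elems_in_PA]
    show "corner_iso (a \<otimes>\<^bsub>corner_ring\<^esub> b) = corner_iso a \<otimes>\<^bsub>tiled_order n\<^esub> corner_iso b"
      unfolding sel tsel ab cls_mult[OF c] iso[OF corner_elems_pmult[OF fg]] iso[OF fg(1)] iso[OF fg(2)]
      by (rule corner_mat_pmult[OF fg])
    show "corner_iso (a \<oplus>\<^bsub>corner_ring\<^esub> b) = corner_iso a \<oplus>\<^bsub>tiled_order n\<^esub> corner_iso b"
      unfolding sel tsel ab cls_add[OF c] iso[OF corner_elems_plus[OF fg]] iso[OF fg(1)] iso[OF fg(2)]
      by (rule corner_mat_plus[OF c])
  next
    show "corner_iso \<one>\<^bsub>corner_ring\<^esub> = \<one>\<^bsub>tiled_order n\<^esub>"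
      unfolding sel tsel unfolding eF_eq iso[OF frozen_idem_corner] by (rule corner_mat_idem)
  qed
  moreover have "bij_betw corner_iso (carrier corner_ring) (carrier (tiled_order n))"
    unfolding bij_betw_def
  proof
    show "inj_on corner_iso (carrier corner_ring)"
    proof (rule inj_onI)
      fix a b assume "a \<in> carrier corner_ring" "b \<in> carrier corner_ring" and eq: "corner_iso a = corner_iso b"
      then obtain f g :: "'k pathalg" where fg: "f \<in> corner_elems" "g \<in> corner_elems"
        and ab: "a = cls n \<sigma> f" "b = cls n \<sigma> g" unfolding carrier_corner by blast
      show "a = b"
        unfolding ab by (rule corner_mat_inj[OF fg]) (use eq in \<open>simp only: ab iso[OF fg(1)] iso[OF fg(2)]\<close>)
    qed
    show "corner_iso ` carrier corner_ring = carrier (tiled_order n)"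
    proof
      show "corner_iso ` carrier corner_ring \<subseteq> carrier (tiled_order n)"
        using tiled by blast
      show "carrier (tiled_order n) \<subseteq> corner_iso ` carrier corner_ring"
      proof
        fix A :: "'k poly fract mat" assume "A \<in> carrier (tiled_order n)"
        then obtain f where "f \<in> corner_elems" "corner_mat f = A" by (rule corner_mat_surj)
        then show "A \<in> corner_iso ` carrier corner_ring" unfolding carrier_corner using iso by force
      qed
    qed
  qed
  ultimately show ?thesis by (simp add: ring_iso_def)
qed

text \<open>The scalar acts on a representative through \<open>C_poly\<close>, and each factor C
  multiplies the matrix of a corner element by \<open>X_fract\<close>; this is the linearity over
  polynomials that makes the ring isomorphism one of orders.\<close>

lemma corner_iso_rho:
  assumes "a \<in> carrier corner_ring"
  shows "corner_iso (rho_Gamma n \<sigma> p \<otimes>\<^bsub>\<Gamma>\<^esub> a) = rho_Lambda n p * corner_iso a"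
proof -
  obtain f where f: "f \<in> corner_elems" "a = cls n \<sigma> f" using assms unfolding carrier_corner by blast
  note c = corner_elems_in_PA[OF f(1)]
  have "rho_Gamma n \<sigma> p \<otimes>\<^bsub>\<Gamma>\<^esub> a = cls n \<sigma> (pmult (C_poly p) f)"
    unfolding rho_Gamma_def C_poly_def[symmetric] f(2) by (rule cls_mult[OF C_poly_in_PA c])
  then have "corner_iso (rho_Gamma n \<sigma> p \<otimes>\<^bsub>\<Gamma>\<^esub> a) = Fract p 1 \<cdot>\<^sub>m corner_mat f"
    using corner_iso_cls[OF corner_elems_in_PA[OF C_poly_pmult(1)[OF f(1)]]] C_poly_pmult(2)[OF f(1)] by simp
  also have "\<dots> = rho_Lambda n p * corner_mat f"
  proof -
    have m: "corner_mat f \<in> carrier_mat n n" by (simp add: corner_mat_def)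
    show ?thesis
      unfolding rho_Lambda_def mult_smult_assoc_mat[OF one_carrier_mat m] left_mult_one_mat[OF m] ..
  qed
  finally show ?thesis using corner_iso_cls[OF c] f(2) by simp
qed

end

theorem theorem2p25:
  fixes n :: nat and \<sigma> :: "nat set set"
  assumes "n \<ge> 3" and "triangulation n \<sigma>"
  shows "\<exists>\<phi>. \<phi> \<in> ring_iso (corner (frozen_jacobian n \<sigma> :: 'k::field pathalg set ring) (eF n \<sigma>))
                          (tiled_order n :: 'k poly fract mat ring) \<and>
             (\<forall>p :: 'k poly. \<forall>a \<in> carrier (corner (frozen_jacobian n \<sigma>) (eF n \<sigma>)).
                 \<phi> (rho_Gamma n \<sigma> p \<otimes>\<^bsub>frozen_jacobian n \<sigma>\<^esub> a) = rho_Lambda n p * \<phi> a)"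
proof -
  interpret frozen_jacobian_algebra n \<sigma> "TYPE('k)"
    using assms by unfold_locales
  show ?thesis using corner_iso_ring_iso corner_iso_rho by blast
qed

end
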